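(* Let $X=\mathrm{Spec}(\mathbb{C}[S])$ be an affine toric variety, let $H=\{\nu_1,\dots,\nu_r\}\subset\overset{\circ}{\sigma}\cap N$ be a finite set of monomial divisorial valuations, and let $P(\underline t)=P_{X,H}(\underline t)$ be the Poincaré series of the multi-index filtration on $\mathcal{O}_{X,o}$ defined by $H$. Then $$P(\underline t)=\sum_{\underline v\in\mathbb{Z}^r}\chi(\mathbb{P}F_{\underline v})\,\underline t^{\underline v},$$ where $\chi$ denotes the Euler characteristic.
   Context: Setting: $N=\mathbb{Z}^d$, $M$ is the dual lattice with pairing $\langle m,n\rangle$. $\sigma\subset N\otimes_{\mathbb Z}\mathbb{R}$ is a rational polyhedral strongly convex $d$-dimensional cone with interior $\overset{\circ}{\sigma}$, and $\check\sigma$ is its dual cone. $S\subset\check\sigma\cap M$ is a finitely generated semigroup (containing $0$) which generates $\check\sigma$ as a cone and $M$ as a group. $\mathbb{C}[S]=\bigoplus_{s\in S}\mathbb{C}\chi^s$, $X=\mathrm{Spec}(\mathbb{C}[S])$, $o\in X$ is the unique $0$-dimensional torus orbit, and $\mathcal{O}_{X,o}$ is the ring of germs at $o$. Monomial valuations: a lattice point $\nu\in\overset{\circ}{\sigma}\cap N$ defines the valuation $\nu\big(\sum_{m\in F}a_m\chi^m\big)=\min\{\langle m,\nu\rangle\mid m\in F,\ a_m\neq 0\}$, centred at the maximal ideal of $\mathcal{O}_{X,o}$ (primitive lattice points give the normalized valuations). Poincaré series: for $\underline v\in\mathbb{Z}^r$ put $I(\underline v)=\{g\in\mathcal{O}_{X,o}\mid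 \nu_i(g)\ge v_i,\ 1\le i\le r\}$, $\underline 1=(1,\dots,1)$, $d(\underline v)=\dim_{\mathbb C} I(\underline v)/I(\underline v+\underline 1)$ (finite), $L=\sum_{\underline v\in\mathbb{Z}^r}d(\underline v)\,\underline t^{\underline v}$. Then $\prod_{i=1}^r(t_i-1)L\in\mathbb{Z}[[t_1,\dots,t_r]]$ and $P_{X,H}(\underline t)=\prod_{i=1}^r(t_i-1)L/(t_1\cdots t_r-1)\in\mathbb{Z}[[t_1,\dots,t_r]]$. The spaces $F_{\underline v}$ (fibers of the extended semigroup): for $1\le j\le r$ let $\underline e_j$ be the $j$-th standard basis vector of $\mathbb{Z}^r$ and $D_j(\underline v)=I(\underline v)/I(\underline v+\underline e_j)$. Let $D(\underline v)$ be the image of the natural map $I(\underline v)\to D_1(\underline v)\times\cdots\times D_r(\underline v)$, so that $D(\underline v)\simeq I(\underline v)/I(\underline v+\underline 1)$ is a finite-dimensional complex vector space, and let $F_{\underline v}=D(\underline v)\cap\prod_{j=1}^r\big(D_j(\underline v)\setminus\{0\}\big)$. $F_{\underline v}$ is invariant under multiplication by nonzero constants, and $\mathbb{P}F_{\underline v}=F_{\underline v}/\mathbb{C}^*$; it is (when nonempty) the complement of an arrangement of projective subspaces in the projective space $\mathbb{P}D(\underline v)$. *)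

theory Defs
  imports
    "Jordan_Normal_Form.Missing_VectorSpace"
    "HOL-Analysis.Analysis"
    "HOL-Library.Poly_Mapping"
    "HOL-Homology.Homology"
begin

hide_const (open) Multiset.mult

section \<open>Lattices, cones and semigroups\<close>

text \<open>Both \<open>N\<close> and its dual lattice \<open>M\<close> are represented by \<open>int ^ 'd\<close> (standard basis of \<open>N\<close>, dual
  basis of \<open>M\<close>), and \<open>N \<otimes> \<real>\<close>, \<open>M \<otimes> \<real>\<close> by \<open>real ^ 'd\<close>.\<close>

definition pairing :: "int ^ 'd \<Rightarrow> int ^ 'd \<Rightarrow> int"
  where "pairing m n = (\<Sum>i\<in>UNIV. m $ i * n $ i)"

definition real_vec :: "int ^ 'd \<Rightarrow> real ^ 'd"
  where "real_vec n = (\<chi> i. real_of_int (n $ i))"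

definition rational_polyhedral_cone :: "(real ^ 'd) set \<Rightarrow> bool"
  where "rational_polyhedral_cone \<sigma> \<longleftrightarrow> (\<exists>G. finite G \<and> \<sigma> = convex_cone hull (real_vec ` G))"

definition strongly_convex :: "(real ^ 'd) set \<Rightarrow> bool"
  where "strongly_convex \<sigma> \<longleftrightarrow> \<sigma> \<inter> uminus ` \<sigma> = {0}"

definition dual_cone :: "(real ^ 'd) set \<Rightarrow> (real ^ 'd) set"
  where "dual_cone \<sigma> = {m. \<forall>n\<in>\<sigma>. 0 \<le> m \<bullet> n}"

definition is_submonoid :: "'a::monoid_add set \<Rightarrow> bool"
  where "is_submonoid A \<longleftrightarrow> 0 \<in> A \<and> (\<forall>x\<in>A. \<forall>y\<in>A. x + y \<in> A)"

definition is_subgroup :: "'a::group_add set \<Rightarrow> bool"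
  where "is_subgroup A \<longleftrightarrow> is_submonoid A \<and> (\<forall>x\<in>A. - x \<in> A)"


section \<open>The affine toric variety and its local ring at the fixed point\<close>

text \<open>Elements of \<open>\<complex>[M]\<close> are finitely supported functions \<open>int ^ 'd \<Rightarrow>\<^sub>0 complex\<close> with convolution as
  multiplication; the character \<open>\<chi>\<^sup>m\<close> is \<open>Poly_Mapping.single m 1\<close>.\<close>

definition semigroup_algebra :: "(int ^ 'd) set \<Rightarrow> (int ^ 'd \<Rightarrow>\<^sub>0 complex) set"
  where "semigroup_algebra S = {f. Poly_Mapping.keys f \<subseteq> S}"

text \<open>The closed points of \<open>Spec \<complex>[S]\<close> are the semigroup homomorphisms \<open>S \<rightarrow> (\<complex>, \<cdot>)\<close>, here extended
  by \<open>0\<close> outside \<open>S\<close>; the torus is \<open>Hom(M, \<complex>\<^sup>*)\<close>.\<close>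

definition toric_points :: "(int ^ 'd) set \<Rightarrow> (int ^ 'd \<Rightarrow> complex) set"
  where "toric_points S =
    {x. x 0 = 1 \<and> (\<forall>m\<in>S. \<forall>n\<in>S. x (m + n) = x m * x n) \<and> (\<forall>m. m \<notin> S \<longrightarrow> x m = 0)}"

definition torus :: "(int ^ 'd \<Rightarrow> complex) set"
  where "torus = {t. (\<forall>m. t m \<noteq> 0) \<and> (\<forall>m n. t (m + n) = t m * t n)}"

definition torus_orbit :: "(int ^ 'd \<Rightarrow> complex) \<Rightarrow> (int ^ 'd \<Rightarrow> complex) set"
  where "torus_orbit x = (\<lambda>t m. t m * x m) ` torus"

text \<open>The torus is connected, so a \<open>0\<close>-dimensional orbit is a single point.\<close>

definition torus_fixed_point :: "(int ^ 'd) set \<Rightarrow> (int ^ 'd \<Rightarrow> complex)"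
  where "torus_fixed_point S = (THE x. x \<in> toric_points S \<and> torus_orbit x = {x})"

definition eval_at :: "(int ^ 'd \<Rightarrow> complex) \<Rightarrow> (int ^ 'd \<Rightarrow>\<^sub>0 complex) \<Rightarrow> complex"
  where "eval_at x f = (\<Sum>m\<in>Poly_Mapping.keys f. Poly_Mapping.lookup f m * x m)"

text \<open>The local ring is the localization of \<open>\<complex>[S]\<close> at the maximal ideal of functions vanishing
  at the fixed point; a germ is an equivalence class of pairs (numerator, denominator).\<close>

type_synonym 'd germ = "((int ^ 'd \<Rightarrow>\<^sub>0 complex) \<times> (int ^ 'd \<Rightarrow>\<^sub>0 complex)) set"

definition denominators :: "(int ^ 'd) set \<Rightarrow> (int ^ 'd \<Rightarrow>\<^sub>0 complex) set"
  where "denominators S = {g \<in> semigroup_algebra S. eval_at (torus_fixed_point S) g \<noteq> 0}"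

definition frac_rel ::
  "(int ^ 'd) set \<Rightarrow> (((int ^ 'd \<Rightarrow>\<^sub>0 complex) \<times> (int ^ 'd \<Rightarrow>\<^sub>0 complex)) \<times>
                     ((int ^ 'd \<Rightarrow>\<^sub>0 complex) \<times> (int ^ 'd \<Rightarrow>\<^sub>0 complex))) set"
  where "frac_rel S = {((f, g), (f', g')).
    f \<in> semigroup_algebra S \<and> g \<in> denominators S \<and>
    f' \<in> semigroup_algebra S \<and> g' \<in> denominators S \<and>
    (\<exists>h\<in>denominators S. h * (f * g' - f' * g) = 0)}"

definition fraction :: "(int ^ 'd) set \<Rightarrow> (int ^ 'd \<Rightarrow>\<^sub>0 complex) \<Rightarrow> (int ^ 'd \<Rightarrow>\<^sub>0 complex) \<Rightarrow> 'd germ"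
  where "fraction S f g = frac_rel S `` {(f, g)}"

definition numer :: "'d germ \<Rightarrow> (int ^ 'd \<Rightarrow>\<^sub>0 complex)"
  where "numer x = fst (SOME p. p \<in> x)"

definition denom :: "'d germ \<Rightarrow> (int ^ 'd \<Rightarrow>\<^sub>0 complex)"
  where "denom x = snd (SOME p. p \<in> x)"

definition local_ring :: "(int ^ 'd) set \<Rightarrow> (complex, 'd germ) module"
  where "local_ring S = \<lparr>
    carrier = (semigroup_algebra S \<times> denominators S) // frac_rel S,
    mult = (\<lambda>x y. fraction S (numer x * numer y) (denom x * denom y)),
    one = fraction S 1 1,
    ring.zero = fraction S 0 1,
    add = (\<lambda>x y. fraction S (numer x * denom y + numer y * denom x) (denom x * denom y)),
    module.smult = (\<lambda>c x. fraction S (Poly_Mapping.single 0 c * numer x) (denom x)) \<rparr>"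


section \<open>Monomial valuations and the multi-index filtration\<close>

text \<open>The infimum over the empty support gives the value \<open>\<infinity>\<close> of the zero function.\<close>

definition monomial_valuation :: "int ^ 'd \<Rightarrow> (int ^ 'd \<Rightarrow>\<^sub>0 complex) \<Rightarrow> ereal"
  where "monomial_valuation n f = (INF m\<in>Poly_Mapping.keys f. ereal (real_of_int (pairing m n)))"

definition germ_valuation :: "int ^ 'd \<Rightarrow> 'd germ \<Rightarrow> ereal"
  where "germ_valuation n x = monomial_valuation n (numer x) - monomial_valuation n (denom x)"

definition filtration :: "(int ^ 'd) set \<Rightarrow> ('r \<Rightarrow> int ^ 'd) \<Rightarrow> int ^ 'r \<Rightarrow> 'd germ set"
  where "filtration S \<nu> v =
    {x \<in> carrier (local_ring S). \<forall>i. ereal (real_of_int (v $ i)) \<le> germ_valuation (\<nu> i) x}"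


section \<open>Vector space constructions\<close>

definition complex_field :: "complex ring"
  where "complex_field = \<lparr> carrier = UNIV, mult = (*), one = 1, ring.zero = 0, add = (+) \<rparr>"

text \<open>The quotient \<open>U / W\<close> of subspaces \<open>W \<subseteq> U\<close> of \<open>V\<close>. The ring multiplication and unit, present
  in every module record, are irrelevant for modules.\<close>

definition quotient_space :: "('k, 'a, 'z) module_scheme \<Rightarrow> 'a set \<Rightarrow> 'a set \<Rightarrow> ('k, 'a set) module"
  where "quotient_space V U W = \<lparr>
    carrier = (\<lambda>x. W +>\<^bsub>V\<^esub> x) ` U,
    mult = undefined,
    one = undefined,
    ring.zero = W,
    add = set_add V,
    module.smult = (\<lambda>c A. \<Union>a\<in>A. W +>\<^bsub>V\<^esub> (c \<odot>\<^bsub>V\<^esub> a)) \<rparr>"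

definition product_space :: "('r \<Rightarrow> ('k, 'a) module) \<Rightarrow> ('k, 'r \<Rightarrow> 'a) module"
  where "product_space V = \<lparr>
    carrier = {x. \<forall>j. x j \<in> carrier (V j)},
    mult = undefined,
    one = undefined,
    ring.zero = (\<lambda>j. \<zero>\<^bsub>V j\<^esub>),
    add = (\<lambda>x y j. x j \<oplus>\<^bsub>V j\<^esub> y j),
    module.smult = (\<lambda>c x j. c \<odot>\<^bsub>V j\<^esub> x j) \<rparr>"

text \<open>The usual topology of a finite-dimensional complex vector space: a set is open if its preimage
  under the coordinate isomorphism \<open>\<complex>\<^sup>n \<rightarrow> V\<close> of every (equivalently, of some) basis is open. The
  space \<open>\<complex>\<^sup>n\<close> is the set of extensional functions on \<open>{..<n}\<close>.\<close>

definition vs_topology :: "(complex, 'a) module \<Rightarrow> 'a topology"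
  where "vs_topology V = topology (\<lambda>U. U \<subseteq> carrier V \<and>
    (\<forall>(n::nat) b. inj_on b {..<n} \<and> vectorspace.basis complex_field V (b ` {..<n}) \<longrightarrow>
       openin (product_topology (\<lambda>_. euclidean) {..<n})
         {x \<in> {..<n} \<rightarrow>\<^sub>E UNIV. (\<Oplus>\<^bsub>V\<^esub>i\<in>{..<n}. x i \<odot>\<^bsub>V\<^esub> b i) \<in> U}))"

definition quotient_topology :: "'a topology \<Rightarrow> ('a \<Rightarrow> 'b) \<Rightarrow> 'b topology"
  where "quotient_topology X f = topology (\<lambda>U. U \<subseteq> f ` topspace X \<and>
    openin X {x \<in> topspace X. f x \<in> U})"

text \<open>The quotient by \<open>\<complex>\<^sup>*\<close> of a subset \<open>F\<close> of \<open>V \<setminus> {0}\<close> that is closed under nonzero scalars.\<close>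

definition projectivization :: "(complex, 'a) module \<Rightarrow> 'a set \<Rightarrow> 'a set topology"
  where "projectivization V F = quotient_topology (subtopology (vs_topology V) F)
    (\<lambda>x. {c \<odot>\<^bsub>V\<^esub> x | c. c \<noteq> 0})"

lemma istopology_preimages:
  "istopology (\<lambda>U. U \<subseteq> A \<and> (\<forall>i\<in>I. openin (Y i) {x \<in> topspace (Y i). h i x \<in> U}))"
  unfolding istopology_def
proof (intro conjI allI impI ballI; (elim conjE)?)
  fix U T i
  assume "\<forall>i\<in>I. openin (Y i) {x \<in> topspace (Y i). h i x \<in> U}"
    "\<forall>i\<in>I. openin (Y i) {x \<in> topspace (Y i). h i x \<in> T}" "i \<in> I"
  then have "openin (Y i) ({x \<in> topspace (Y i). h i x \<in> U} \<inter> {x \<in> topspace (Y i). h i x \<in> T})"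
    by blast
  also have "{x \<in> topspace (Y i). h i x \<in> U} \<inter> {x \<in> topspace (Y i). h i x \<in> T}
      = {x \<in> topspace (Y i). h i x \<in> U \<inter> T}" by blast
  finally show "openin (Y i) {x \<in> topspace (Y i). h i x \<in> U \<inter> T}" .
next
  fix \<K> i
  assume K: "\<forall>K\<in>\<K>. K \<subseteq> A \<and> (\<forall>i\<in>I. openin (Y i) {x \<in> topspace (Y i). h i x \<in> K})" and "i \<in> I"
  then have "openin (Y i) (\<Union>K\<in>\<K>. {x \<in> topspace (Y i). h i x \<in> K})" by blast
  also have "(\<Union>K\<in>\<K>. {x \<in> topspace (Y i). h i x \<in> K}) = {x \<in> topspace (Y i). h i x \<in> \<Union>\<K>}"
    by blast
  finally show "openin (Y i) {x \<in> topspace (Y i). h i x \<in> \<Union>\<K>}" .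
qed blast+

lemma openin_vs_topology:
  "openin (vs_topology V) U \<longleftrightarrow> U \<subseteq> carrier V \<and>
    (\<forall>(n::nat) b. inj_on b {..<n} \<and> vectorspace.basis complex_field V (b ` {..<n}) \<longrightarrow>
       openin (product_topology (\<lambda>_. euclidean) {..<n})
         {x \<in> {..<n} \<rightarrow>\<^sub>E UNIV. (\<Oplus>\<^bsub>V\<^esub>i\<in>{..<n}. x i \<odot>\<^bsub>V\<^esub> b i) \<in> U})"
proof -
  define I where "I = {(n::nat, b). inj_on b {..<n} \<and> vectorspace.basis complex_field V (b ` {..<n})}"
  define Y :: "nat \<times> (nat \<Rightarrow> 'a) \<Rightarrow> (nat \<Rightarrow> complex) topology"
    where "Y = (\<lambda>(n, b). product_topology (\<lambda>_. euclidean) {..<n})"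
  define h where "h = (\<lambda>(n, b) x. \<Oplus>\<^bsub>V\<^esub>i\<in>{..<n::nat}. x i \<odot>\<^bsub>V\<^esub> b i)"
  have eq: "(\<lambda>U. U \<subseteq> carrier V \<and>
      (\<forall>(n::nat) b. inj_on b {..<n} \<and> vectorspace.basis complex_field V (b ` {..<n}) \<longrightarrow>
       openin (product_topology (\<lambda>_. euclidean) {..<n})
         {x \<in> {..<n} \<rightarrow>\<^sub>E UNIV. (\<Oplus>\<^bsub>V\<^esub>i\<in>{..<n}. x i \<odot>\<^bsub>V\<^esub> b i) \<in> U}))
    = (\<lambda>U. U \<subseteq> carrier V \<and> (\<forall>i\<in>I. openin (Y i) {x \<in> topspace (Y i). h i x \<in> U}))"
    by (auto simp: I_def Y_def h_def fun_eq_iff)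
  show ?thesis
    unfolding vs_topology_def
    by (subst topology_inverse') (simp_all only: eq istopology_preimages)
qed

lemma openin_quotient_topology:
  "openin (quotient_topology X f) U \<longleftrightarrow>
    U \<subseteq> f ` topspace X \<and> openin X {x \<in> topspace X. f x \<in> U}"
  using istopology_preimages[where I = "{()}" and Y = "\<lambda>_. X" and h = "\<lambda>_. f" and A = "f ` topspace X"]
  by (simp add: quotient_topology_def topology_inverse')

lemma quotient_map_quotient_topology: "quotient_map X (quotient_topology X f) f"
proof -
  have "{x \<in> topspace X. f x \<in> f ` topspace X} = topspace X"
    by blast
  then have "openin (quotient_topology X f) (f ` topspace X)"
    by (simp add: openin_quotient_topology)
  then have "topspace (quotient_topology X f) = f ` topspace X"
    by (metis openin_quotient_topology openin_subset openin_topspace subset_antisym)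
  then show ?thesis
    unfolding quotient_map_def by (simp add: openin_quotient_topology)
qed


section \<open>Euler characteristic\<close>

text \<open>The rank of an abelian group in multiplicative notation: the largest size of a
  \<open>\<int>\<close>-linearly independent finite subset (\<open>0\<close> if there is no largest size).\<close>

definition int_independent :: "('a, 'b) monoid_scheme \<Rightarrow> 'a set \<Rightarrow> bool"
  where "int_independent G B \<longleftrightarrow> finite B \<and> B \<subseteq> carrier G \<and>
    (\<forall>c::'a \<Rightarrow> int. (\<Otimes>\<^bsub>G\<^esub>b\<in>B. b [^]\<^bsub>G\<^esub> c b) = \<one>\<^bsub>G\<^esub> \<longrightarrow> (\<forall>b\<in>B. c b = 0))"

definition abelian_rank :: "('a, 'b) monoid_scheme \<Rightarrow> nat"
  where "abelian_rank G = Sup {card B | B. int_independent G B}"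

definition euler_characteristic :: "'a topology \<Rightarrow> int"
  where "euler_characteristic X =
    (\<Sum>p | abelian_rank (homology_group (int p) X) \<noteq> 0.
      (- 1) ^ p * int (abelian_rank (homology_group (int p) X)))"


section \<open>The Poincare series\<close>

text \<open>A formal series in \<open>t\<^sub>1\<^sup>\<plusminus>\<^sup>1, \<dots>, t\<^sub>r\<^sup>\<plusminus>\<^sup>1\<close>, possibly infinite in all directions, is its coefficient
  function; such series form a module over the Laurent polynomials.\<close>

definition laurent_mult :: "(int ^ 'r \<Rightarrow>\<^sub>0 int) \<Rightarrow> (int ^ 'r \<Rightarrow> int) \<Rightarrow> (int ^ 'r \<Rightarrow> int)"
  where "laurent_mult p L =
    (\<lambda>v. \<Sum>a\<in>Poly_Mapping.keys p. Poly_Mapping.lookup p a * L (v - a))"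

definition tvar :: "'r::finite \<Rightarrow> (int ^ 'r \<Rightarrow>\<^sub>0 int)"
  where "tvar i = Poly_Mapping.single (axis i 1) 1"

definition is_power_series :: "(int ^ 'r \<Rightarrow> int) \<Rightarrow> bool"
  where "is_power_series P \<longleftrightarrow> (\<forall>v. P v \<noteq> 0 \<longrightarrow> (\<forall>i. 0 \<le> v $ i))"

definition dim_series :: "(int ^ 'd) set \<Rightarrow> ('r \<Rightarrow> int ^ 'd) \<Rightarrow> int ^ 'r \<Rightarrow> int"
  where "dim_series S \<nu> v = int (vectorspace.dim complex_field
    (quotient_space (local_ring S) (filtration S \<nu> v) (filtration S \<nu> (v + 1))))"

text \<open>The quotient of \<open>\<Prod>\<^sub>i (t\<^sub>i - 1) L\<close> by \<open>t\<^sub>1 \<cdots> t\<^sub>r - 1\<close> in the integral domain \<open>\<int>[[t\<^sub>1, \<dots>, t\<^sub>r]]\<close>.\<close>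

definition poincare_series :: "(int ^ 'd) set \<Rightarrow> ('r::finite \<Rightarrow> int ^ 'd) \<Rightarrow> int ^ 'r \<Rightarrow> int"
  where "poincare_series S \<nu> = (THE P. is_power_series P \<and>
    laurent_mult ((\<Prod>i\<in>UNIV. tvar i) - 1) P = laurent_mult (\<Prod>i\<in>UNIV. (tvar i - 1)) (dim_series S \<nu>))"


section \<open>The fibers of the extended semigroup\<close>

definition D_comp :: "(int ^ 'd) set \<Rightarrow> ('r::finite \<Rightarrow> int ^ 'd) \<Rightarrow> int ^ 'r \<Rightarrow> 'r \<Rightarrow>
    (complex, 'd germ set) module"
  where "D_comp S \<nu> v j =
    quotient_space (local_ring S) (filtration S \<nu> v) (filtration S \<nu> (v + axis j 1))"

definition D_space :: "(int ^ 'd) set \<Rightarrow> ('r::finite \<Rightarrow> int ^ 'd) \<Rightarrow> int ^ 'r \<Rightarrow>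
    (complex, 'r \<Rightarrow> 'd germ set) module"
  where "D_space S \<nu> v = product_space (D_comp S \<nu> v)
    \<lparr> carrier := (\<lambda>g j. filtration S \<nu> (v + axis j 1) +>\<^bsub>local_ring S\<^esub> g) ` filtration S \<nu> v \<rparr>"

definition F_fiber :: "(int ^ 'd) set \<Rightarrow> ('r::finite \<Rightarrow> int ^ 'd) \<Rightarrow> int ^ 'r \<Rightarrow> ('r \<Rightarrow> 'd germ set) set"
  where "F_fiber S \<nu> v =
    carrier (D_space S \<nu> v) \<inter> {x. \<forall>j. x j \<in> carrier (D_comp S \<nu> v j) - {\<zero>\<^bsub>D_comp S \<nu> v j\<^esub>}}"

definition PF_fiber :: "(int ^ 'd) set \<Rightarrow> ('r::finite \<Rightarrow> int ^ 'd) \<Rightarrow> int ^ 'r \<Rightarrow>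
    ('r \<Rightarrow> 'd germ set) set topology"
  where "PF_fiber S \<nu> v = projectivization (D_space S \<nu> v) (F_fiber S \<nu> v)"

end

theory Submission
  imports Defs
begin

text \<open>
  Both sides have the same coefficients: the coefficient at \<open>v\<close> is the number of exponents \<open>m \<in> S\<close> with
  \<open>\<langle>m, \<nu>\<^sub>i\<rangle> = v\<^sub>i\<close> for all \<open>i\<close>.

  A germ at the fixed point has a power series expansion with exponents in \<open>S\<close>, because the \<open>\<nu>\<^sub>i\<close> are
  positive on \<open>S - {0}\<close>, and its valuations are the least values of \<open>\<nu>\<^sub>i\<close> on the support of the expansion
  (\<open>frac_rel_iff\<close>, \<open>filtration_eq_vanishing\<close>). So \<open>I(v) / I(v + 1)\<close> has a basis of monomials,
  namely those \<open>m \<in> S\<close> with \<open>\<nu>(m) \<ge> v\<close> and equality in some component.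

  On the side of the Poincare series, each monomial contributes to \<open>L\<close> the difference of two orthants.
  Multiplication by all \<open>t\<^sub>i - 1\<close> reduces the orthants to points, and division by \<open>t\<^sub>1 \<cdots> t\<^sub>r - 1\<close>
  leaves \<open>t\<close> to the power \<open>\<nu>(m)\<close> (\<open>laurent_mult_dim_series\<close>, \<open>poincare_series_eq\<close>).

  On the side of the Euler characteristics, \<open>F\<^sub>v\<close> is given in the monomial coordinates by the
  condition that for each \<open>j\<close> one of the coordinates \<open>m\<close> with \<open>\<nu>\<^sub>j(m) = v\<^sub>j\<close> does not vanish. So its
  projectivization is a union of charts, each given by the nonvanishing of a nonempty set \<open>K\<close> of
  coordinates. The chart is a product of \<open>\<bar>K\<bar> - 1\<close> punctured planes and some planes, and has
  Euler characteristic \<open>1\<close> or \<open>0\<close> according to whether \<open>K\<close> is a singleton. The charts of \<open>K\<close> and \<open>L\<close>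
  meet in that of \<open>K \<union> L\<close>, and inclusion-exclusion shows that the Euler characteristic is the
  number of coordinate points in the union (\<open>has_euler_union_of_charts\<close>). These are the monomials with
  \<open>\<nu>(m) = v\<close>.

  The additivity of the Euler characteristic for open covers (\<open>has_euler_Un\<close>) follows from
  the additivity of the rank of abelian groups (\<open>erank_rank_nullity\<close>), the long exact sequence of a pair
  and excision.
\<close>

section \<open>The rank of an abelian group\<close>

abbreviation zcomb :: "('a, 'm) monoid_scheme \<Rightarrow> 'i set \<Rightarrow> ('i \<Rightarrow> 'a) \<Rightarrow> ('i \<Rightarrow> int) \<Rightarrow> 'a"
  where "zcomb G I g c \<equiv> (\<Otimes>\<^bsub>G\<^esub>i\<in>I. g i [^]\<^bsub>G\<^esub> c i)"

text \<open>Allowing families instead of sets lets elements of two different groups, or lifts of elements, be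
  collected before their distinctness is known; it follows from independence.\<close>

definition indep_family :: "('a, 'm) monoid_scheme \<Rightarrow> 'i set \<Rightarrow> ('i \<Rightarrow> 'a) \<Rightarrow> bool"
  where "indep_family G I g \<longleftrightarrow> finite I \<and> g ` I \<subseteq> carrier G \<and>
    (\<forall>c. zcomb G I g c = \<one>\<^bsub>G\<^esub> \<longrightarrow> (\<forall>i\<in>I. c i = 0))"

context comm_group
begin

lemma zcomb_add:
  assumes "g ` I \<subseteq> carrier G"
  shows "zcomb G I g (\<lambda>i. c i + d i) = zcomb G I g c \<otimes> zcomb G I g d"
proof -
  have "zcomb G I g (\<lambda>i. c i + d i) = (\<Otimes>i\<in>I. g i [^] c i \<otimes> g i [^] d i)"
    using assms by (intro finprod_cong') (auto simp: int_pow_mult)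
  also have "\<dots> = zcomb G I g c \<otimes> zcomb G I g d"
    using assms by (intro finprod_multf) auto
  finally show ?thesis .
qed

lemma zcomb_scale:
  assumes "g ` I \<subseteq> carrier G" "finite I"
  shows "zcomb G I g (\<lambda>i. n * c i) = zcomb G I g c [^] (n::int)"
  using assms(2,1)
proof (induction rule: finite_induct)
  case (insert x F)
  have "g x [^] (n * c x) = (g x [^] c x) [^] n"
    using insert.prems by (simp add: int_pow_pow mult.commute)
  with insert show ?case
    by (simp add: int_pow_distrib Pi_iff image_subset_iff)
qed auto

lemma zcomb_zero: "(\<And>i. i \<in> I \<Longrightarrow> c i = (0::int)) \<Longrightarrow> zcomb G I g c = \<one>"
  by (rule finprod_one_eqI) auto

lemma zcomb_superset:
  assumes "finite J" "I \<subseteq> J" "g ` J \<subseteq> carrier G" "\<And>i. i \<in> J - I \<Longrightarrow> c i = 0"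
  shows "zcomb G J g c = zcomb G I g c"
proof (rule finprod_mono_neutral_cong_left[symmetric])
  show "g i [^] c i = \<one>" if "i \<in> J - I" for i
    using assms(4)[OF that] by simp
qed (use assms in auto)

lemma zcomb_sum:
  assumes "finite K" "finite I" "g ` I \<subseteq> carrier G"
  shows "zcomb G I g (\<lambda>i. \<Sum>k\<in>K. d k * r k i) = zcomb G K (\<lambda>k. zcomb G I g (r k)) d"
  using assms(1)
proof (induction rule: finite_induct)
  case empty
  then show ?case by (simp add: zcomb_zero)
next
  case (insert x F)
  have *: "zcomb G I g (r k) \<in> carrier G" for k
    using assms by (intro finprod_closed) auto
  show ?case
    using insert * by (simp add: zcomb_add zcomb_scale assms Pi_iff)
qed

lemma hom_zcomb:
  assumes "comm_group H" "f \<in> hom G H" "g ` I \<subseteq> carrier G" "finite I"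
  shows "f (zcomb G I g c) = zcomb H I (f \<circ> g) c"
proof -
  interpret H: comm_group H by fact
  have fc: "f x \<in> carrier H" if "x \<in> carrier G" for x
    using that assms(2) by (auto simp: hom_def)
  show ?thesis
    using assms(4,3)
  proof (induction rule: finite_induct)
    case empty
    then show ?case
      using hom_one[OF assms(2)] by simp
  next
    case (insert x F)
    have "f (g x [^] c x \<otimes> zcomb G F g c) = f (g x [^] c x) \<otimes>\<^bsub>H\<^esub> f (zcomb G F g c)"
      using insert.prems by (intro hom_mult[OF assms(2)]) (auto intro!: finprod_closed)
    also have "f (g x [^] c x) = f (g x) [^]\<^bsub>H\<^esub> c x"
      using insert.prems by (intro hom_int_pow[OF assms(2)]) auto
    finally show ?case
      using insert fc by (simp add: Pi_iff image_subset_iff)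
  qed
qed

lemma indep_family_subset:
  assumes "indep_family G J g" "I \<subseteq> J"
  shows "indep_family G I g"
  unfolding indep_family_def
proof (intro conjI allI impI)
  fix c :: "_ \<Rightarrow> int" assume c: "zcomb G I g c = \<one>"
  define c' where "c' = (\<lambda>i. if i \<in> I then c i else 0)"
  have *: "zcomb G J g c' = zcomb G I g c'"
    using assms by (intro zcomb_superset) (auto simp: indep_family_def c'_def)
  have "zcomb G I g c' = zcomb G I g c"
    using assms by (intro finprod_cong') (auto simp: indep_family_def c'_def)
  with c * have "\<forall>i\<in>J. c' i = 0"
    using assms(1) by (auto simp: indep_family_def)
  then show "\<forall>i\<in>I. c i = 0"
    using assms(2) by (force simp: c'_def)
qed (use assms in \<open>auto simp: indep_family_def intro: finite_subset\<close>)

lemma indep_family_inj: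
  assumes "indep_family G I g"
  shows "inj_on g I"
proof (rule inj_onI, rule ccontr)
  fix i j assume ij: "i \<in> I" "j \<in> I" "g i = g j" "i \<noteq> j"
  have g: "g i \<in> carrier G" "g j \<in> carrier G"
    using assms ij by (auto simp: indep_family_def)
  define c :: "_ \<Rightarrow> int" where "c = (\<lambda>k. if k = i then 1 else -1)"
  have "indep_family G {i, j} g"
    using assms ij by (intro indep_family_subset[OF assms]) auto
  moreover have "zcomb G {i, j} g c = \<one>"
    using ij g by (simp add: c_def int_pow_neg)
  ultimately show False
    by (auto simp: indep_family_def c_def)
qed

lemma indep_family_image:
  assumes "indep_family G I g"
  shows "int_independent G (g ` I)"
  unfolding int_independent_def
proof (intro conjI allI impI)
  fix c :: "_ \<Rightarrow> int" assume "(\<Otimes>b\<in>g ` I. b [^] c b) = \<one>"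
  also have "(\<Otimes>b\<in>g ` I. b [^] c b) = zcomb G I g (c \<circ> g)"
    using assms indep_family_inj[OF assms]
    by (subst finprod_reindex) (auto simp: indep_family_def o_def)
  finally show "\<forall>b\<in>g ` I. c b = 0"
    using assms by (auto simp: indep_family_def)
qed (use assms in \<open>auto simp: indep_family_def\<close>)

end

lemma int_independent_iff_family: "int_independent G B \<longleftrightarrow> indep_family G B (\<lambda>b. b)"
  by (simp add: int_independent_def indep_family_def)

text \<open>Unlike \<^const>\<open>abelian_rank\<close>, this rank lives in the extended naturals, so that its
  additivity needs no finiteness. It is taken for subsets of a group, since the kernels and images
  in an exact sequence are subsets of one fixed group.\<close>

definition erank :: "('a, 'm) monoid_scheme \<Rightarrow> 'a set \<Rightarrow> enat"
  where "erank G K = (SUP B\<in>{B. B \<subseteq> K \<and> int_independent G B}. enat (card B))"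

context comm_group
begin

text \<open>Subsets of independent sets are independent, so every natural number below the rank is attained.\<close>

lemma erank_ge_iff: "enat n \<le> erank G K \<longleftrightarrow> (\<exists>B\<subseteq>K. int_independent G B \<and> card B = n)"
proof
  assume n: "enat n \<le> erank G K"
  have "\<exists>B\<subseteq>K. int_independent G B \<and> n \<le> card B"
  proof (rule ccontr)
    assume *: "\<not> ?thesis"
    have "n \<noteq> 0"
      using *[simplified, rule_format, of "{}"] by (auto simp: int_independent_def)
    have "erank G K \<le> enat (n - 1)"
      unfolding erank_def using * by (intro SUP_least) force
    with n have "enat n \<le> enat (n - 1)"
      by (rule order_trans)
    with \<open>n \<noteq> 0\<close> show False
      by simp
  qed
  then obtain B where B: "B \<subseteq> K" "int_independent G B" "n \<le> card B" by blast
  obtain B' where B': "B' \<subseteq> B" "card B' = n"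
    using B(3) by (meson obtain_subset_with_card_n)
  have "int_independent G B'"
    using indep_family_subset B(2) B'(1) unfolding int_independent_iff_family by blast
  then show "\<exists>B\<subseteq>K. int_independent G B \<and> card B = n"
    using B B' by blast
next
  assume "\<exists>B\<subseteq>K. int_independent G B \<and> card B = n"
  then show "enat n \<le> erank G K"
    unfolding erank_def by (auto intro: SUP_upper2)
qed

lemma card_le_erank:
  assumes "indep_family G I g" "g ` I \<subseteq> K"
  shows "enat (card I) \<le> erank G K"
  using indep_family_image[OF assms(1)] card_image[OF indep_family_inj[OF assms(1)]] assms(2)
  unfolding erank_ge_iff by blast

lemma abelian_rank_eqI:
  assumes "erank G (carrier G) = enat n"
  shows "abelian_rank G = n"
proof -
  have le: "card B \<le> n" if "int_independent G B" for B
  proof -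
    have "enat (card B) \<le> erank G (carrier G)"
      unfolding erank_ge_iff using that by (auto simp: int_independent_def)
    then show ?thesis using assms by simp
  qed
  have "n \<in> {card B | B. int_independent G B}"
    using erank_ge_iff[of n "carrier G"] assms by auto
  then show ?thesis
    unfolding abelian_rank_def by (intro cSup_eq_maximum) (auto dest: le)
qed

lemma erank_one: "erank G {\<one>} = 0"
proof (rule ccontr)
  assume "erank G {\<one>} \<noteq> 0"
  then have "enat 1 \<le> erank G {\<one>}"
    by (metis one_enat_def ileI1 one_eSuc zero_less_iff_neq_zero)
  then obtain B where B: "B \<subseteq> {\<one>}" "int_independent G B" "card B = 1"
    unfolding erank_ge_iff by blast
  then have "B = {\<one>}" by (auto simp: subset_singleton_iff)
  with B(2) have "\<forall>c::_\<Rightarrow>int. c \<one> = 0"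
    by (auto simp: int_independent_def)
  from this[rule_format, of "\<lambda>_. 1"] show False by simp
qed

end

lemma enat_eqI: "(\<And>n. enat n \<le> x \<longleftrightarrow> enat n \<le> y) \<Longrightarrow> x = y"
proof -
  have le: "x \<le> y" if *: "\<And>n. enat n \<le> x \<Longrightarrow> enat n \<le> y" for x y :: enat
  proof (cases x)
    case (enat n)
    then show ?thesis using *[of n] by simp
  next
    case infinity
    then show ?thesis using *[of "Suc (the_enat y)"] by (cases y) auto
  qed
  assume *: "\<And>n. enat n \<le> x \<longleftrightarrow> enat n \<le> y"
  show "x = y"
    by (rule order_antisym; rule le) (simp_all add: *)
qed

lemma enat_le_addE:
  assumes "enat n \<le> a + b"
  obtains m k where "n = m + k" "enat m \<le> a" "enat k \<le> b"
proof (cases a)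
  case a: (enat x)
  show thesis
  proof (cases b)
    case b: (enat y)
    show thesis
      by (rule that[of "min x n" "n - min x n"]) (use a b assms in auto)
  next
    case infinity
    then show thesis
      by (intro that[of 0 n]) (auto simp flip: zero_enat_def)
  qed
next
  case infinity
  then show thesis
    by (intro that[of n 0]) (auto simp flip: zero_enat_def)
qed

text \<open>For \<open>\<ge>\<close>, an independent set of the kernel and lifts of an independent set of the image are together
  independent. For \<open>\<le>\<close>, let \<open>E\<close> be independent in \<open>G\<close> and \<open>E\<^sub>1 \<subseteq> E\<close> maximal with independent image.
  Every other \<open>e \<in> E\<close> satisfies a relation over \<open>E\<^sub>1\<close> in the image, which says that some
  combination \<open>k e\<close> of \<open>e\<close> and \<open>E\<^sub>1\<close>, with a nonzero coefficient at \<open>e\<close>, lies in the kernel. These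
  combinations are independent because \<open>e\<close> occurs in \<open>k e\<close> only. The argument works
  with one finite \<open>E\<close> at a time, and so covers infinite ranks.\<close>

theorem erank_rank_nullity:
  assumes G: "comm_group G" and H: "comm_group H" and f: "f \<in> hom G H"
  shows "erank G (carrier G) = erank G (kernel G H f) + erank H (f ` carrier G)"
proof -
  interpret G: comm_group G by fact
  interpret H: comm_group H by fact
  have fc: "f x \<in> carrier H" if "x \<in> carrier G" for x
    using that f by (auto simp: hom_def)
  have ge: "enat (m + n) \<le> erank G (carrier G)"
    if m: "enat m \<le> erank G (kernel G H f)" and n: "enat n \<le> erank H (f ` carrier G)" for m n
  proof -
    obtain B where B: "B \<subseteq> kernel G H f" "int_independent G B" "card B = m"
      using m unfolding G.erank_ge_iff by blast
    obtain C where C: "C \<subseteq> f ` carrier G" "int_independent H C" "card C = n"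
      using n unfolding H.erank_ge_iff by blast
    have CH: "x \<in> carrier H" if "x \<in> C" for x
      using C(1) fc that by auto
    have "\<forall>c\<in>C. \<exists>x\<in>carrier G. f x = c"
      using C(1) by blast
    then obtain l where l: "\<And>c. c \<in> C \<Longrightarrow> l c \<in> carrier G \<and> f (l c) = c"
      by metis
    have fin: "finite B" "finite C"
      using B C by (auto simp: int_independent_def)
    have BG: "B \<subseteq> carrier G" "\<And>b. b \<in> B \<Longrightarrow> f b = \<one>\<^bsub>H\<^esub>"
      using B(1) by (auto simp: kernel_def)
    \<comment> \<open>The disjoint sum as index set, because a lift might a priori lie in \<open>B\<close>.\<close>
    define I where "I = Inl ` B \<union> Inr ` C"
    define g where "g = case_sum (\<lambda>b. b) l"
    have gI: "g ` I \<subseteq> carrier G"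
      using BG l by (auto simp: g_def I_def)
    have "indep_family G I g"
      unfolding indep_family_def
    proof (intro conjI allI impI)
      show "finite I" "g ` I \<subseteq> carrier G"
        using fin gI by (auto simp: I_def)
      fix c :: "_ \<Rightarrow> int" assume c: "zcomb G I g c = \<one>\<^bsub>G\<^esub>"
      have "\<one>\<^bsub>H\<^esub> = zcomb H I (f \<circ> g) c"
        using G.hom_zcomb[OF H f gI, of c] fin c hom_one[OF f] by (simp add: I_def)
      also have "\<dots> = zcomb H (Inr ` C) (f \<circ> g) c"
        using fin l C(1) BG fc by (intro H.finprod_mono_neutral_cong_right) (auto simp: I_def g_def)
      also have "\<dots> = zcomb H C (\<lambda>x. x) (c \<circ> Inr)"
        using l CH by (subst H.finprod_reindex) (auto simp: g_def intro!: H.finprod_cong')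
      finally have cC: "c (Inr x) = 0" if "x \<in> C" for x
        using C(2) that by (auto simp: int_independent_def)
      have "\<one>\<^bsub>G\<^esub> = zcomb G (Inl ` B) g c"
        unfolding c[symmetric] using fin gI by (intro G.zcomb_superset) (auto simp: I_def cC)
      also have "\<dots> = zcomb G B (\<lambda>x. x) (c \<circ> Inl)"
        using BG by (subst G.finprod_reindex) (auto simp: g_def intro!: G.finprod_cong')
      finally have cB: "c (Inl x) = 0" if "x \<in> B" for x
        using B(2) that by (auto simp: int_independent_def)
      show "\<forall>i\<in>I. c i = 0"
        using cB cC by (auto simp: I_def)
    qed
    then have "enat (card I) \<le> erank G (carrier G)"
      using gI by (intro G.card_le_erank)
    moreover have "card I = m + n"
      unfolding I_def using fin B C by (subst card_Un_disjoint) (auto simp: card_image)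
    ultimately show ?thesis by simp
  qed
  have le: "enat n \<le> erank G (kernel G H f) + erank H (f ` carrier G)"
    if n: "enat n \<le> erank G (carrier G)" for n
  proof -
    obtain E where E: "E \<subseteq> carrier G" "int_independent G E" "card E = n"
      using n unfolding G.erank_ge_iff by blast
    have finE: "finite E" using E by (auto simp: int_independent_def)
    define \<C> where "\<C> = {E1. E1 \<subseteq> E \<and> indep_family H E1 f}"
    have "{} \<in> \<C>" by (auto simp: \<C>_def indep_family_def)
    moreover have "finite \<C>" using finE by (auto simp: \<C>_def)
    ultimately obtain E1 where E1: "E1 \<in> \<C>" "\<And>E'. E' \<in> \<C> \<Longrightarrow> E1 \<subseteq> E' \<Longrightarrow> E' = E1"
      using finite_has_maximal[of \<C>] by (metis empty_iff)
    have E1': "E1 \<subseteq> E" "indep_family H E1 f" "finite E1"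
      using E1(1) finE by (auto simp: \<C>_def intro: finite_subset)
    have "\<exists>r. r e \<noteq> 0 \<and> (\<forall>x. x \<notin> insert e E1 \<longrightarrow> r x = 0) \<and> zcomb H E f r = \<one>\<^bsub>H\<^esub>"
      if e: "e \<in> E - E1" for e
    proof -
      have fi: "f ` insert e E1 \<subseteq> carrier H"
        using E(1) E1' e fc by blast
      have "\<not> indep_family H (insert e E1) f"
        using E1(2)[of "insert e E1"] e E1' by (auto simp: \<C>_def)
      then obtain c :: "_ \<Rightarrow> int" where c: "zcomb H (insert e E1) f c = \<one>\<^bsub>H\<^esub>" "\<not> (\<forall>i\<in>insert e E1. c i = 0)"
        using E1'(3) fi unfolding indep_family_def by blast
      have ce: "c e \<noteq> 0"
      proof
        assume "c e = 0"
        then have "zcomb H (insert e E1) f c = zcomb H E1 f c"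
          using E1' fi e by (intro H.zcomb_superset) auto
        then have "\<forall>i\<in>E1. c i = 0"
          using c(1) E1'(2) by (auto simp: indep_family_def)
        with c(2) \<open>c e = 0\<close> show False by auto
      qed
      define r where "r = (\<lambda>x. if x \<in> insert e E1 then c x else 0)"
      have "zcomb H E f r = zcomb H (insert e E1) f r"
        using finE E1' e E(1) fc by (intro H.zcomb_superset) (auto simp: r_def)
      also have "\<dots> = zcomb H (insert e E1) f c"
        using fi by (intro H.finprod_cong') (auto simp: r_def)
      finally show ?thesis
        using c ce by (intro exI[of _ r]) (auto simp: r_def)
    qed
    then obtain r where r: "\<And>e. e \<in> E - E1 \<Longrightarrow> r e e \<noteq> (0::int)"
      "\<And>e x. e \<in> E - E1 \<Longrightarrow> x \<notin> insert e E1 \<Longrightarrow> r e x = 0"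
      "\<And>e. e \<in> E - E1 \<Longrightarrow> zcomb H E f (r e) = \<one>\<^bsub>H\<^esub>"
      by metis
    define k where "k = (\<lambda>e. zcomb G E (\<lambda>x. x) (r e))"
    have kc: "k e \<in> carrier G" for e
      unfolding k_def using E(1) by (intro G.finprod_closed) auto
    have "f (k e) = \<one>\<^bsub>H\<^esub>" if "e \<in> E - E1" for e
      unfolding k_def using G.hom_zcomb[OF H f, of "\<lambda>x. x" E "r e"] E(1) finE r(3)[OF that]
      by (simp add: o_def)
    then have kk: "k ` (E - E1) \<subseteq> kernel G H f"
      using kc by (auto simp: kernel_def)
    have "indep_family G (E - E1) k"
      unfolding indep_family_def
    proof (intro conjI allI impI)
      show "finite (E - E1)" "k ` (E - E1) \<subseteq> carrier G"
        using finE kc by auto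
      fix d :: "_ \<Rightarrow> int" assume d: "zcomb G (E - E1) k d = \<one>\<^bsub>G\<^esub>"
      have "zcomb G E (\<lambda>x. x) (\<lambda>i. \<Sum>e\<in>E - E1. d e * r e i) = \<one>\<^bsub>G\<^esub>"
        unfolding d[symmetric] k_def using finE E(1) by (intro G.zcomb_sum) auto
      then have *: "(\<Sum>e\<in>E - E1. d e * r e x) = 0" if "x \<in> E" for x
        by (rule E(2)[unfolded int_independent_def, THEN conjunct2, THEN conjunct2, rule_format, OF _ that])
      show "\<forall>e\<in>E - E1. d e = 0"
      proof
        fix e assume e: "e \<in> E - E1"
        have "(\<Sum>x\<in>E - E1. d x * r x e) = (\<Sum>x\<in>{e}. d x * r x e)"
          using finE e r(2) by (intro sum.mono_neutral_right) auto
        with *[of e] e r(1)[OF e] show "d e = 0" by auto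
      qed
    qed
    then have 1: "enat (card (E - E1)) \<le> erank G (kernel G H f)"
      using kk by (intro G.card_le_erank)
    have 2: "enat (card E1) \<le> erank H (f ` carrier G)"
      using E1' E by (intro H.card_le_erank) auto
    have "n = card (E - E1) + card E1"
      using E(3) E1'(1) finE card_mono[OF finE E1'(1)]
      by (simp add: card_Diff_subset finite_subset)
    then show ?thesis
      using add_mono[OF 1 2] by simp
  qed
  show ?thesis
  proof (rule enat_eqI)
    fix n
    show "enat n \<le> erank G (carrier G) \<longleftrightarrow> enat n \<le> erank G (kernel G H f) + erank H (f ` carrier G)"
    proof
      assume "enat n \<le> erank G (kernel G H f) + erank H (f ` carrier G)"
      then show "enat n \<le> erank G (carrier G)"
        by (rule enat_le_addE) (simp add: ge)
    qed (rule le)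
  qed
qed

lemma erank_iso:
  assumes "comm_group G" "comm_group H" "f \<in> iso G H"
  shows "erank G (carrier G) = erank H (carrier H)"
proof -
  interpret G: comm_group G by fact
  interpret H: comm_group H by fact
  have f: "f \<in> hom G H" "inj_on f (carrier G)" "f ` carrier G = carrier H"
    using assms(3) by (auto simp: iso_def bij_betw_def)
  interpret group_hom G H f
    using f(1) by unfold_locales
  have "kernel G H f = {\<one>\<^bsub>G\<^esub>}"
    using f(2) inj_iff_trivial_ker by blast
  then show ?thesis
    using erank_rank_nullity[OF assms(1,2) f(1)] by (simp add: f(3) G.erank_one)
qed

text \<open>Two integers \<open>x\<close>, \<open>y\<close> satisfy the relation \<open>y \<cdot> x - x \<cdot> y = 0\<close>.\<close>

lemma erank_integer_group: "erank integer_group (carrier integer_group) = 1"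
proof -
  interpret comm_group integer_group
    by (simp add: abelian_integer_group)
  have "\<not> int_independent integer_group B" if B: "card B = 2" for B
  proof
    assume ind: "int_independent integer_group B"
    obtain x y where xy: "B = {x, y}" "x \<noteq> y"
      using B by (auto simp: card_2_iff)
    define c where "c = (\<lambda>b. if b = x then y else - x)"
    have "(\<Otimes>\<^bsub>integer_group\<^esub>b\<in>B. b [^]\<^bsub>integer_group\<^esub> c b) = \<one>\<^bsub>integer_group\<^esub>"
      using xy by (simp add: c_def)
    then have "\<forall>b\<in>B. c b = 0"
      using ind unfolding int_independent_def by blast
    with xy show False
      by (auto simp: c_def)
  qed
  then have "\<not> enat 2 \<le> erank integer_group (carrier integer_group)"
    unfolding erank_ge_iff by blast
  moreover have "enat 1 \<le> erank integer_group (carrier integer_group)"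
    unfolding erank_ge_iff by (rule exI[of _ "{1}"]) (auto simp: int_independent_def)
  ultimately show ?thesis
    by (cases "erank integer_group (carrier integer_group)") (auto simp: one_enat_def)
qed

section \<open>Additivity of the Euler characteristic\<close>

text \<open>The statement that all terms of \<open>f\<close> are finite, almost all are zero, and their alternating sum is
  \<open>e\<close>. As a relation it carries the finiteness without which alternating sums are not additive.\<close>

definition alt_sum :: "(nat \<Rightarrow> enat) \<Rightarrow> int \<Rightarrow> bool"
  where "alt_sum f e \<longleftrightarrow> (\<exists>b N. (\<forall>p. f p = enat (b p)) \<and> (\<forall>p\<ge>N. b p = 0) \<and>
    e = (\<Sum>p<N. (-1) ^ p * int (b p)))"

lemma alt_sumI:
  assumes "\<And>p. f p = enat (b p)" "\<And>p. p \<ge> N \<Longrightarrow> b p = 0" "e = (\<Sum>p<N. (-1) ^ p * int (b p))"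
  shows "alt_sum f e"
  using assms unfolding alt_sum_def by blast

lemma alt_sumE:
  assumes "alt_sum f e"
  obtains b N where "f = (\<lambda>p. enat (b p))" "\<forall>p\<ge>N. b p = 0"
    "\<forall>M\<ge>N. (\<Sum>p<M. (-1) ^ p * int (b p)) = e"
proof -
  obtain b N where *: "\<And>p. f p = enat (b p)" "\<And>p. p \<ge> N \<Longrightarrow> b p = 0"
      "e = (\<Sum>p<N. (-1) ^ p * int (b p))"
    using assms unfolding alt_sum_def by blast
  have sum: "(\<Sum>p<M. (-1) ^ p * int (b p)) = e" if "M \<ge> N" for M
    unfolding *(3) using that *(2) by (intro sum.mono_neutral_right) auto
  show thesis
    by (rule that[of b N]) (use *(1,2) sum in \<open>auto simp only: fun_eq_iff\<close>)
qed

lemma sum_alternating_shift: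
  fixes d :: "nat \<Rightarrow> nat"
  assumes "d 0 = 0" "d N = 0"
  shows "(\<Sum>p<N. (-1) ^ p * int (d (Suc p))) = - (\<Sum>p<N. (-1) ^ p * int (d p))"
  using sum.lessThan_Suc_shift[of "\<lambda>p. (-1) ^ p * int (d p)" N] assms
  by (simp add: sum_negf)

lemma enat_add_eq_enatE:
  assumes "a + b = enat n"
  obtains x y where "a = enat x" "b = enat y" "n = x + y"
  using assms by (cases a; cases b) auto

text \<open>The terms \<open>a\<close>, \<open>x\<close>, \<open>r\<close> are the ranks of the groups in a long exact sequence
  \<open>\<dots> \<rightarrow> A\<^sub>p \<rightarrow> X\<^sub>p \<rightarrow> R\<^sub>p \<rightarrow> A\<^sub>p\<^sub>-\<^sub>1 \<rightarrow> \<dots>\<close>, and \<open>i\<close>, \<open>j\<close>, \<open>d\<close> are the ranks of the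
  images of its three kinds of maps. Each image rank occurs in two of the three
  alternating sums and cancels, for the connecting maps after a shift of degree.\<close>

lemma alt_sum_long_exact:
  assumes a: "\<And>p. a p = d (Suc p) + i p" and x: "\<And>p. x p = i p + j p"
    and r: "\<And>p. r p = j p + d p" and d0: "d 0 = (0::enat)"
  shows "alt_sum a ea \<Longrightarrow> alt_sum x ex \<Longrightarrow> alt_sum r (ex - ea)" (is "PROP ?rel")
    and "alt_sum a ea \<Longrightarrow> alt_sum r er \<Longrightarrow> alt_sum x (ea + er)" (is "PROP ?abs")
proof -
  have main: "alt_sum x ex \<and> alt_sum r er \<and> ex = ea + er"
    if "a = (\<lambda>p. enat (a' p))" "x = (\<lambda>p. enat (x' p))" "r = (\<lambda>p. enat (r' p))"
      and N: "\<And>p. p \<ge> N \<Longrightarrow> a' p = 0" "\<And>p. p \<ge> N \<Longrightarrow> x' p = 0" "\<And>p. p \<ge> N \<Longrightarrow> r' p = 0"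
      and ea: "ea = (\<Sum>p<N. (-1) ^ p * int (a' p))" and ex: "ex = (\<Sum>p<N. (-1) ^ p * int (x' p))"
      and er: "er = (\<Sum>p<N. (-1) ^ p * int (r' p))" for a' x' r' N ea ex er
  proof -
    have "\<exists>y. i p = enat y" "\<exists>y. j p = enat y" "\<exists>y. d p = enat y" for p
      using a[of p] x[of p] r[of p] that(1-3) by (metis enat_add_eq_enatE)+
    then obtain i' j' d' where i: "i = (\<lambda>p. enat (i' p))" and j: "j = (\<lambda>p. enat (j' p))"
        and d: "d = (\<lambda>p. enat (d' p))"
      by (metis ext)
    have eqs: "a' p = d' (Suc p) + i' p" "x' p = i' p + j' p" "r' p = j' p + d' p" "d' 0 = 0" for p
      using a[of p] x[of p] r[of p] d0 that(1-3) i j d by (auto simp: zero_enat_def)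
    have "d' N = 0" using N(3)[of N] eqs by simp
    have "ea = (\<Sum>p<N. (-1) ^ p * int (d' (Suc p))) + (\<Sum>p<N. (-1) ^ p * int (i' p))"
      by (simp add: ea eqs(1) algebra_simps sum.distrib)
    moreover have "ex = (\<Sum>p<N. (-1) ^ p * int (i' p)) + (\<Sum>p<N. (-1) ^ p * int (j' p))"
      by (simp add: ex eqs(2) algebra_simps sum.distrib)
    moreover have "er = (\<Sum>p<N. (-1) ^ p * int (j' p)) + (\<Sum>p<N. (-1) ^ p * int (d' p))"
      by (simp add: er eqs(3) algebra_simps sum.distrib)
    ultimately have "ex = ea + er"
      using sum_alternating_shift[of d' N] eqs(4) \<open>d' N = 0\<close> by simp
    then show ?thesis
      using that by (auto intro!: alt_sumI[of _ _ N])
  qed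
  show "PROP ?rel"
  proof -
    assume alts: "alt_sum a ea" "alt_sum x ex"
    from alts(1) obtain a' N1 where
      "a = (\<lambda>p. enat (a' p))" "\<forall>p\<ge>N1. a' p = 0"
        "\<forall>M\<ge>N1. (\<Sum>p<M. (-1) ^ p * int (a' p)) = ea"
      by (rule alt_sumE)
    note 1 = this(1) this(2)[rule_format] this(3)[rule_format]
    from alts(2) obtain x' N2 where
      "x = (\<lambda>p. enat (x' p))" "\<forall>p\<ge>N2. x' p = 0"
        "\<forall>M\<ge>N2. (\<Sum>p<M. (-1) ^ p * int (x' p)) = ex"
      by (rule alt_sumE)
    note 2 = this(1) this(2)[rule_format] this(3)[rule_format]
    have dfin: "\<exists>y. d p = enat y \<and> (p > N1 \<longrightarrow> y = 0)" for p
    proof (cases p)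
      case 0 then show ?thesis using d0 by (auto simp: zero_enat_def)
    next
      case (Suc q)
      obtain y z where "d (Suc q) = enat y" "a' q = y + z"
        using a[of q] 1(1) by (metis enat_add_eq_enatE)
      then show ?thesis using 1(2)[of q] Suc by auto
    qed
    have jfin: "\<exists>y. j p = enat y \<and> (p \<ge> N2 \<longrightarrow> y = 0)" for p
    proof -
      obtain y z where "j p = enat y" "x' p = z + y"
        using x[of p] 2(1) by (metis enat_add_eq_enatE)
      then show ?thesis using 2(2)[of p] by auto
    qed
    obtain d' j' where d': "\<And>p. d p = enat (d' p)" "\<And>p. p > N1 \<Longrightarrow> d' p = 0"
      and j': "\<And>p. j p = enat (j' p)" "\<And>p. p \<ge> N2 \<Longrightarrow> j' p = 0"
      using dfin jfin by metis
    define N where "N = Suc N1 + N2"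
    have "alt_sum r (\<Sum>p<N. (-1) ^ p * int (j' p + d' p)) \<and> ex = ea + (\<Sum>p<N. (-1) ^ p * int (j' p + d' p))"
      using main[of a' x' "\<lambda>p. j' p + d' p" N ea ex] 1 2 d' j' r
      by (auto simp: N_def fun_eq_iff)
    then show "alt_sum r (ex - ea)" by auto
  qed
  show "PROP ?abs"
  proof -
    assume alts: "alt_sum a ea" "alt_sum r er"
    from alts(1) obtain a' N1 where
      "a = (\<lambda>p. enat (a' p))" "\<forall>p\<ge>N1. a' p = 0"
        "\<forall>M\<ge>N1. (\<Sum>p<M. (-1) ^ p * int (a' p)) = ea"
      by (rule alt_sumE)
    note 1 = this(1) this(2)[rule_format] this(3)[rule_format]
    from alts(2) obtain r' N2 where
      "r = (\<lambda>p. enat (r' p))" "\<forall>p\<ge>N2. r' p = 0"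
        "\<forall>M\<ge>N2. (\<Sum>p<M. (-1) ^ p * int (r' p)) = er"
      by (rule alt_sumE)
    note 2 = this(1) this(2)[rule_format] this(3)[rule_format]
    have ifin: "\<exists>y. i p = enat y \<and> (p \<ge> N1 \<longrightarrow> y = 0)" for p
    proof -
      obtain y z where "i p = enat y" "a' p = z + y"
        using a[of p] 1(1) by (metis enat_add_eq_enatE)
      then show ?thesis using 1(2)[of p] by auto
    qed
    have jfin: "\<exists>y. j p = enat y \<and> (p \<ge> N2 \<longrightarrow> y = 0)" for p
    proof -
      obtain y z where "j p = enat y" "r' p = y + z"
        using r[of p] 2(1) by (metis enat_add_eq_enatE)
      then show ?thesis using 2(2)[of p] by auto
    qed
    obtain i' j' where i': "\<And>p. i p = enat (i' p)" "\<And>p. p \<ge> N1 \<Longrightarrow> i' p = 0"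
      and j': "\<And>p. j p = enat (j' p)" "\<And>p. p \<ge> N2 \<Longrightarrow> j' p = 0"
      using ifin jfin by metis
    define N where "N = N1 + N2"
    have "alt_sum x (\<Sum>p<N. (-1) ^ p * int (i' p + j' p)) \<and> (\<Sum>p<N. (-1) ^ p * int (i' p + j' p)) = ea + er"
      using main[of a' "\<lambda>p. i' p + j' p" r' N ea _ er] 1 2 i' j' x
      by (auto simp: N_def fun_eq_iff)
    then show "alt_sum x (ea + er)" by auto
  qed
qed

definition hrank :: "int \<Rightarrow> 'a topology \<Rightarrow> 'a set \<Rightarrow> enat"
  where "hrank p X S = erank (relative_homology_group p X S) (carrier (relative_homology_group p X S))"

text \<open>The space \<open>X\<close> modulo \<open>S\<close> has homology of finite rank, of rank \<open>0\<close> in high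
  degrees, and \<open>e\<close> is its Euler characteristic.\<close>

definition has_euler :: "'a topology \<Rightarrow> 'a set \<Rightarrow> int \<Rightarrow> bool"
  where "has_euler X S e \<longleftrightarrow> alt_sum (\<lambda>p. hrank (int p) X S) e"

lemma erank_trivial_group:
  assumes "comm_group G" "trivial_group G"
  shows "erank G (carrier G) = 0"
  using assms comm_group.erank_one[OF assms(1)] by (simp add: trivial_group_def)

lemma hrank_iso:
  assumes "relative_homology_group p X S \<cong> relative_homology_group q Y T"
  shows "hrank p X S = hrank q Y T"
  using assms unfolding is_iso_def hrank_def
  by (auto intro!: erank_iso)

lemma erank_subset_trivial:
  assumes "comm_group G" "trivial_group G" "K \<subseteq> carrier G"
  shows "erank G K = 0"
proof -
  have "erank G K \<le> erank G (carrier G)"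
    unfolding erank_def using assms(3) by (intro SUP_subset_mono) auto
  then show ?thesis
    using erank_trivial_group[OF assms(1,2)] by simp
qed

text \<open>Each group of the long exact sequence of the pair has the rank of its image under the outgoing map
  plus the rank of the kernel, which is the image of the incoming map.\<close>

lemma hrank_long_exact:
  obtains i j d :: "nat \<Rightarrow> enat"
  where "\<And>p. hrank (int p) (subtopology X S) {} = d (Suc p) + i p"
    "\<And>p. hrank (int p) X {} = i p + j p" "\<And>p. hrank (int p) X S = j p + d p" "d 0 = 0"
proof
  let ?A = "\<lambda>p. homology_group p (subtopology X S)" and ?X = "\<lambda>p. homology_group p X"
    and ?R = "\<lambda>p. relative_homology_group p X S"
  let ?i = "\<lambda>p. hom_induced p (subtopology X S) {} X {} id" and ?j = "\<lambda>p. hom_induced p X {} X S id"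
    and ?d = "\<lambda>p. hom_boundary p X S"
  define i where "i = (\<lambda>p. erank (?X (int p)) (?i (int p) ` carrier (?A (int p))))"
  define j where "j = (\<lambda>p. erank (?R (int p)) (?j (int p) ` carrier (?X (int p))))"
  define d where "d = (\<lambda>p. erank (?A (int p - 1)) (?d (int p) ` carrier (?R (int p))))"
  have 1: "kernel (?A p) (?X p) (?i p) = ?d (p + 1) ` carrier (?R (p + 1))" for p
    using homology_exactness_axiom_2[of "p + 1" X S] by simp
  have 2: "kernel (?X p) (?R p) (?j p) = ?i p ` carrier (?A p)" for p
    using homology_exactness_axiom_3[of p X S] by simp
  have 3: "kernel (?R p) (?A (p - 1)) (?d p) = ?j p ` carrier (?X p)" for p
    using homology_exactness_axiom_1[of p X S] by simp
  show "hrank (int p) (subtopology X S) {} = d (Suc p) + i p" for p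
    unfolding hrank_def d_def i_def
    using erank_rank_nullity[OF _ _ hom_induced_hom[of "int p" "subtopology X S" "{}" X "{}" id]] 1[of "int p"]
    by (simp add: add.commute)
  show "hrank (int p) X {} = i p + j p" for p
    unfolding hrank_def j_def i_def
    using erank_rank_nullity[OF _ _ hom_induced_hom[of "int p" X "{}" X S id]] 2[of "int p"]
    by simp
  show "hrank (int p) X S = j p + d p" for p
    unfolding hrank_def j_def d_def
    using erank_rank_nullity[OF _ _ hom_boundary_hom[of "int p" X S]] 3[of "int p"]
    by simp
  show "d 0 = 0"
    unfolding d_def using hom_boundary_hom[of 0 X S]
    by (intro erank_subset_trivial) (auto simp: hom_def)
qed

lemma has_euler_relative:
  assumes "has_euler (subtopology X S) {} a" "has_euler X {} x"
  shows "has_euler X S (x - a)"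
  using assms unfolding has_euler_def
  by (rule_tac hrank_long_exact[of X S]) (metis (no_types, lifting) alt_sum_long_exact(1))

lemma has_euler_absolute:
  assumes "has_euler (subtopology X S) {} a" "has_euler X S r"
  shows "has_euler X {} (a + r)"
  using assms unfolding has_euler_def
  by (rule_tac hrank_long_exact[of X S]) (metis (no_types, lifting) alt_sum_long_exact(2))

lemma has_euler_iso:
  assumes "\<And>p. relative_homology_group p X S \<cong> relative_homology_group p Y T" "has_euler Y T e"
  shows "has_euler X S e"
  using assms(2) hrank_iso[OF assms(1)] by (simp add: has_euler_def)

lemma has_euler_homeomorphic:
  "X homeomorphic_space Y \<Longrightarrow> has_euler Y {} e \<Longrightarrow> has_euler X {} e"
  by (rule has_euler_iso) (rule homeomorphic_space_imp_isomorphic_homology_groups)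

text \<open>By excision the pair \<open>(U, U \<inter> V)\<close> has the same homology as \<open>(X, V)\<close>, hence
  \<open>\<chi>(U) - \<chi>(U \<inter> V) = \<chi>(X) - \<chi>(V)\<close>.\<close>

theorem has_euler_Un:
  assumes U: "openin X U" and V: "openin X V" and X: "topspace X = U \<union> V"
    and u: "has_euler (subtopology X U) {} u" and v: "has_euler (subtopology X V) {} v"
    and w: "has_euler (subtopology X (U \<inter> V)) {} w"
  shows "has_euler X {} (u + v - w)"
proof -
  have *: "V - (topspace X - U) = U \<inter> V" "topspace X - (topspace X - U) = U"
    using openin_subset[OF V] openin_subset[OF U] by auto
  have "has_euler (subtopology X U) (U \<inter> V) (u - w)"
    by (rule has_euler_relative[OF _ u]) (simp add: subtopology_subtopology w)
  moreover have "X closure_of (topspace X - U) \<subseteq> X interior_of V"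
  proof -
    have "X closure_of (topspace X - U) = topspace X - U"
      using U by (intro closure_of_closedin) auto
    then show ?thesis
      using X V by (auto simp: interior_of_openin)
  qed
  from homology_excision_axiom[OF this, of "topspace X"] openin_subset[OF V]
  have "relative_homology_group p (subtopology X U) (U \<inter> V) \<cong> relative_homology_group p X V" for p
    unfolding * is_iso_def by (auto simp: subtopology_topspace)
  then have "relative_homology_group p X V \<cong> relative_homology_group p (subtopology X U) (U \<inter> V)" for p
    by (simp add: group.iso_sym)
  ultimately have "has_euler X V (u - w)"
    by (rule_tac has_euler_iso)
  from has_euler_absolute[OF v this] show ?thesis
    by (simp add: algebra_simps)
qed

lemma has_euler_empty: "topspace X = {} \<Longrightarrow> has_euler X {} 0"
  unfolding has_euler_def hrank_def
  by (rule alt_sumI[of _ "\<lambda>_. 0" 0])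
    (auto simp: erank_trivial_group trivial_homology_group_empty zero_enat_def[symmetric])

lemma has_euler_contractible:
  assumes "contractible_space X" "topspace X \<noteq> {}"
  shows "has_euler X {} 1"
proof -
  obtain a where a: "a \<in> topspace X" "X homotopy_equivalent_space subtopology X {a}"
    using assms by (auto simp: contractible_eq_homotopy_equivalent_singleton_subtopology)
  let ?P = "subtopology X {a}"
  have P: "topspace ?P = {a}" using a by auto
  have "hrank (int p) ?P {} = enat (if p = 0 then 1 else 0)" for p
  proof (cases "p = 0")
    case True
    have "homology_group 0 ?P \<cong> integer_group"
      by (rule homology_coefficients[OF P])
    then have "hrank 0 ?P {} = 1"
      unfolding hrank_def is_iso_def using erank_iso[OF abelian_homology_group abelian_integer_group] erank_integer_group
      by auto
    then show ?thesis using True by (simp add: one_enat_def)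
  next
    case False
    then show ?thesis
      unfolding hrank_def using homology_dimension_axiom[OF P, of "int p"]
      by (simp add: erank_trivial_group zero_enat_def)
  qed
  then have "has_euler ?P {} 1"
    unfolding has_euler_def by (rule alt_sumI[of _ _ 1]) auto
  then show ?thesis
    by (rule has_euler_iso[rotated]) (rule homotopy_equivalent_space_imp_isomorphic_homology_groups[OF a(2)])
qed

lemma euler_characteristic_eq:
  assumes "has_euler X {} e"
  shows "euler_characteristic X = e"
proof -
  obtain b N where b: "(\<lambda>p. hrank (int p) X {}) = (\<lambda>p. enat (b p))" "\<forall>p\<ge>N. b p = 0"
    and e: "\<forall>M\<ge>N. (\<Sum>p<M. (-1) ^ p * int (b p)) = e"
    using assms unfolding has_euler_def by (rule alt_sumE)
  have r: "abelian_rank (homology_group (int p) X) = b p" for p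
    using comm_group.abelian_rank_eqI[OF abelian_homology_group] fun_cong[OF b(1), of p]
    unfolding hrank_def by blast
  have "(\<Sum>p | b p \<noteq> 0. (-1) ^ p * int (b p)) = (\<Sum>p<N. (-1) ^ p * int (b p))"
  proof (rule sum.mono_neutral_left)
    show "{p. b p \<noteq> 0} \<subseteq> {..<N}"
    proof
      fix p assume "p \<in> {p. b p \<noteq> 0}"
      then show "p \<in> {..<N}"
        using b(2) by (cases "p \<ge> N") auto
    qed
  qed auto
  also have "\<dots> = e"
    using e by blast
  finally show ?thesis
    by (simp only: euler_characteristic_def r of_nat_0_eq_iff)
qed

section \<open>Products of punctured planes\<close>

abbreviation cspace :: "'i set \<Rightarrow> ('i \<Rightarrow> complex) topology"
  where "cspace A \<equiv> product_topology (\<lambda>_. euclidean) A"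

lemma continuous_map_euclidean_iff_tendsto:
  "continuous_map X euclidean f \<longleftrightarrow> (\<forall>x\<in>topspace X. (f \<longlongrightarrow> f x) (atin X x))"
  by (simp add: continuous_map_atin)

lemma openin_cspace_coordinate:
  assumes "open U" "j \<in> A" "X = subtopology (cspace A) F"
  shows "openin X {x \<in> topspace X. x j \<in> U}"
proof -
  have "continuous_map X euclidean (\<lambda>x. x j)"
    unfolding assms(3) using assms(2)
    by (intro continuous_map_from_subtopology continuous_map_product_projection)
  then show ?thesis
    using assms(1) by (auto simp: continuous_map_def)
qed

text \<open>The punctured plane is the union of the two slit planes, and these meet in the disjoint union of
  the two open half planes.\<close>

lemma contractible_plane_pieces:
  "contractible (- complex_of_real ` {..0})" "contractible (- complex_of_real ` {0..})"
  "contractible {z. Im z > 0}" "contractible {z. Im z < 0}"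
  by (intro starlike_imp_contractible starlike_slotted_complex_plane_left
        starlike_slotted_complex_plane_right convex_imp_contractible
        convex_halfspace_Im_gt convex_halfspace_Im_lt)+

lemma open_plane_pieces:
  "open (- complex_of_real ` {..0})" "open (- complex_of_real ` {0..})"
  "open {z. Im z > 0}" "open {z. Im z < 0}"
  by (auto intro!: closed_slot_left closed_slot_right open_halfspace_Im_gt open_halfspace_Im_lt
      simp: open_Compl)

lemma of_real_slots:
  "complex_of_real ` {..0} = {z. Im z = 0 \<and> Re z \<le> 0}"
  "complex_of_real ` {0..} = {z. Im z = 0 \<and> Re z \<ge> 0}"
  by (auto simp: image_iff complex_eq_iff)

text \<open>One punctured coordinate is treated at a time: covering it by the two slit planes leaves spaces with
  one punctured coordinate less, all with the same Euler characteristic \<open>e\<close>. The intersection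
  consists of two such spaces, so the result is \<open>e + e - (e + e) = 0\<close>.\<close>

theorem has_euler_product_punctured_planes:
  assumes "finite J" "J \<subseteq> I" "\<And>k. k \<in> J \<Longrightarrow> W k = - {0}"
    and "\<And>k. k \<in> I - J \<Longrightarrow> contractible (W k) \<and> W k \<noteq> {}"
  shows "has_euler (subtopology (cspace I) (PiE I W)) {} (if J = {} then 1 else 0)"
  using assms
proof (induction J arbitrary: W rule: finite_induct)
  case empty
  have "PiE I W \<noteq> {}" using empty by (simp add: PiE_eq_empty_iff)
  then have ne: "topspace (subtopology (cspace I) (PiE I W)) \<noteq> {}"
    by (auto simp: PiE_def)
  have "contractible_space (subtopology (cspace I) (PiE I W))"
    using empty by (simp add: subtopology_product_topology contractible_space_product_topology
        contractible_space_top_of_set)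
  from has_euler_contractible[OF this ne] show ?case
    by simp
next
  case (insert j J)
  define e :: int where "e = (if J = {} then 1 else 0)"
  define X where "X = subtopology (cspace I) (PiE I W)"
  have jI: "j \<in> I" and Wj: "W j = - {0}" using insert by auto
  define B where "B = (\<lambda>Q. PiE I (W(j := Q)))"
  have IH: "has_euler (subtopology (cspace I) (B Q)) {} e" if "contractible Q" "Q \<noteq> {}" for Q
    unfolding B_def e_def using that insert.prems insert.hyps by (intro insert.IH) auto
  have BX: "B Q = {x \<in> topspace X. x j \<in> Q}" if "Q \<subseteq> - {0}" for Q
  proof -
    have "(\<forall>i\<in>I. x i \<in> (W(j := Q)) i) \<longleftrightarrow> (\<forall>i\<in>I. x i \<in> W i) \<and> x j \<in> Q" for x
      using that Wj jI by (metis fun_upd_apply subsetD)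
    then show ?thesis
      by (simp add: B_def X_def PiE_iff set_eq_iff) blast
  qed
  have sub: "subtopology X (B Q) = subtopology (cspace I) (B Q)" if "Q \<subseteq> - {0}" for Q
  proof -
    have "PiE I W \<inter> B Q = B Q" using BX[OF that] by (auto simp: X_def)
    then show ?thesis by (simp add: X_def subtopology_subtopology)
  qed
  have opn: "openin X (B Q)" if "Q \<subseteq> - {0}" "open Q" for Q
    unfolding BX[OF that(1)] by (rule openin_cspace_coordinate[OF that(2) jI X_def])
  define L R Up Lo where "L = - complex_of_real ` {..0}" and "R = - complex_of_real ` {0..}"
    and "Up = {z. Im z > 0}" and "Lo = {z. Im z < 0}"
  note pieces = of_real_slots L_def R_def Up_def Lo_def
  have "1 \<in> L" "-1 \<in> R" "\<i> \<in> Up" "-\<i> \<in> Lo" by (auto simp: pieces)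
  then have ne: "L \<noteq> {}" "R \<noteq> {}" "Up \<noteq> {}" "Lo \<noteq> {}" by blast+
  have con: "contractible L" "contractible R" "contractible Up" "contractible Lo"
    unfolding L_def R_def Up_def Lo_def by (rule contractible_plane_pieces)+
  have op: "open L" "open R" "open Up" "open Lo"
    unfolding L_def R_def Up_def Lo_def by (rule open_plane_pieces)+
  have sb: "L \<subseteq> - {0}" "R \<subseteq> - {0}" "Up \<subseteq> - {0}" "Lo \<subseteq> - {0}" "L \<inter> R \<subseteq> - {0}"
    by (auto simp: pieces)
  have LR: "L \<union> R = - {0}" "L \<inter> R = Up \<union> Lo" "Up \<inter> Lo = {}"
    by (auto simp: pieces complex_eq_iff)
  let ?Y = "subtopology X (B (L \<inter> R))"
  have BLR: "B (L \<inter> R) = B L \<inter> B R" "B (L \<inter> R) = B Up \<union> B Lo" "B Up \<inter> B Lo = {}"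
    unfolding BX[OF sb(1)] BX[OF sb(2)] BX[OF sb(3)] BX[OF sb(4)] BX[OF sb(5)] using LR by blast+
  have subY: "subtopology ?Y (B Up) = subtopology X (B Up)" "subtopology ?Y (B Lo) = subtopology X (B Lo)"
    using BLR(2) by (simp_all add: subtopology_subtopology Int_absorb1)
  have "has_euler ?Y {} (e + e - 0)"
  proof (rule has_euler_Un[where U = "B Up" and V = "B Lo"])
    show "openin ?Y (B Up)" "openin ?Y (B Lo)"
      using opn[OF sb(3) op(3)] opn[OF sb(4) op(4)] BLR(2) by (auto simp: openin_open_subtopology openin_subtopology)
    show "topspace ?Y = B Up \<union> B Lo"
      using BLR(2) BX[OF sb(5)] by auto
    show "has_euler (subtopology ?Y (B Up)) {} e" "has_euler (subtopology ?Y (B Lo)) {} e"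
      unfolding subY using IH[OF con(3) ne(3)] IH[OF con(4) ne(4)] sub[OF sb(3)] sub[OF sb(4)] by simp_all
    show "has_euler (subtopology ?Y (B Up \<inter> B Lo)) {} 0"
      by (rule has_euler_empty) (simp add: BLR(3))
  qed
  moreover have "has_euler X {} (e + e - w)" if "has_euler ?Y {} w" for w
  proof (rule has_euler_Un[where U = "B L" and V = "B R"])
    show "openin X (B L)" "openin X (B R)"
      using opn sb op by auto
    have "topspace X \<subseteq> {x. x j \<in> - {0}}"
      using Wj jI by (auto simp: X_def)
    then show "topspace X = B L \<union> B R"
      using LR(1) unfolding BX[OF sb(1)] BX[OF sb(2)] by auto
    show "has_euler (subtopology X (B L)) {} e" "has_euler (subtopology X (B R)) {} e"
      using IH[OF con(1) ne(1)] IH[OF con(2) ne(2)] sub[OF sb(1)] sub[OF sb(2)] by simp_all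
    show "has_euler (subtopology X (B L \<inter> B R)) {} w"
      using that BLR(1) by simp
  qed
  ultimately have "has_euler X {} 0"
    by fastforce
  then show ?case by (simp add: X_def)
qed

section \<open>Unions of coordinate charts in projective space\<close>

text \<open>Both \<open>q\<close> and \<open>h\<close> are quotient maps with the same fibres; for \<open>h\<close> this is due to the section \<open>s\<close>.\<close>

lemma homeomorphic_space_of_quotient_section:
  assumes q: "quotient_map X Y q" and h: "continuous_map X Z h" and s: "continuous_map Z X s"
    and hs: "\<And>z. z \<in> topspace Z \<Longrightarrow> h (s z) = z"
    and qh: "\<And>x y. x \<in> topspace X \<Longrightarrow> y \<in> topspace X \<Longrightarrow> q x = q y \<longleftrightarrow> h x = h y"
  shows "Y homeomorphic_space Z"
proof -
  obtain k where k: "continuous_map Y Z k" "\<And>x. x \<in> topspace X \<Longrightarrow> k (q x) = h x"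
    using quotient_map_lift_exists[OF q h] qh by metis
  have qs: "continuous_map Z Y (q \<circ> s)"
    using s quotient_imp_continuous_map[OF q] by (rule continuous_map_compose)
  have sX: "s z \<in> topspace X" if "z \<in> topspace Z" for z
    using s that by (auto simp: continuous_map_def)
  have hZ: "h x \<in> topspace Z" if "x \<in> topspace X" for x
    using h that by (auto simp: continuous_map_def)
  have "homeomorphic_maps Y Z k (q \<circ> s)"
    unfolding homeomorphic_maps_def
  proof (intro conjI ballI)
    fix y assume "y \<in> topspace Y"
    then obtain x where x: "x \<in> topspace X" "y = q x"
      using quotient_imp_surjective_map[OF q] by blast
    then show "(q \<circ> s) (k y) = y"
      using qh[OF sX[OF hZ[OF x(1)]] x(1)] hs[OF hZ[OF x(1)]] by (simp add: k(2))
  qed (use k qs hs sX in auto)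
  then show ?thesis
    by (auto simp: homeomorphic_space_def)
qed

definition scale_on :: "'i set \<Rightarrow> complex \<Rightarrow> ('i \<Rightarrow> complex) \<Rightarrow> ('i \<Rightarrow> complex)"
  where "scale_on A c x = (\<lambda>k\<in>A. c * x k)"

definition nonvanishing :: "'i set \<Rightarrow> 'i set \<Rightarrow> ('i \<Rightarrow> complex) set"
  where "nonvanishing A K = {x \<in> A \<rightarrow>\<^sub>E UNIV. \<forall>k\<in>K. x k \<noteq> 0}"

text \<open>A subset \<open>F\<close> of \<open>\<complex>\<^sup>A\<close> and its image \<open>Y\<close> in projective space, the latter known only through a
  quotient map whose fibres are the orbits of the nonzero scalars.\<close>

locale projective_quotient =
  fixes A :: "'i set" and F :: "('i \<Rightarrow> complex) set" and Y :: "'y topology" and g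
  assumes finite_A: "finite A" and F_subset: "F \<subseteq> A \<rightarrow>\<^sub>E UNIV"
    and quotient: "quotient_map (subtopology (cspace A) F) Y g"
    and fibres: "\<And>x y. x \<in> F \<Longrightarrow> y \<in> F \<Longrightarrow> g x = g y \<longleftrightarrow> (\<exists>c. c \<noteq> 0 \<and> y = scale_on A c x)"
begin

lemma topspace_F: "topspace (subtopology (cspace A) F) = F"
  using F_subset by (auto simp: PiE_def)

lemma saturated:
  assumes "K \<subseteq> A" "x \<in> F" "y \<in> F" "g x = g y" "x \<in> nonvanishing A K"
  shows "y \<in> nonvanishing A K"
proof -
  obtain c where "c \<noteq> 0" "y = scale_on A c x"
    using fibres[OF assms(2,3)] assms(4) by blast
  then show ?thesis
    using assms(1,5) by (auto simp: nonvanishing_def scale_on_def)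
qed

lemma openin_nonvanishing:
  assumes "K \<subseteq> A"
  shows "openin (subtopology (cspace A) F) (F \<inter> nonvanishing A K)"
proof -
  let ?X = "subtopology (cspace A) F"
  show ?thesis
    using finite_subset[OF assms finite_A] assms
  proof (induction K rule: finite_induct)
    case empty
    have "F \<inter> nonvanishing A {} = topspace ?X"
      unfolding topspace_F using F_subset by (auto simp: nonvanishing_def)
    then show ?case by (simp only: openin_topspace)
  next
    case (insert k K)
    have *: "openin ?X {x \<in> topspace ?X. x k \<in> - {0}}"
      by (rule openin_cspace_coordinate) (use insert.prems in auto)
    have "F \<inter> nonvanishing A (insert k K) = (F \<inter> nonvanishing A K) \<inter> {x \<in> topspace ?X. x k \<in> - {0}}"
      unfolding topspace_F by (auto simp: nonvanishing_def)
    then show ?case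
      using openin_Int[OF insert.IH *] insert.prems by auto
  qed
qed

lemma preimage_image:
  assumes "\<And>K. K \<in> \<K> \<Longrightarrow> K \<subseteq> A" "\<And>K. K \<in> \<K> \<Longrightarrow> nonvanishing A K \<subseteq> F"
  shows "{x \<in> F. g x \<in> g ` (\<Union>(nonvanishing A ` \<K>))} = \<Union>(nonvanishing A ` \<K>)"
proof (intro equalityI subsetI)
  fix x assume "x \<in> {x \<in> F. g x \<in> g ` (\<Union>(nonvanishing A ` \<K>))}"
  then obtain y K where y: "x \<in> F" "g y = g x" "K \<in> \<K>" "y \<in> nonvanishing A K"
    by force
  then have "x \<in> nonvanishing A K"
    using saturated[of K y x] assms[OF y(3)] by blast
  with y(3) show "x \<in> \<Union>(nonvanishing A ` \<K>)" by blast
qed (use assms(2) in blast)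

lemma openin_image:
  assumes "\<And>K. K \<in> \<K> \<Longrightarrow> K \<subseteq> A" "\<And>K. K \<in> \<K> \<Longrightarrow> nonvanishing A K \<subseteq> F"
  shows "openin Y (g ` (\<Union>(nonvanishing A ` \<K>)))"
proof -
  let ?U = "\<Union>(nonvanishing A ` \<K>)"
  have UF: "?U \<subseteq> F" using assms(2) by blast
  have pre: "{x \<in> F. g x \<in> g ` ?U} = ?U"
    using assms by (rule preimage_image)
  have "openin (subtopology (cspace A) F) {x \<in> F. g x \<in> g ` ?U}"
    unfolding pre
  proof (rule openin_Union)
    fix U assume "U \<in> nonvanishing A ` \<K>"
    then obtain K where K: "K \<in> \<K>" "U = nonvanishing A K" by blast
    then show "openin (subtopology (cspace A) F) U"
      using openin_nonvanishing[OF assms(1)[OF K(1)]] assms(2)[OF K(1)] by (simp add: Int_absorb1)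
  qed
  moreover have "g ` ?U \<subseteq> topspace Y"
    using quotient_imp_surjective_map[OF quotient] UF topspace_F by blast
  ultimately show ?thesis
    using quotient unfolding quotient_map_def topspace_F by blast
qed

text \<open>Dividing by the coordinate \<open>a \<in> K\<close> identifies the image of the chart with a product of punctured
  planes, for the coordinates in \<open>K - {a}\<close>, and planes, for those outside \<open>K\<close>.\<close>

lemma has_euler_torus_chart:
  assumes K: "K \<subseteq> A" "K \<noteq> {}" "nonvanishing A K \<subseteq> F"
  shows "has_euler (subtopology Y (g ` nonvanishing A K)) {} (if is_singleton K then 1 else 0)"
proof -
  obtain a where a: "a \<in> K" using K by blast
  let ?T = "nonvanishing A K"
  define W where "W = (\<lambda>k. if k \<in> K then - {0 :: complex} else UNIV)"
  define X where "X = subtopology (cspace A) ?T"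
  define Z where "Z = subtopology (cspace (A - {a})) (PiE (A - {a}) W)"
  have tX: "topspace X = ?T" by (auto simp: X_def nonvanishing_def PiE_def)
  have tZ: "topspace Z = PiE (A - {a}) W" by (auto simp: Z_def PiE_def)
  have "quotient_map (subtopology (subtopology (cspace A) F) ?T) (subtopology Y (g ` ?T)) g"
  proof (rule quotient_map_restriction[OF quotient])
    show "{x \<in> topspace (subtopology (cspace A) F). g x \<in> g ` ?T} = ?T"
      unfolding topspace_F using preimage_image[of "{K}"] K by simp
    show "openin Y (g ` ?T) \<or> closedin Y (g ` ?T)"
      using openin_image[of "{K}"] K by simp
  qed
  then have q: "quotient_map X (subtopology Y (g ` ?T)) g"
    using K(3) by (simp add: X_def subtopology_subtopology Int_absorb1)
  define h :: "('i \<Rightarrow> complex) \<Rightarrow> 'i \<Rightarrow> complex" where "h = (\<lambda>x. \<lambda>k\<in>A - {a}. x k / x a)"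
  \<comment> \<open>The section of the chart normalizes the coordinate \<open>a\<close> to \<open>1\<close>.\<close>
  define s :: "('i \<Rightarrow> complex) \<Rightarrow> 'i \<Rightarrow> complex" where "s = (\<lambda>z. \<lambda>k\<in>A. if k = a then 1 else z k)"
  have hT: "h x \<in> PiE (A - {a}) W" if "x \<in> ?T" for x
    using that a by (auto simp: h_def W_def nonvanishing_def)
  have sT: "s z \<in> ?T" if "z \<in> PiE (A - {a}) W" for z
  proof -
    have "s z k \<noteq> 0" if k: "k \<in> K" for k
    proof (cases "k = a")
      case False
      then have "z k \<in> W k"
        using k K(1) by (intro PiE_mem[OF \<open>z \<in> PiE (A - {a}) W\<close>]) auto
      then show ?thesis using False k K(1) by (auto simp: s_def W_def)
    qed (use k K(1) in \<open>auto simp: s_def\<close>)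
    then show ?thesis by (auto simp: nonvanishing_def s_def)
  qed
  have tend: "((\<lambda>x. x k) \<longlongrightarrow> x k) (atin X x)" if "k \<in> A" "x \<in> ?T" for k x
  proof -
    have "continuous_map X euclidean (\<lambda>x. x k)"
      unfolding X_def using that(1)
      by (intro continuous_map_from_subtopology continuous_map_product_projection)
    then show ?thesis
      using that(2) by (simp add: continuous_map_euclidean_iff_tendsto tX)
  qed
  have "subtopology Y (g ` ?T) homeomorphic_space Z"
  proof (rule homeomorphic_space_of_quotient_section[OF q, of Z h s])
    show "continuous_map X Z h"
      unfolding Z_def continuous_map_in_subtopology continuous_map_componentwise
        continuous_map_euclidean_iff_tendsto tX
    proof (intro conjI ballI)
      fix k x assume k: "k \<in> A - {a}" "x \<in> ?T"
      have "x a \<noteq> 0" using k a by (auto simp: nonvanishing_def)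
      then have "((\<lambda>x. x k / x a) \<longlongrightarrow> x k / x a) (atin X x)"
        using k a K(1) by (intro tendsto_divide tend) auto
      then show "((\<lambda>x. h x k) \<longlongrightarrow> h x k) (atin X x)"
        using k by (simp add: h_def)
    qed (use hT in \<open>auto simp: h_def\<close>)
    show "continuous_map Z X s"
      unfolding X_def continuous_map_in_subtopology continuous_map_componentwise tZ
    proof (intro conjI ballI)
      fix k assume "k \<in> A"
      show "continuous_map Z euclidean (\<lambda>x. s x k)"
      proof (cases "k = a")
        case False
        then have "continuous_map Z euclidean (\<lambda>x. x k)"
          unfolding Z_def using \<open>k \<in> A\<close>
          by (intro continuous_map_from_subtopology continuous_map_product_projection) auto
        then show ?thesis using False \<open>k \<in> A\<close> by (simp add: s_def)
      qed (use \<open>k \<in> A\<close> in \<open>simp add: s_def\<close>)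
    qed (use sT in \<open>auto simp: s_def\<close>)
    show "h (s z) = z" if "z \<in> topspace Z" for z
      using that a K(1) unfolding tZ by (fastforce simp: h_def s_def fun_eq_iff PiE_iff extensional_def)
    show "g x = g y \<longleftrightarrow> h x = h y" if "x \<in> topspace X" "y \<in> topspace X" for x y
    proof -
      have xy: "x \<in> ?T" "y \<in> ?T" using that tX by auto
      have nz: "x a \<noteq> 0" "y a \<noteq> 0" using xy a by (auto simp: nonvanishing_def)
      have ext: "x \<in> extensional A" "y \<in> extensional A" using xy by (auto simp: nonvanishing_def PiE_def)
      have hc: "h x = h y" if "y = scale_on A c x" "c \<noteq> 0" for c
        using that a K(1) by (auto simp: h_def scale_on_def fun_eq_iff)
      have hy: "y = scale_on A (y a / x a) x" if h: "h x = h y"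
      proof (rule extensionalityI[OF ext(2)])
        fix k assume k: "k \<in> A"
        show "y k = scale_on A (y a / x a) x k"
        proof (cases "k = a")
          case False
          have "x k / x a = y k / y a"
            using fun_cong[OF h, of k] k False by (simp add: h_def)
          then show ?thesis using nz k by (simp add: scale_on_def field_simps)
        qed (use nz k in \<open>simp add: scale_on_def\<close>)
      qed (auto simp: scale_on_def)
      show ?thesis
      proof -
        have "g x = g y \<longleftrightarrow> (\<exists>c. c \<noteq> 0 \<and> y = scale_on A c x)"
          using xy K(3) by (intro fibres) blast+
        moreover have "y a / x a \<noteq> 0" using nz by simp
        ultimately show ?thesis
          using hy hc by blast
      qed
    qed
  qed
  moreover have "has_euler Z {} (if K - {a} = {} then 1 else 0)"
    unfolding Z_def
  proof (rule has_euler_product_punctured_planes)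
    show "finite (K - {a})" using finite_subset[OF K(1) finite_A] by simp
    show "contractible (W k) \<and> W k \<noteq> {}" if "k \<in> A - {a} - (K - {a})" for k
      using that a by (auto simp: W_def convex_imp_contractible)
  qed (use K(1) in \<open>auto simp: W_def\<close>)
  moreover have "K - {a} = {} \<longleftrightarrow> is_singleton K"
    using a by (auto simp: is_singleton_def)
  ultimately show ?thesis
    by (auto intro: has_euler_homeomorphic)
qed

text \<open>Both sides are additive in the sense of inclusion and exclusion, because the charts of \<open>K\<close> and \<open>L\<close>
  intersect in the chart of \<open>K \<union> L\<close>, and they agree on one chart. The right side counts the
  coordinate points (the fixed points of the torus) in the union. The induction is on the number
  of charts since the intersection of one chart with the others is again a union of fewer charts.\<close>

theorem has_euler_union_of_charts:
  assumes "finite \<K>" "\<And>K. K \<in> \<K> \<Longrightarrow> K \<subseteq> A" "\<And>K. K \<in> \<K> \<Longrightarrow> K \<noteq> {}"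
    and "\<And>K. K \<in> \<K> \<Longrightarrow> nonvanishing A K \<subseteq> F"
  shows "has_euler (subtopology Y (g ` (\<Union>(nonvanishing A ` \<K>)))) {} (int (card {a. {a} \<in> \<K>}))"
  using assms
proof (induction "card \<K>" arbitrary: \<K> rule: less_induct)
  case less
  show ?case
  proof (cases "\<K> = {}")
    case True
    then show ?thesis by (simp add: has_euler_empty)
  next
    case False
    then obtain K where K: "K \<in> \<K>" by blast
    define \<L> where "\<L> = \<K> - {K}"
    define \<M> where "\<M> = (\<lambda>L. K \<union> L) ` \<L>"
    let ?N = "\<lambda>\<K>. \<Union>(nonvanishing A ` \<K>)"
    have KL: "\<K> = insert K \<L>" "K \<notin> \<L>" "finite \<L>" using K less.prems(1) by (auto simp: \<L>_def)
    have cL: "card \<L> < card \<K>" using KL by simp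
    have cM: "card \<M> < card \<K>"
      using card_image_le[OF KL(3), of "(\<union>) K"] cL by (simp add: \<M>_def)
    have L: "has_euler (subtopology Y (g ` ?N \<L>)) {} (int (card {a. {a} \<in> \<L>}))"
      using less.prems KL by (intro less.hyps[OF cL]) auto
    have M: "has_euler (subtopology Y (g ` ?N \<M>)) {} (int (card {a. {a} \<in> \<M>}))"
    proof (rule less.hyps[OF cM])
      fix K' assume "K' \<in> \<M>"
      then obtain L' where L': "L' \<in> \<L>" "K' = K \<union> L'" by (auto simp: \<M>_def)
      then show "K' \<subseteq> A" "K' \<noteq> {}" using less.prems KL by auto
      have "nonvanishing A K' \<subseteq> nonvanishing A K" using L' by (auto simp: nonvanishing_def)
      then show "nonvanishing A K' \<subseteq> F" using less.prems(4)[OF K] by blast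
    qed (use KL in \<open>simp add: \<M>_def\<close>)
    let ?U = "g ` nonvanishing A K" and ?V = "g ` ?N \<L>" and ?W = "g ` ?N \<K>"
    let ?X = "subtopology Y ?W"
    have UV: "?W = ?U \<union> ?V" using KL(1) by auto
    have int: "?U \<inter> ?V = g ` ?N \<M>"
    proof
      show "?U \<inter> ?V \<subseteq> g ` ?N \<M>"
      proof
        fix y assume "y \<in> ?U \<inter> ?V"
        then obtain x x' L' where x: "x \<in> nonvanishing A K" "y = g x"
          and x': "x' \<in> nonvanishing A L'" "y = g x'" "L' \<in> \<L>" by blast
        have "x \<in> F" "x' \<in> F" using x x' less.prems(4) KL(1) by blast+
        then have "x \<in> nonvanishing A L'"
          using saturated[of L' x' x] x x' less.prems(2) KL(1) by auto
        then have "x \<in> nonvanishing A (K \<union> L')" using x by (auto simp: nonvanishing_def)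
        then show "y \<in> g ` ?N \<M>" using x x' by (auto simp: \<M>_def)
      qed
    qed (auto simp: \<M>_def nonvanishing_def)
    have sub: "subtopology ?X ?U = subtopology Y ?U" "subtopology ?X ?V = subtopology Y ?V"
      "subtopology ?X (?U \<inter> ?V) = subtopology Y (?U \<inter> ?V)"
      by (simp_all add: subtopology_subtopology UV Int_absorb1 le_infI1)
    have oW: "openin Y ?W" and oU: "openin Y ?U" and oV: "openin Y ?V"
      using openin_image[of \<K>] openin_image[of "{K}"] openin_image[of \<L>] less.prems KL by auto
    have "has_euler ?X {} ((if is_singleton K then 1 else 0) + int (card {a. {a} \<in> \<L>}) - int (card {a. {a} \<in> \<M>}))"
    proof (rule has_euler_Un[where U = ?U and V = ?V])
      show "openin ?X ?U" "openin ?X ?V"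
        using oU oV UV by (auto simp: openin_subtopology)
      show "topspace ?X = ?U \<union> ?V"
        using openin_subset[OF oW] UV by (simp add: Int_absorb1)
      show "has_euler (subtopology ?X ?U) {} (if is_singleton K then 1 else 0)"
        unfolding sub using has_euler_torus_chart[of K] less.prems K by auto
    qed (use L M int sub in auto)
    moreover have "(if is_singleton K then 1 else 0) + int (card {a. {a} \<in> \<L>}) - int (card {a. {a} \<in> \<M>})
        = int (card {a. {a} \<in> \<K>})"
    proof (cases "is_singleton K")
      case True
      then obtain b where b: "K = {b}" by (auto simp: is_singleton_def)
      have "{b} \<notin> \<L>" using KL(2) b by simp
      then have "{a. {a} \<in> \<M>} = {}"
        using b less.prems(3) KL(1) by (auto simp: \<M>_def dest: subset_singletonD)
      moreover have "{a. {a} \<in> \<K>} = insert b {a. {a} \<in> \<L>}" "b \<notin> {a. {a} \<in> \<L>}"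
        using KL b by auto
      moreover have "finite {a. {a} \<in> \<L>}"
        using finite_vimageI[OF KL(3), of "\<lambda>a. {a}"] by (simp add: vimage_def)
      ultimately show ?thesis using True by simp
    next
      case False
      then have "{a. {a} \<in> \<M>} = {}"
        using less.prems(3)[OF K] by (auto simp: \<M>_def is_singleton_def dest!: sym[of "{_}"] singleton_Un_iff[THEN iffD1])
      moreover have "{a. {a} \<in> \<K>} = {a. {a} \<in> \<L>}"
        using KL(1) False by (auto simp: is_singleton_def)
      ultimately show ?thesis using False by simp
    qed
    ultimately show ?thesis by simp
  qed
qed

end

section \<open>Coordinates on finite-dimensional spaces\<close>

lemma field_complex_field: "field complex_field"
  by (rule Ring.field.intro[OF Ring.domain.intro])
   (unfold_locales, auto simp: complex_field_def Units_def algebra_simps intro: exI[of _ "- _"] field_simps right_inverse)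

text \<open>A linear isomorphism \<open>\<phi>\<close> from \<open>V\<close> onto \<open>\<complex>\<^sup>A\<close>. The axioms of a vector space are
  inherited from \<open>\<complex>\<^sup>A\<close> through \<open>\<phi>\<close>.\<close>

locale linear_coordinates =
  fixes V :: "(complex, 'a) module" (structure) and \<phi> :: "'a \<Rightarrow> 'i \<Rightarrow> complex" and A :: "'i set"
  assumes finite_A: "finite A"
    and bij: "bij_betw \<phi> (carrier V) (A \<rightarrow>\<^sub>E UNIV)"
    and zero_closed: "\<zero> \<in> carrier V" and zero: "\<And>a. a \<in> A \<Longrightarrow> \<phi> \<zero> a = 0"
    and add_closed: "\<And>x y. x \<in> carrier V \<Longrightarrow> y \<in> carrier V \<Longrightarrow> x \<oplus> y \<in> carrier V"
    and add: "\<And>x y a. x \<in> carrier V \<Longrightarrow> y \<in> carrier V \<Longrightarrow> a \<in> A \<Longrightarrow> \<phi> (x \<oplus> y) a = \<phi> x a + \<phi> y a"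
    and scale_closed: "\<And>c x. x \<in> carrier V \<Longrightarrow> c \<odot> x \<in> carrier V"
    and scale: "\<And>c x a. x \<in> carrier V \<Longrightarrow> a \<in> A \<Longrightarrow> \<phi> (c \<odot> x) a = c * \<phi> x a"
begin

lemma eqI:
  assumes "x \<in> carrier V" "y \<in> carrier V" "\<And>a. a \<in> A \<Longrightarrow> \<phi> x a = \<phi> y a"
  shows "x = y"
proof -
  have "\<phi> x \<in> A \<rightarrow>\<^sub>E UNIV" "\<phi> y \<in> A \<rightarrow>\<^sub>E UNIV"
    using bij assms(1,2) by (auto simp: bij_betw_def)
  then have "\<phi> x = \<phi> y"
    using assms(3) by (intro PiE_ext) auto
  then show ?thesis
    using bij assms(1,2) by (auto simp: bij_betw_def inj_on_def)
qed

lemma surj: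
  assumes "h \<in> A \<rightarrow>\<^sub>E UNIV"
  obtains x where "x \<in> carrier V" "\<phi> x = h"
  using bij assms by (metis bij_betw_def imageE)

lemma coordinates_in: "x \<in> carrier V \<Longrightarrow> \<phi> x \<in> A \<rightarrow>\<^sub>E UNIV"
  using bij by (auto simp: bij_betw_def)

lemma vectorspace_V: "vectorspace complex_field V"
proof -
  have inv: "\<exists>y\<in>carrier V. y \<oplus> x = \<zero>" if x: "x \<in> carrier V" for x
  proof
    show "(-1) \<odot> x \<in> carrier V" using x by (rule scale_closed)
    show "(-1) \<odot> x \<oplus> x = \<zero>"
      by (rule eqI) (simp_all add: x scale_closed add_closed zero_closed add scale zero)
  qed
  have ab: "abelian_group V"
  proof (rule abelian_groupI)
    show "\<exists>y\<in>carrier V. y \<oplus> x = \<zero>" if "x \<in> carrier V" for x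
      using inv[OF that] .
  qed (auto intro!: eqI simp: add_closed zero_closed add zero algebra_simps)
  interpret K: Ring.field complex_field by (rule field_complex_field)
  have sel: "a \<oplus>\<^bsub>complex_field\<^esub> b = a + b" "a \<otimes>\<^bsub>complex_field\<^esub> b = a * b"
    "\<one>\<^bsub>complex_field\<^esub> = 1" for a b
    by (simp_all add: complex_field_def)
  have "Module.module complex_field V"
  proof (rule moduleI[OF K.is_cring ab], unfold sel)
    fix a b :: complex and x y assume xy: "x \<in> carrier V" "y \<in> carrier V"
    show "a \<odot> (x \<oplus> y) = a \<odot> x \<oplus> a \<odot> y"
      by (rule eqI) (simp_all add: xy scale_closed add_closed add scale algebra_simps)
  next
    fix a b :: complex and x assume x: "x \<in> carrier V"
    show "a \<odot> x \<in> carrier V" using x by (rule scale_closed)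
    show "(a + b) \<odot> x = a \<odot> x \<oplus> b \<odot> x" "(a * b) \<odot> x = a \<odot> (b \<odot> x)" "1 \<odot> x = x"
      by (rule eqI; simp add: x scale_closed add_closed add scale algebra_simps)+
  qed
  then show ?thesis
    by (intro vectorspace.intro K.field_axioms)
qed

sublocale vs: vectorspace complex_field V
  by (rule vectorspace_V)

lemma finsum_closed:
  assumes "\<And>i. i \<in> I \<Longrightarrow> b i \<in> carrier V"
  shows "(\<Oplus>i\<in>I. c i \<odot> b i) \<in> carrier V"
  using assms by (intro vs.finsum_closed) (auto intro: scale_closed)

lemma coordinates_finsum:
  assumes "finite I" "\<And>i. i \<in> I \<Longrightarrow> b i \<in> carrier V" "a \<in> A"
  shows "\<phi> (\<Oplus>i\<in>I. c i \<odot> b i) a = (\<Sum>i\<in>I. c i * \<phi> (b i) a)"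
  using assms
proof (induction I rule: finite_induct)
  case (insert i I)
  then have "(\<Oplus>i\<in>insert i I. c i \<odot> b i) = c i \<odot> b i \<oplus> (\<Oplus>i\<in>I. c i \<odot> b i)"
    by (intro vs.finsum_insert) (auto intro: scale_closed)
  then show ?case
    using insert by (simp add: add scale scale_closed finsum_closed)
qed (simp add: zero)

definition unit_vector :: "'i \<Rightarrow> 'a"
  where "unit_vector a = inv_into (carrier V) \<phi> (\<lambda>k\<in>A. if k = a then 1 else 0)"

lemma unit_vector: "unit_vector a \<in> carrier V" "\<phi> (unit_vector a) = (\<lambda>k\<in>A. if k = a then 1 else 0)"
proof -
  have "(\<lambda>k\<in>A. if k = a then 1 else 0) \<in> \<phi> ` carrier V"
    using bij by (auto simp: bij_betw_def)
  then show "unit_vector a \<in> carrier V" "\<phi> (unit_vector a) = (\<lambda>k\<in>A. if k = a then 1 else 0)"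
    unfolding unit_vector_def by (rule inv_into_into, rule f_inv_into_f)
qed

lemma inj_unit_vector: "inj_on unit_vector A"
proof
  fix a b assume ab: "a \<in> A" "b \<in> A" "unit_vector a = unit_vector b"
  then have "\<phi> (unit_vector a) a = \<phi> (unit_vector b) a" by simp
  then show "a = b" using ab(1) unfolding unit_vector by (auto split: if_splits)
qed

lemma basis_unit_vectors: "vs.basis (unit_vector ` A)"
proof -
  let ?B = "unit_vector ` A"
  have "\<exists>!c. c \<in> ?B \<rightarrow>\<^sub>E carrier complex_field \<and> vs.lincomb c ?B = v" if v: "v \<in> carrier V" for v
  proof -
    have eq: "vs.lincomb c ?B = v \<longleftrightarrow> (\<forall>a\<in>A. c (unit_vector a) = \<phi> v a)" for c
    proof -
      have cl: "vs.lincomb c ?B \<in> carrier V"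
        unfolding vs.lincomb_def by (intro finsum_closed) (auto simp: unit_vector)
      have "\<phi> (vs.lincomb c ?B) a = c (unit_vector a)" if a: "a \<in> A" for a
      proof -
        have "\<phi> (vs.lincomb c ?B) a = (\<Sum>w\<in>?B. c w * \<phi> w a)"
          unfolding vs.lincomb_def using a finite_A by (intro coordinates_finsum) (auto simp: unit_vector)
        also have "\<dots> = (\<Sum>k\<in>A. c (unit_vector k) * \<phi> (unit_vector k) a)"
          by (simp add: sum.reindex[OF inj_unit_vector])
        also have "\<dots> = (\<Sum>k\<in>A. if k = a then c (unit_vector k) else 0)"
          using a by (intro sum.cong) (auto simp: unit_vector)
        finally show ?thesis using a finite_A by simp
      qed
      then show ?thesis using eqI[OF cl v] by auto
    qed
    define c where "c = (\<lambda>w\<in>?B. \<phi> v (inv_into A unit_vector w))"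
    show ?thesis
    proof (rule ex1I[of _ c])
      show "c \<in> ?B \<rightarrow>\<^sub>E carrier complex_field \<and> vs.lincomb c ?B = v"
        unfolding eq by (auto simp: c_def complex_field_def inj_unit_vector)
      fix d assume d: "d \<in> ?B \<rightarrow>\<^sub>E carrier complex_field \<and> vs.lincomb d ?B = v"
      then have "\<forall>a\<in>A. d (unit_vector a) = \<phi> v a" unfolding eq by blast
      then show "d = c"
        using d by (intro PiE_ext[of d ?B "\<lambda>_. UNIV"]) (auto simp: c_def inj_unit_vector PiE_iff)
    qed
  qed
  then show ?thesis
    by (subst vs.basis_criterion) (auto simp: finite_A unit_vector)
qed

lemma dim_V: "vs.dim = card A"
  using vs.dim_basis[OF _ basis_unit_vectors] finite_A by (simp add: card_image inj_unit_vector)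

lemma continuous_map_linear_combination:
  assumes "\<And>i. i \<in> I \<Longrightarrow> b i \<in> carrier V" "finite I"
  shows "continuous_map (cspace I) (cspace A) (\<lambda>x. \<phi> (\<Oplus>i\<in>I. x i \<odot> b i))"
  unfolding continuous_map_componentwise
proof (intro conjI ballI)
  have "\<phi> (\<Oplus>i\<in>I. x i \<odot> b i) \<in> A \<rightarrow>\<^sub>E UNIV" for x
    using assms by (intro coordinates_in finsum_closed)
  then show "(\<lambda>x. \<phi> (\<Oplus>i\<in>I. x i \<odot> b i)) ` topspace (cspace I) \<subseteq> extensional A"
    by (auto simp: PiE_def)
  fix a assume "a \<in> A"
  then have "(\<lambda>x. \<phi> (\<Oplus>i\<in>I. x i \<odot> b i) a) = (\<lambda>x. \<Sum>i\<in>I. x i * \<phi> (b i) a)"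
    using assms by (intro ext coordinates_finsum)
  moreover have "continuous_map (cspace I) euclidean (\<lambda>x. \<Sum>i\<in>I. x i * \<phi> (b i) a)"
    unfolding continuous_map_euclidean_iff_tendsto
  proof (intro ballI tendsto_sum tendsto_mult tendsto_const)
    fix x i assume "x \<in> topspace (cspace I)" "i \<in> I"
    then show "((\<lambda>x. x i) \<longlongrightarrow> x i) (atin (cspace I) x)"
      using continuous_map_product_projection[of i I "\<lambda>_. euclidean"]
      unfolding continuous_map_euclidean_iff_tendsto by blast
  qed
  ultimately show "continuous_map (cspace I) euclidean (\<lambda>x. \<phi> (\<Oplus>i\<in>I. x i \<odot> b i) a)"
    by simp
qed

text \<open>The topology of \<open>V\<close> is defined through all bases. One direction uses the basis of unit vectors, the
  other the continuity of the linear map from \<open>\<complex>\<^sup>n\<close> to \<open>\<complex>\<^sup>A\<close> given by an arbitrary basis.\<close>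

lemma openin_vs_topology_iff:
  "openin (vs_topology V) U \<longleftrightarrow> U \<subseteq> carrier V \<and> openin (cspace A) (\<phi> ` U)"
proof
  assume U: "openin (vs_topology V) U"
  then have sub: "U \<subseteq> carrier V" by (simp add: openin_vs_topology)
  define n where "n = card A"
  obtain e where e: "bij_betw e {..<n} A"
    using ex_bij_betw_nat_finite[OF finite_A] by (auto simp: n_def lessThan_atLeast0)
  have eA: "e i \<in> A" if "i < n" for i using e that by (auto simp: bij_betw_def)
  define b where "b = unit_vector \<circ> e"
  have bc: "b i \<in> carrier V" for i by (simp add: b_def unit_vector)
  have enum: "inj_on b {..<n}" "b ` {..<n} = unit_vector ` A"
    unfolding b_def using e inj_unit_vector by (auto simp: bij_betw_def comp_inj_on image_comp[symmetric])
  have op: "openin (cspace {..<n}) {x \<in> {..<n} \<rightarrow>\<^sub>E UNIV. (\<Oplus>i\<in>{..<n}. x i \<odot> b i) \<in> U}"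
    by (rule U[unfolded openin_vs_topology, THEN conjunct2, rule_format])
      (simp add: enum basis_unit_vectors)
  define R where "R = (\<lambda>h. \<lambda>i\<in>{..<n}. h (e i) :: complex)"
  have R: "continuous_map (cspace A) (cspace {..<n}) R"
    unfolding continuous_map_componentwise
  proof (intro conjI ballI)
    fix i assume i: "i \<in> {..<n}"
    have "continuous_map (cspace A) euclidean (\<lambda>h. h (e i))"
      using eA i by (intro continuous_map_product_projection) auto
    then show "continuous_map (cspace A) euclidean (\<lambda>h. R h i)"
      using i by (simp add: R_def)
  qed (auto simp: R_def)
  have comb: "(\<Oplus>i\<in>{..<n}. R (\<phi> v) i \<odot> b i) = v" if v: "v \<in> carrier V" for v
  proof (rule eqI)
    show "(\<Oplus>i\<in>{..<n}. R (\<phi> v) i \<odot> b i) \<in> carrier V"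
      by (intro finsum_closed bc)
    fix a assume a: "a \<in> A"
    have "\<phi> (\<Oplus>i\<in>{..<n}. R (\<phi> v) i \<odot> b i) a = (\<Sum>i<n. R (\<phi> v) i * \<phi> (b i) a)"
      using a by (intro coordinates_finsum bc) auto
    also have "\<dots> = (\<Sum>i<n. (\<lambda>k. if k = a then \<phi> v k else 0) (e i))"
      using a by (intro sum.cong) (auto simp: R_def b_def unit_vector)
    also have "\<dots> = (\<Sum>k\<in>A. if k = a then \<phi> v k else 0)"
      using sum.reindex_bij_betw[OF e] .
    also have "\<dots> = \<phi> v a" using a finite_A by simp
    finally show "\<phi> (\<Oplus>i\<in>{..<n}. R (\<phi> v) i \<odot> b i) a = \<phi> v a" .
  qed (rule v)
  have "openin (cspace A) {h \<in> topspace (cspace A). R h \<in> {x \<in> {..<n} \<rightarrow>\<^sub>E UNIV. (\<Oplus>i\<in>{..<n}. x i \<odot> b i) \<in> U}}"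
    using R op by (rule openin_continuous_map_preimage)
  also have "{h \<in> topspace (cspace A). R h \<in> {x \<in> {..<n} \<rightarrow>\<^sub>E UNIV. (\<Oplus>i\<in>{..<n}. x i \<odot> b i) \<in> U}} = \<phi> ` U"
  proof (intro equalityI subsetI)
    fix h assume h: "h \<in> {h \<in> topspace (cspace A). R h \<in> {x \<in> {..<n} \<rightarrow>\<^sub>E UNIV. (\<Oplus>i\<in>{..<n}. x i \<odot> b i) \<in> U}}"
    then have "h \<in> A \<rightarrow>\<^sub>E UNIV" by simp
    then obtain v where v: "v \<in> carrier V" "\<phi> v = h" by (rule surj)
    then show "h \<in> \<phi> ` U" using h comb[OF v(1)] by auto
  next
    fix h assume "h \<in> \<phi> ` U"
    then obtain v where v: "v \<in> U" "h = \<phi> v" by blast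
    then show "h \<in> {h \<in> topspace (cspace A). R h \<in> {x \<in> {..<n} \<rightarrow>\<^sub>E UNIV. (\<Oplus>i\<in>{..<n}. x i \<odot> b i) \<in> U}}"
      using comb[of v] coordinates_in[of v] sub by (auto simp: R_def)
  qed
  finally show "U \<subseteq> carrier V \<and> openin (cspace A) (\<phi> ` U)" using sub by simp
next
  assume U: "U \<subseteq> carrier V \<and> openin (cspace A) (\<phi> ` U)"
  show "openin (vs_topology V) U"
    unfolding openin_vs_topology
  proof (intro conjI allI impI)
    fix n :: nat and b assume "inj_on b {..<n} \<and> vs.basis (b ` {..<n})"
    then have b: "b i \<in> carrier V" if "i \<in> {..<n}" for i
      using that by (auto simp: vs.basis_def)
    have mem: "\<phi> x \<in> \<phi> ` U \<longleftrightarrow> x \<in> U" if "x \<in> carrier V" for x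
      using inj_on_image_mem_iff[of \<phi> "carrier V" x U] U that bij by (auto simp: bij_betw_def)
    have "openin (cspace {..<n}) {x \<in> topspace (cspace {..<n}). \<phi> (\<Oplus>i\<in>{..<n}. x i \<odot> b i) \<in> \<phi> ` U}"
    proof (rule openin_continuous_map_preimage)
      show "continuous_map (cspace {..<n}) (cspace A) (\<lambda>x. \<phi> (\<Oplus>i\<in>{..<n}. x i \<odot> b i))"
        using b by (rule continuous_map_linear_combination) simp_all
    qed (use U in simp)
    also have "{x \<in> topspace (cspace {..<n}). \<phi> (\<Oplus>i\<in>{..<n}. x i \<odot> b i) \<in> \<phi> ` U} =
        {x \<in> {..<n} \<rightarrow>\<^sub>E UNIV. (\<Oplus>i\<in>{..<n}. x i \<odot> b i) \<in> U}"
    proof -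
      have "(\<Oplus>i\<in>{..<n}. x i \<odot> b i) \<in> carrier V" for x
        using b by (rule finsum_closed)
      then show ?thesis
        by (simp only: mem topspace_product_topology topspace_euclidean)
    qed
    finally show "openin (cspace {..<n}) {x \<in> {..<n} \<rightarrow>\<^sub>E UNIV. (\<Oplus>i\<in>{..<n}. x i \<odot> b i) \<in> U}" .
  qed (use U in auto)
qed

lemma topspace_vs_topology: "topspace (vs_topology V) = carrier V"
proof -
  have "openin (vs_topology V) (carrier V)"
    using bij openin_topspace[of "cspace A"] by (simp add: openin_vs_topology_iff bij_betw_def)
  then show ?thesis
    by (metis openin_subset openin_topspace openin_vs_topology_iff subset_antisym)
qed

lemma homeomorphic_map_coordinates: "homeomorphic_map (vs_topology V) (cspace A) \<phi>"
  unfolding homeomorphic_map_def quotient_map_def topspace_vs_topology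
proof (intro conjI allI impI)
  show im: "\<phi> ` carrier V = topspace (cspace A)" "inj_on \<phi> (carrier V)"
    using bij by (auto simp: bij_betw_def)
  fix U assume U: "U \<subseteq> topspace (cspace A)"
  then have "\<phi> ` {x \<in> carrier V. \<phi> x \<in> U} = U"
    unfolding im(1)[symmetric] by blast
  then show "openin (vs_topology V) {x \<in> carrier V. \<phi> x \<in> U} = openin (cspace A) U"
    by (auto simp: openin_vs_topology_iff)
qed

theorem euler_characteristic_projectivization:
  assumes "finite \<K>" "\<And>K. K \<in> \<K> \<Longrightarrow> K \<subseteq> A" "\<And>K. K \<in> \<K> \<Longrightarrow> K \<noteq> {}"
    and F: "F = {x \<in> carrier V. \<exists>K\<in>\<K>. \<forall>k\<in>K. \<phi> x k \<noteq> 0}"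
  shows "euler_characteristic (projectivization V F) = int (card {a. {a} \<in> \<K>})"
proof -
  let ?F = "\<Union>(nonvanishing A ` \<K>)"
  define p where "p = (\<lambda>x. {c \<odot> x | c. c \<noteq> 0})"
  define g where "g = p \<circ> inv_into (carrier V) \<phi>"
  have FV: "F \<subseteq> carrier V" by (auto simp: F)
  have img: "\<phi> ` F = ?F"
  proof (intro equalityI subsetI)
    fix h assume "h \<in> ?F"
    then obtain K where K: "K \<in> \<K>" "h \<in> nonvanishing A K" by blast
    then obtain v where "v \<in> carrier V" "\<phi> v = h"
      using surj[of h] by (auto simp: nonvanishing_def)
    then show "h \<in> \<phi> ` F" using K by (auto simp: F nonvanishing_def)
  qed (use coordinates_in in \<open>auto simp: F nonvanishing_def\<close>)
  have inv: "inv_into (carrier V) \<phi> (\<phi> x) = x" if "x \<in> carrier V" for x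
    using that bij by (auto simp: bij_betw_def)
  have hom: "homeomorphic_map (subtopology (vs_topology V) F) (subtopology (cspace A) ?F) \<phi>"
    using homeomorphic_map_coordinates
  proof (rule homeomorphic_map_subtopologies)
    have "carrier V \<inter> F = F" "(A \<rightarrow>\<^sub>E UNIV) \<inter> ?F = ?F"
      using FV by (auto simp: nonvanishing_def)
    then show "\<phi> ` (topspace (vs_topology V) \<inter> F) = topspace (cspace A) \<inter> ?F"
      by (simp add: topspace_vs_topology img)
  qed
  let ?PF = "projectivization V F"
  have "quotient_map (subtopology (vs_topology V) F) ?PF p"
    unfolding projectivization_def p_def by (rule quotient_map_quotient_topology)
  then have "quotient_map (subtopology (vs_topology V) F) ?PF (g \<circ> \<phi>)"
    by (rule quotient_map_eq) (auto simp: g_def inv topspace_vs_topology)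
  then have q: "quotient_map (subtopology (cspace A) ?F) ?PF g"
    using quotient_map_compose_eq hom unfolding homeomorphic_map_def by blast
  interpret projective_quotient A ?F ?PF g
  proof
    show "g x = g y \<longleftrightarrow> (\<exists>c. c \<noteq> 0 \<and> y = scale_on A c x)" if xy: "x \<in> ?F" "y \<in> ?F" for x y
    proof -
      obtain v w where v: "v \<in> F" "x = \<phi> v" and w: "w \<in> F" "y = \<phi> w"
        using xy unfolding img[symmetric] by blast
      then have vw: "v \<in> carrier V" "w \<in> carrier V" using FV by auto
      have one: "1 \<odot> u = u" if "u \<in> carrier V" for u
        by (rule eqI) (simp_all add: that scale_closed scale)
      have assoc: "c \<odot> (d \<odot> u) = (c * d) \<odot> u" if "u \<in> carrier V" for c d u
        by (rule eqI) (simp_all add: that scale_closed scale)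
      have "g x = g y \<longleftrightarrow> p v = p w"
        using v w vw by (simp add: g_def inv)
      also have "\<dots> \<longleftrightarrow> (\<exists>c. c \<noteq> 0 \<and> w = c \<odot> v)"
      proof
        assume "p v = p w"
        moreover have "w \<in> p w" using one[OF vw(2)] by (force simp: p_def intro: exI[of _ 1])
        ultimately show "\<exists>c. c \<noteq> 0 \<and> w = c \<odot> v" by (auto simp: p_def)
      next
        assume "\<exists>c. c \<noteq> 0 \<and> w = c \<odot> v"
        then obtain c where c: "c \<noteq> 0" "w = c \<odot> v" by blast
        show "p v = p w"
        proof (intro equalityI subsetI)
          fix u assume "u \<in> p v"
          then obtain d where "d \<noteq> 0" "u = d \<odot> v" by (auto simp: p_def)
          then have "u = (d / c) \<odot> w" "d / c \<noteq> 0" using c assoc[OF vw(1)] by simp_all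
          then show "u \<in> p w" by (auto simp: p_def)
        next
          fix u assume "u \<in> p w"
          then obtain d where "d \<noteq> 0" "u = d \<odot> w" by (auto simp: p_def)
          then have "u = (d * c) \<odot> v" "d * c \<noteq> 0" using c assoc[OF vw(1)] by simp_all
          then show "u \<in> p v" by (auto simp: p_def)
        qed
      qed
      also have "\<dots> \<longleftrightarrow> (\<exists>c. c \<noteq> 0 \<and> \<phi> w = scale_on A c (\<phi> v))"
      proof -
        have "\<phi> (c \<odot> v) = scale_on A c (\<phi> v)" for c
          using coordinates_in[OF scale_closed[OF vw(1)]] scale[OF vw(1)]
          by (intro PiE_ext[of _ A "\<lambda>_. UNIV"]) (auto simp: scale_on_def)
        then show ?thesis
          using vw scale_closed[OF vw(1)] inv by metis
      qed
      finally show ?thesis using v w by simp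
    qed
  qed (use finite_A q in \<open>auto simp: nonvanishing_def\<close>)
  have "has_euler (subtopology ?PF (g ` ?F)) {} (int (card {a. {a} \<in> \<K>}))"
    using assms(1-3) by (intro has_euler_union_of_charts) auto
  moreover have "g ` ?F = topspace ?PF"
    using quotient_imp_surjective_map[OF q] unfolding topspace_F .
  ultimately show ?thesis
    by (intro euler_characteristic_eq) (simp add: subtopology_topspace)
qed

end

text \<open>Coordinates on a quotient \<open>Q = \<pi>(U)\<close> come from a surjective linear map \<open>T\<close> on \<open>U\<close> with the same
  fibres as \<open>\<pi>\<close>.\<close>

lemma linear_coordinates_of_image:
  fixes Q :: "(complex, 'b) module" and V :: "(complex, 'a) module" and T :: "'a \<Rightarrow> 'i \<Rightarrow> complex"
  assumes "finite A" and Q: "carrier Q = \<pi> ` U" and TU: "T ` U = A \<rightarrow>\<^sub>E UNIV"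
    and eq: "\<And>g h. g \<in> U \<Longrightarrow> h \<in> U \<Longrightarrow> \<pi> g = \<pi> h \<longleftrightarrow> T g = T h"
    and z: "z \<in> U" "\<zero>\<^bsub>Q\<^esub> = \<pi> z" "\<And>a. a \<in> A \<Longrightarrow> T z a = 0"
    and plus: "\<And>g h. g \<in> U \<Longrightarrow> h \<in> U \<Longrightarrow> g \<oplus>\<^bsub>V\<^esub> h \<in> U \<and> \<pi> g \<oplus>\<^bsub>Q\<^esub> \<pi> h = \<pi> (g \<oplus>\<^bsub>V\<^esub> h)
      \<and> (\<forall>a\<in>A. T (g \<oplus>\<^bsub>V\<^esub> h) a = T g a + T h a)"
    and times: "\<And>c g. g \<in> U \<Longrightarrow> c \<odot>\<^bsub>V\<^esub> g \<in> U \<and> c \<odot>\<^bsub>Q\<^esub> \<pi> g = \<pi> (c \<odot>\<^bsub>V\<^esub> g)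
      \<and> (\<forall>a\<in>A. T (c \<odot>\<^bsub>V\<^esub> g) a = c * T g a)"
  shows "linear_coordinates Q (T \<circ> inv_into U \<pi>) A"
    and "\<And>g. g \<in> U \<Longrightarrow> (T \<circ> inv_into U \<pi>) (\<pi> g) = T g"
proof -
  show *: "(T \<circ> inv_into U \<pi>) (\<pi> g) = T g" if "g \<in> U" for g
    using eq[of "inv_into U \<pi> (\<pi> g)" g] that by (auto simp: inv_into_into f_inv_into_f)
  show "linear_coordinates Q (T \<circ> inv_into U \<pi>) A"
  proof
    have "inj_on (T \<circ> inv_into U \<pi>) (carrier Q)"
      unfolding Q using * eq by (auto intro!: inj_onI simp del: comp_apply)
    moreover have "(T \<circ> inv_into U \<pi>) ` carrier Q = A \<rightarrow>\<^sub>E UNIV"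
      unfolding Q image_image using * TU by (simp del: comp_apply)
    ultimately show "bij_betw (T \<circ> inv_into U \<pi>) (carrier Q) (A \<rightarrow>\<^sub>E UNIV)"
      by (simp add: bij_betw_def)
  qed (use assms * in \<open>auto simp del: comp_apply\<close>)
qed

section \<open>Quotients of spaces of power series\<close>

lemma bex_ranges_iff: "(\<exists>K\<in>range ` {f. Q f}. \<forall>k\<in>K. P k) \<longleftrightarrow> (\<exists>f. Q f \<and> (\<forall>j. P (f j)))"
  by auto

text \<open>A space whose elements are determined by families of coefficients, such as germs by their power
  series, and which contains all polynomials. The filtration consists of subspaces on which certain
  coefficients vanish, and its quotients are described by the coefficients that vanish on the
  smaller subspace only.\<close>

locale series_space =
  fixes V :: "(complex, 'a) module" (structure) and E :: "'a \<Rightarrow> 'm \<Rightarrow> complex" and S :: "'m set"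
  assumes inj: "inj_on E (carrier V)"
    and supp: "\<And>x m. x \<in> carrier V \<Longrightarrow> m \<notin> S \<Longrightarrow> E x m = 0"
    and zero_closed: "\<zero> \<in> carrier V" and zero: "E \<zero> m = 0"
    and add_closed: "\<And>x y. x \<in> carrier V \<Longrightarrow> y \<in> carrier V \<Longrightarrow> x \<oplus> y \<in> carrier V"
    and add: "\<And>x y. x \<in> carrier V \<Longrightarrow> y \<in> carrier V \<Longrightarrow> E (x \<oplus> y) m = E x m + E y m"
    and scale_closed: "\<And>c x. x \<in> carrier V \<Longrightarrow> c \<odot> x \<in> carrier V"
    and scale: "\<And>c x. x \<in> carrier V \<Longrightarrow> E (c \<odot> x) m = c * E x m"
    and polynomials: "\<And>A h. finite A \<Longrightarrow> A \<subseteq> S \<Longrightarrow> (\<And>m. m \<notin> A \<Longrightarrow> h m = 0) \<Longrightarrow> \<exists>x\<in>carrier V. E x = h"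
begin

lemma eqI: "x \<in> carrier V \<Longrightarrow> y \<in> carrier V \<Longrightarrow> (\<And>m. E x m = E y m) \<Longrightarrow> x = y"
  by (rule inj_onD[OF inj]) auto

definition vanishing :: "'m set \<Rightarrow> 'a set"
  where "vanishing N = {x \<in> carrier V. \<forall>m\<in>N. E x m = 0}"

lemma vanishing_closed:
  "\<zero> \<in> vanishing N"
  "x \<in> vanishing N \<Longrightarrow> y \<in> vanishing N \<Longrightarrow> x \<oplus> y \<in> vanishing N"
  "x \<in> vanishing N \<Longrightarrow> c \<odot> x \<in> vanishing N"
  by (auto simp: vanishing_def zero_closed zero add_closed add scale_closed scale)

text \<open>Cosets become fibres of a restriction map, which turns the set operations on cosets into identities
  between coefficients.\<close>

lemma coset_eq:
  assumes g: "g \<in> vanishing N"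
  shows "vanishing (N \<union> B) +> g = {h \<in> vanishing N. \<forall>m\<in>B. E h m = E g m}"
proof (intro equalityI subsetI)
  fix h assume "h \<in> vanishing (N \<union> B) +> g"
  then show "h \<in> {h \<in> vanishing N. \<forall>m\<in>B. E h m = E g m}"
    using g by (auto simp: a_r_coset_def' vanishing_def add_closed add)
next
  fix h assume h: "h \<in> {h \<in> vanishing N. \<forall>m\<in>B. E h m = E g m}"
  have gh: "g \<in> carrier V" "h \<in> carrier V" using g h by (auto simp: vanishing_def)
  define k where "k = h \<oplus> (-1) \<odot> g"
  have k: "k \<in> vanishing (N \<union> B)"
    using g h by (auto simp: k_def vanishing_def scale_closed add_closed add scale)
  moreover have "h = k \<oplus> g"
    by (rule eqI) (simp_all add: k_def gh scale_closed add_closed add scale)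
  ultimately show "h \<in> vanishing (N \<union> B) +> g"
    by (auto simp: a_r_coset_def')
qed

lemma coset_eq_iff:
  assumes "g \<in> vanishing N" "h \<in> vanishing N"
  shows "vanishing (N \<union> B) +> g = vanishing (N \<union> B) +> h \<longleftrightarrow> (\<forall>m\<in>B. E g m = E h m)"
  unfolding assms[THEN coset_eq] using assms by auto

lemma coset_zero: "vanishing (N \<union> B) +> \<zero> = vanishing (N \<union> B)"
  by (subst coset_eq) (auto simp: vanishing_closed zero, auto simp: vanishing_def)

lemma coset_add:
  assumes g: "g \<in> vanishing N" and h: "h \<in> vanishing N"
  shows "set_add V (vanishing (N \<union> B) +> g) (vanishing (N \<union> B) +> h) = vanishing (N \<union> B) +> (g \<oplus> h)"
proof -
  have gh: "g \<in> carrier V" "h \<in> carrier V" using g h by (auto simp: vanishing_def)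
  show ?thesis
    unfolding coset_eq[OF g] coset_eq[OF h] coset_eq[OF vanishing_closed(2)[OF g h]]
  proof (intro equalityI subsetI)
    fix k assume "k \<in> set_add V {k \<in> vanishing N. \<forall>m\<in>B. E k m = E g m} {k \<in> vanishing N. \<forall>m\<in>B. E k m = E h m}"
    then show "k \<in> {k \<in> vanishing N. \<forall>m\<in>B. E k m = E (g \<oplus> h) m}"
      using gh by (auto simp: set_add_def' vanishing_closed add, simp add: vanishing_def add)
  next
    fix k assume k: "k \<in> {k \<in> vanishing N. \<forall>m\<in>B. E k m = E (g \<oplus> h) m}"
    define l where "l = k \<oplus> (-1) \<odot> h"
    have kc: "k \<in> carrier V" using k by (auto simp: vanishing_def)
    have "l \<in> vanishing N" using k h by (auto simp: l_def vanishing_closed)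
    moreover have "\<forall>m\<in>B. E l m = E g m"
      using k kc gh by (auto simp: l_def add scale scale_closed)
    moreover have "k = l \<oplus> h"
      by (rule eqI) (simp_all add: l_def gh kc scale_closed add_closed add scale)
    ultimately show "k \<in> set_add V {k \<in> vanishing N. \<forall>m\<in>B. E k m = E g m} {k \<in> vanishing N. \<forall>m\<in>B. E k m = E h m}"
      using h unfolding set_add_def' by blast
  qed
qed

lemma coset_scale:
  assumes g: "g \<in> vanishing N"
  shows "(\<Union>a\<in>vanishing (N \<union> B) +> g. vanishing (N \<union> B) +> (c \<odot> a)) = vanishing (N \<union> B) +> (c \<odot> g)"
proof -
  have "vanishing (N \<union> B) +> (c \<odot> a) = vanishing (N \<union> B) +> (c \<odot> g)" if "a \<in> vanishing (N \<union> B) +> g" for a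
  proof -
    have a: "a \<in> vanishing N" "\<forall>m\<in>B. E a m = E g m" using that unfolding coset_eq[OF g] by auto
    show ?thesis
      using a g by (subst coset_eq_iff[of _ N]) (auto simp: vanishing_closed, auto simp: vanishing_def scale)
  qed
  moreover have "g \<in> vanishing (N \<union> B) +> g"
    unfolding coset_eq[OF g] using g by simp
  ultimately show ?thesis by blast
qed

lemma restrict_eq_iff:
  assumes "g \<in> vanishing N" "h \<in> vanishing N" "A = (B - N) \<inter> S"
  shows "restrict (E g) A = restrict (E h) A \<longleftrightarrow> (\<forall>m\<in>B. E g m = E h m)"
proof
  assume *: "restrict (E g) A = restrict (E h) A"
  show "\<forall>m\<in>B. E g m = E h m"
  proof
    fix m assume m: "m \<in> B"
    show "E g m = E h m"
    proof (cases "m \<in> A")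
      case True then show ?thesis using fun_cong[OF *, of m] by simp
    next
      case False
      then have "m \<in> N \<or> m \<notin> S" using assms(3) m by blast
      then show ?thesis using assms(1,2) supp by (auto simp: vanishing_def)
    qed
  qed
qed (auto simp: assms(3) restrict_def)

lemma restrict_image:
  assumes "finite A" "A = (B - N) \<inter> S"
  shows "(\<lambda>g. restrict (E g) A) ` vanishing N = A \<rightarrow>\<^sub>E UNIV"
proof (intro equalityI subsetI)
  fix h assume h: "h \<in> A \<rightarrow>\<^sub>E (UNIV :: complex set)"
  have "\<exists>x\<in>carrier V. E x = (\<lambda>m. if m \<in> A then h m else 0)"
    using assms by (intro polynomials[of A]) auto
  then obtain x where x: "x \<in> carrier V" "E x = (\<lambda>m. if m \<in> A then h m else 0)"
    by blast
  have "h = restrict (E x) A" using h by (auto simp: x fun_eq_iff PiE_def extensional_def)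
  moreover have "x \<in> vanishing N" using x assms(2) by (auto simp: vanishing_def)
  ultimately show "h \<in> (\<lambda>g. restrict (E g) A) ` vanishing N" by blast
qed auto

theorem dim_quotient:
  assumes "finite A" "A = (B - N) \<inter> S"
  shows "vectorspace.dim complex_field (quotient_space V (vanishing N) (vanishing (N \<union> B))) = card A"
proof -
  let ?\<pi> = "\<lambda>g. vanishing (N \<union> B) +> g" and ?T = "\<lambda>g. restrict (E g) A"
  have "linear_coordinates (quotient_space V (vanishing N) (vanishing (N \<union> B)))
      (?T \<circ> inv_into (vanishing N) ?\<pi>) A"
  proof (rule linear_coordinates_of_image(1)[where V = V and z = \<zero>])
    show "(?\<pi> g = ?\<pi> h) = (?T g = ?T h)" if "g \<in> vanishing N" "h \<in> vanishing N" for g h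
      using restrict_eq_iff[OF that assms(2)] coset_eq_iff[OF that] by simp
  qed (auto simp: assms(1) restrict_image[OF assms] quotient_space_def vanishing_closed coset_zero
      zero coset_add coset_scale, auto simp: vanishing_def add scale)
  then show ?thesis
    by (rule linear_coordinates.dim_V)
qed

text \<open>In the coordinates given by the coefficients at the exponents in \<open>A\<close>, the \<open>j\<close>th component of
  an element is nonzero iff some coefficient at an exponent in \<open>A \<inter> B j\<close> is nonzero. Choosing such
  an exponent for each \<open>j\<close> writes the fibre as a union of charts, one for each choice function
  \<open>f\<close>, namely that of the set \<open>range f\<close>. This set is a singleton \<open>{a}\<close> only if \<open>a\<close> lies in all \<open>B j\<close>.\<close>

theorem euler_characteristic_fiber:
  fixes B :: "'r::finite \<Rightarrow> 'm set" and N
  defines "C \<equiv> \<lambda>j. quotient_space V (vanishing N) (vanishing (N \<union> B j))"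
  defines "D \<equiv> product_space C \<lparr>carrier := (\<lambda>g j. vanishing (N \<union> B j) +> g) ` vanishing N\<rparr>"
  assumes fin: "finite (((\<Union>j. B j) - N) \<inter> S)"
  shows "euler_characteristic (projectivization D
      (carrier D \<inter> {x. \<forall>j. x j \<in> carrier (C j) - {\<zero>\<^bsub>C j\<^esub>}})) = int (card (((\<Inter>j. B j) - N) \<inter> S))"
proof -
  define A where "A = ((\<Union>j. B j) - N) \<inter> S"
  let ?\<pi> = "\<lambda>g j. vanishing (N \<union> B j) +> g" and ?T = "\<lambda>g. restrict (E g) A"
  let ?\<phi> = "?T \<circ> inv_into (vanishing N) ?\<pi>"
  have eq: "(?\<pi> g = ?\<pi> h) = (?T g = ?T h)" if "g \<in> vanishing N" "h \<in> vanishing N" for g h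
    using restrict_eq_iff[OF that A_def] coset_eq_iff[OF that] by (auto simp: fun_eq_iff)
  have TN: "?T ` vanishing N = A \<rightarrow>\<^sub>E UNIV"
    by (rule restrict_image[OF _ A_def]) (simp add: A_def fin)
  have carrier_D: "carrier D = ?\<pi> ` vanishing N"
    by (simp add: D_def)
  have lc: "linear_coordinates D ?\<phi> A" and \<phi>: "\<And>g. g \<in> vanishing N \<Longrightarrow> ?\<phi> (?\<pi> g) = ?T g"
  proof -
    have *: "finite A" "\<zero> \<in> vanishing N" "\<zero>\<^bsub>D\<^esub> = ?\<pi> \<zero>" "\<And>a. a \<in> A \<Longrightarrow> ?T \<zero> a = 0"
      using fin by (auto simp: A_def D_def C_def product_space_def quotient_space_def coset_zero zero
          vanishing_closed)
    have plus: "g \<oplus> h \<in> vanishing N \<and> ?\<pi> g \<oplus>\<^bsub>D\<^esub> ?\<pi> h = ?\<pi> (g \<oplus> h) \<and>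
        (\<forall>a\<in>A. ?T (g \<oplus> h) a = ?T g a + ?T h a)" if "g \<in> vanishing N" "h \<in> vanishing N" for g h
      using that coset_add[OF that]
      by (auto simp: vanishing_closed D_def C_def product_space_def quotient_space_def)
        (auto simp: vanishing_def add)
    have times: "c \<odot> g \<in> vanishing N \<and> c \<odot>\<^bsub>D\<^esub> ?\<pi> g = ?\<pi> (c \<odot> g) \<and>
        (\<forall>a\<in>A. ?T (c \<odot> g) a = c * ?T g a)" if "g \<in> vanishing N" for c g
      using that coset_scale[OF that]
      by (auto simp: vanishing_closed D_def C_def product_space_def quotient_space_def)
        (auto simp: vanishing_def scale)
    note lin = linear_coordinates_of_image[of A D ?\<pi> "vanishing N" ?T \<zero> V,
        OF *(1) carrier_D TN eq *(2-4) plus times]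
    show "linear_coordinates D ?\<phi> A" by (rule lin(1))
    show "?\<phi> (?\<pi> g) = ?T g" if "g \<in> vanishing N" for g
      by (rule lin(2)) (simp_all only: that)
  qed
  define \<K> where "\<K> = range ` {f. \<forall>j. f j \<in> A \<inter> B j}"
  let ?F = "carrier D \<inter> {x. \<forall>j. x j \<in> carrier (C j) - {\<zero>\<^bsub>C j\<^esub>}}"
  have F: "?\<pi> g \<in> ?F \<longleftrightarrow> (\<forall>j. \<exists>m\<in>A \<inter> B j. E g m \<noteq> 0)" if g: "g \<in> vanishing N" for g
  proof -
    have "vanishing (N \<union> B j) +> g \<noteq> vanishing (N \<union> B j) \<longleftrightarrow> (\<exists>m\<in>B j. E g m \<noteq> 0)" for j
      using coset_eq_iff[OF g vanishing_closed(1), of "B j"] by (simp add: coset_zero zero)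
    moreover have "(\<exists>m\<in>B j. E g m \<noteq> 0) \<longleftrightarrow> (\<exists>m\<in>A \<inter> B j. E g m \<noteq> 0)" for j
      using g supp[of g] unfolding A_def vanishing_def by blast
    ultimately show ?thesis
      using g by (auto simp: carrier_D C_def quotient_space_def)
  qed
  have "?F = {x \<in> carrier D. \<exists>K\<in>\<K>. \<forall>k\<in>K. ?\<phi> x k \<noteq> 0}"
  proof -
    have "x \<in> ?F \<longleftrightarrow> (\<exists>K\<in>\<K>. \<forall>k\<in>K. ?\<phi> x k \<noteq> 0)" if "x \<in> carrier D" for x
    proof -
      obtain g where g: "g \<in> vanishing N" "x = ?\<pi> g"
        using \<open>x \<in> carrier D\<close> unfolding carrier_D by blast
      have "(\<forall>j. \<exists>m\<in>A \<inter> B j. E g m \<noteq> 0) \<longleftrightarrow> (\<exists>f. \<forall>j. f j \<in> A \<inter> B j \<and> E g (f j) \<noteq> 0)"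
        unfolding Bex_def by (rule choice_iff)
      also have "\<dots> \<longleftrightarrow> (\<exists>f. (\<forall>j. f j \<in> A \<inter> B j) \<and> (\<forall>j. ?T g (f j) \<noteq> 0))"
        by (intro ex_cong1) auto
      also have "\<dots> \<longleftrightarrow> (\<exists>K\<in>\<K>. \<forall>k\<in>K. ?T g k \<noteq> 0)"
        unfolding \<K>_def by (rule bex_ranges_iff[symmetric])
      finally have e: "(\<forall>j. \<exists>m\<in>A \<inter> B j. E g m \<noteq> 0) \<longleftrightarrow> (\<exists>K\<in>\<K>. \<forall>k\<in>K. ?T g k \<noteq> 0)" .
      show ?thesis
        unfolding g(2) \<phi>[OF g(1)] by (rule trans[OF F[OF g(1)] e])
    qed
    then show ?thesis by blast
  qed
  moreover have "finite \<K>"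
  proof -
    have "{f. \<forall>j. f j \<in> A \<inter> B j} = PiE UNIV (\<lambda>j. A \<inter> B j)" by auto
    then show ?thesis
      unfolding \<K>_def using fin by (simp add: A_def finite_PiE)
  qed
  ultimately have "euler_characteristic (projectivization D ?F) = int (card {a. {a} \<in> \<K>})"
    by (intro linear_coordinates.euler_characteristic_projectivization[OF lc]) (auto simp: \<K>_def)
  also have "{a. {a} \<in> \<K>} = ((\<Inter>j. B j) - N) \<inter> S"
  proof (intro equalityI subsetI)
    fix a assume "a \<in> {a. {a} \<in> \<K>}"
    then obtain f where f: "{a} = range f" "\<And>j. f j \<in> A \<inter> B j" by (auto simp: \<K>_def)
    have "f j = a" for j using f(1) by blast
    then show "a \<in> ((\<Inter>j. B j) - N) \<inter> S" using f(2) by (auto simp: A_def)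
  next
    fix a assume a: "a \<in> ((\<Inter>j. B j) - N) \<inter> S"
    then have "(\<lambda>_. a) \<in> {f. \<forall>j. f j \<in> A \<inter> B j}" by (auto simp: A_def)
    then have "range (\<lambda>_ :: 'r. a) \<in> \<K>" unfolding \<K>_def by (rule imageI)
    then show "a \<in> {a. {a} \<in> \<K>}" by simp
  qed
  finally show ?thesis .
qed

end

section \<open>Laurent polynomials acting on formal series\<close>

text \<open>Laurent polynomials act on arbitrary coefficient functions, for which there is no product. This
  covers both the expansion of germs and the multiplication of the series \<open>L\<close> by Laurent polynomials.\<close>

definition conv_act :: "('m::ab_group_add \<Rightarrow>\<^sub>0 'b::comm_ring_1) \<Rightarrow> ('m \<Rightarrow> 'b) \<Rightarrow> 'm \<Rightarrow> 'b"
  where "conv_act p \<phi> = (\<lambda>m. \<Sum>a\<in>Poly_Mapping.keys p. Poly_Mapping.lookup p a * \<phi> (m - a))"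

lemma conv_act_superset:
  assumes "finite B" "Poly_Mapping.keys p \<subseteq> B"
  shows "conv_act p \<phi> m = (\<Sum>a\<in>B. Poly_Mapping.lookup p a * \<phi> (m - a))"
  unfolding conv_act_def using assms by (intro sum.mono_neutral_left) (auto simp: in_keys_iff)

lemma conv_act_plus: "conv_act (p + q) \<phi> m = conv_act p \<phi> m + conv_act q \<phi> m"
proof -
  let ?B = "Poly_Mapping.keys p \<union> Poly_Mapping.keys q"
  have "Poly_Mapping.keys (p + q) \<subseteq> ?B" by (rule keys_add)
  then show ?thesis
    by (simp add: conv_act_superset[of ?B] lookup_add distrib_right sum.distrib)
qed

lemma conv_act_zero_left: "conv_act 0 \<phi> m = 0"
  by (simp add: conv_act_def)

lemma conv_act_sum:
  "conv_act (\<Sum>i\<in>I. p i) \<phi> m = (\<Sum>i\<in>I. conv_act (p i) \<phi> m)"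
  by (induction I rule: infinite_finite_induct) (simp_all add: conv_act_plus conv_act_zero_left)

lemma conv_act_single: "conv_act (Poly_Mapping.single a c) \<phi> m = c * \<phi> (m - a)"
  by (subst conv_act_superset[of "{a}"]) auto

lemma conv_act_add_right: "conv_act p (\<lambda>m. \<phi> m + \<psi> m) m = conv_act p \<phi> m + conv_act p \<psi> m"
  by (simp add: conv_act_def distrib_left sum.distrib)

lemma conv_act_diff_right: "conv_act p (\<lambda>m. \<phi> m - \<psi> m) m = conv_act p \<phi> m - conv_act p \<psi> m"
  by (simp add: conv_act_def right_diff_distrib sum_subtractf)

lemma conv_act_scale_right: "conv_act p (\<lambda>m. c * \<phi> m) m = c * conv_act p \<phi> m"
  by (simp add: conv_act_def sum_distrib_left mult.left_commute)

lemma conv_act_sum_right: "conv_act p (\<lambda>m. \<Sum>i\<in>I. \<phi> i m) m = (\<Sum>i\<in>I. conv_act p (\<phi> i) m)"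
  unfolding conv_act_def sum_distrib_left by (rule sum.swap)

lemma poly_mapping_eq_sum_singles:
  "p = (\<Sum>a\<in>Poly_Mapping.keys p. Poly_Mapping.single a (Poly_Mapping.lookup p a))"
proof (rule poly_mapping_eqI)
  fix k
  have "(\<Sum>a\<in>Poly_Mapping.keys p. Poly_Mapping.lookup p a when a = k) = Poly_Mapping.lookup p k"
    by (simp add: when_def sum.delta in_keys_iff)
  then show "Poly_Mapping.lookup p k =
      Poly_Mapping.lookup (\<Sum>a\<in>Poly_Mapping.keys p. Poly_Mapping.single a (Poly_Mapping.lookup p a)) k"
    by (simp add: lookup_sum lookup_single)
qed

lemma conv_act_single_mult: "conv_act (Poly_Mapping.single a c * q) \<phi> m = c * conv_act q \<phi> (m - a)"
proof -
  have "Poly_Mapping.single a c * q =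
      (\<Sum>b\<in>Poly_Mapping.keys q. Poly_Mapping.single (a + b) (c * Poly_Mapping.lookup q b))"
    by (subst poly_mapping_eq_sum_singles[of q]) (simp add: sum_distrib_left mult_single)
  then show ?thesis
    by (simp add: conv_act_sum conv_act_single conv_act_def[of q] sum_distrib_left algebra_simps)
qed

lemma conv_act_mult: "conv_act (p * q) \<phi> = conv_act p (conv_act q \<phi>)"
proof
  fix m
  have "p * q = (\<Sum>a\<in>Poly_Mapping.keys p. Poly_Mapping.single a (Poly_Mapping.lookup p a) * q)"
    by (subst poly_mapping_eq_sum_singles[of p]) (simp add: sum_distrib_right)
  then show "conv_act (p * q) \<phi> m = conv_act p (conv_act q \<phi>) m"
    by (simp add: conv_act_sum conv_act_single_mult conv_act_def[of p])
qed

lemma conv_act_lookup: "conv_act p (Poly_Mapping.lookup q) = Poly_Mapping.lookup (p * q)"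
proof -
  have delta: "conv_act r (\<lambda>m. if m = 0 then 1 else 0) = Poly_Mapping.lookup r" for r :: "'m::ab_group_add \<Rightarrow>\<^sub>0 'b::comm_ring_1"
    by (rule ext) (simp add: conv_act_def if_distrib cong: if_cong, simp add: sum.delta in_keys_iff)
  show ?thesis
    using conv_act_mult[of p q "\<lambda>m. if m = 0 then 1 else 0"] by (simp add: delta)
qed

section \<open>Power series expansions of germs\<close>

lemma pairing_add: "pairing (m + n) w = pairing m w + pairing n w"
  by (simp add: pairing_def distrib_right sum.distrib)

lemma pairing_diff: "pairing (m - n) w = pairing m w - pairing n w"
  by (simp add: pairing_def left_diff_distrib sum_subtractf)

lemma pairing_zero: "pairing 0 w = 0"
  by (simp add: pairing_def)

text \<open>The coefficients of \<open>f / g\<close>, computed recursively along the weight \<open>w\<close>. The guard makes the recursion terminate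
  for all \<open>g\<close>; for denominators its second part is never satisfied.\<close>

function series_quotient ::
  "int ^ 'd \<Rightarrow> (int ^ 'd \<Rightarrow>\<^sub>0 complex) \<Rightarrow> (int ^ 'd \<Rightarrow>\<^sub>0 complex) \<Rightarrow> int ^ 'd \<Rightarrow> complex"
  where "series_quotient w f g m =
    (if pairing m w < 0 \<or> (\<exists>s\<in>Poly_Mapping.keys g - {0}. pairing s w \<le> 0) then 0
     else (Poly_Mapping.lookup f m - (\<Sum>s\<in>Poly_Mapping.keys g - {0}.
       Poly_Mapping.lookup g s * series_quotient w f g (m - s))) / Poly_Mapping.lookup g 0)"
  by pat_completeness auto
termination
proof (relation "Wellfounded.measure (\<lambda>(w, f, g, m). nat (pairing m w + 1))")
  fix w :: "int ^ 'd" and f g m s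
  assume *: "\<not> (pairing m w < 0 \<or> (\<exists>s\<in>Poly_Mapping.keys g - {0}. pairing s w \<le> 0))"
    and s: "s \<in> Poly_Mapping.keys g - {0}"
  then have "pairing s w > 0" by force
  with * show "((w, f, g, m - s), w, f, g, m) \<in> Wellfounded.measure (\<lambda>(w, f, g, m). nat (pairing m w + 1))"
    by (auto simp: pairing_diff)
qed auto

declare series_quotient.simps [simp del]

text \<open>A weight in the interior of the cone makes all nonzero exponents positive, so that germs can be
  expanded by recursion on the weight.\<close>

locale positive_grading =
  fixes S :: "(int ^ 'd) set" and w :: "int ^ 'd"
  assumes submonoid: "is_submonoid S"
    and positive: "\<And>m. m \<in> S \<Longrightarrow> m \<noteq> 0 \<Longrightarrow> pairing m w > 0"
begin

lemma zero_in: "0 \<in> S" and add_in: "m \<in> S \<Longrightarrow> n \<in> S \<Longrightarrow> m + n \<in> S"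
  using submonoid by (auto simp: is_submonoid_def)

lemma pairing_nonneg: "m \<in> S \<Longrightarrow> 0 \<le> pairing m w"
  using positive[of m] by (cases "m = 0") (auto simp: pairing_zero)

lemma add_eq_0: "m \<in> S \<Longrightarrow> n \<in> S \<Longrightarrow> m + n = 0 \<Longrightarrow> m = 0 \<and> n = 0"
proof -
  assume mn: "m \<in> S" "n \<in> S" "m + n = 0"
  have "pairing m w + pairing n w = 0"
    unfolding pairing_add[symmetric] mn(3) by (rule pairing_zero)
  then have "\<not> pairing m w > 0" "\<not> pairing n w > 0"
    using pairing_nonneg[OF mn(1)] pairing_nonneg[OF mn(2)] by linarith+
  then show "m = 0 \<and> n = 0" using positive mn(1,2) by blast
qed

text \<open>A point fixed by the torus vanishes at every \<open>m \<noteq> 0\<close>, since some torus element has \<open>t m \<noteq> 1\<close>. The candidate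
  is multiplicative because \<open>S\<close> contains no pair \<open>m\<close>, \<open>-m\<close> of nonzero elements.\<close>

lemma torus_fixed_point_eq: "torus_fixed_point S = (\<lambda>m. if m = 0 then 1 else 0)"
  unfolding torus_fixed_point_def
proof (rule the_equality)
  let ?o = "\<lambda>m. if m = (0 :: int ^ 'd) then 1 else (0::complex)"
  have "?o \<in> toric_points S"
  proof -
    have "?o (m + n) = ?o m * ?o n" if "m \<in> S" "n \<in> S" for m n
    proof -
      have "m + n = 0 \<longleftrightarrow> m = 0 \<and> n = 0"
        using add_eq_0[OF that] by (metis add_0)
      then show ?thesis by simp
    qed
    then show ?thesis
      using zero_in unfolding toric_points_def by auto
  qed
  moreover have "t 0 = 1" if "t \<in> torus" for t :: "int ^ 'd \<Rightarrow> complex"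
  proof -
    have "t 0 = t 0 * t 0" "t 0 \<noteq> 0" using that unfolding torus_def by (auto dest: spec[of _ 0])
    then show ?thesis by simp
  qed
  then have "(\<lambda>m. t m * ?o m) = ?o" if "t \<in> torus" for t
    using that by (auto simp: fun_eq_iff)
  moreover have "(\<lambda>_. 1) \<in> torus" by (simp add: torus_def)
  ultimately show "?o \<in> toric_points S \<and> torus_orbit ?o = {?o}"
    unfolding torus_orbit_def by (auto simp: image_iff)
next
  fix x assume x: "x \<in> toric_points S \<and> torus_orbit x = {x}"
  have "x m = 0" if m: "m \<noteq> 0" for m
  proof -
    obtain i where i: "m $ i \<noteq> 0" using m by (auto simp: vec_eq_iff)
    define t where "t = (\<lambda>m :: int ^ 'd. exp (of_int (m $ i) :: complex))"
    have "t \<in> torus" by (simp add: torus_def t_def exp_add)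
    then have "(\<lambda>m. t m * x m) \<in> torus_orbit x" unfolding torus_orbit_def by (rule imageI)
    then have "t m * x m = x m" using x by (auto dest: fun_cong)
    moreover have "t m \<noteq> 1"
    proof
      assume "t m = 1"
      then have "norm (t m) = 1" by simp
      then show False using i by (simp add: t_def norm_exp_eq_Re)
    qed
    ultimately show ?thesis by simp
  qed
  then show "x = (\<lambda>m. if m = 0 then 1 else 0)"
    using x by (auto simp: toric_points_def fun_eq_iff)
qed

lemma denominators_iff:
  "g \<in> denominators S \<longleftrightarrow> g \<in> semigroup_algebra S \<and> Poly_Mapping.lookup g 0 \<noteq> 0"
proof -
  have "eval_at (torus_fixed_point S) g = Poly_Mapping.lookup g 0"
    unfolding eval_at_def torus_fixed_point_eq
    by (simp add: if_distrib sum.delta in_keys_iff cong: if_cong)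
  then show ?thesis by (simp add: denominators_def)
qed

definition S_series :: "(int ^ 'd \<Rightarrow> complex) \<Rightarrow> bool"
  where "S_series \<phi> \<longleftrightarrow> (\<forall>m. \<phi> m \<noteq> 0 \<longrightarrow> m \<in> S)"

lemma conv_act_denominator:
  assumes "g \<in> denominators S"
  shows "conv_act g \<phi> m = Poly_Mapping.lookup g 0 * \<phi> m
    + (\<Sum>s\<in>Poly_Mapping.keys g - {0}. Poly_Mapping.lookup g s * \<phi> (m - s))"
proof -
  have "0 \<in> Poly_Mapping.keys g" using assms by (simp add: denominators_iff in_keys_iff)
  then show ?thesis
    unfolding conv_act_def by (subst sum.remove[of _ 0]) auto
qed

lemma keys_denominator:
  assumes "g \<in> denominators S" "s \<in> Poly_Mapping.keys g - {0}"
  shows "s \<in> S" "pairing s w > 0"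
  using assms positive by (auto simp: denominators_iff semigroup_algebra_def)

text \<open>Look at the terms of least weight: those of \<open>g\<close> are its nonzero constant term.\<close>

lemma conv_act_injective:
  assumes g: "g \<in> denominators S" and \<phi>: "S_series \<phi>" and 0: "\<And>m. conv_act g \<phi> m = 0"
  shows "\<phi> m = 0"
proof (induction "nat (pairing m w)" arbitrary: m rule: less_induct)
  case less
  have "\<phi> (m - s) = 0" if s: "s \<in> Poly_Mapping.keys g - {0}" for s
  proof (rule ccontr)
    assume nz: "\<phi> (m - s) \<noteq> 0"
    then have "m - s \<in> S" using \<phi> by (auto simp: S_series_def)
    then have "pairing (m - s) w \<ge> 0" by (rule pairing_nonneg)
    then have "nat (pairing (m - s) w) < nat (pairing m w)"
      using keys_denominator(2)[OF g s] by (simp add: pairing_diff)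
    from less[OF this] nz show False by simp
  qed
  then show ?case
    using 0[of m] g unfolding conv_act_denominator[OF g] by (simp add: denominators_iff)
qed

lemma series_quotient:
  assumes f: "f \<in> semigroup_algebra S" and g: "g \<in> denominators S"
  shows "S_series (series_quotient w f g)" "conv_act g (series_quotient w f g) = Poly_Mapping.lookup f"
proof -
  let ?\<phi> = "series_quotient w f g"
  have pos: "\<not> (\<exists>s\<in>Poly_Mapping.keys g - {0}. pairing s w \<le> 0)"
    using keys_denominator(2)[OF g] by (force simp: not_le)
  have rec: "?\<phi> m = (Poly_Mapping.lookup f m - (\<Sum>s\<in>Poly_Mapping.keys g - {0}.
       Poly_Mapping.lookup g s * ?\<phi> (m - s))) / Poly_Mapping.lookup g 0" for m
  proof (cases "pairing m w < 0")
    case True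
    then have neg: "?\<phi> m = 0" by (simp add: series_quotient.simps)
    have "?\<phi> (m - s) = 0" if "s \<in> Poly_Mapping.keys g - {0}" for s
      using True keys_denominator(2)[OF g that] by (subst series_quotient.simps) (simp add: pairing_diff)
    moreover have "Poly_Mapping.lookup f m = 0"
      using True f pairing_nonneg[of m] by (auto simp: semigroup_algebra_def in_keys_iff)
    ultimately show ?thesis using neg by simp
  next
    case False
    then show ?thesis using pos by (subst series_quotient.simps) simp
  qed
  have "?\<phi> m \<noteq> 0 \<Longrightarrow> m \<in> S" for m
  proof (induction "nat (pairing m w + 1)" arbitrary: m rule: less_induct)
    case less
    then have "pairing m w \<ge> 0" by (subst (asm) (2) series_quotient.simps) (auto split: if_splits)
    show ?case
    proof (rule ccontr)
      assume m: "m \<notin> S"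
      then have "Poly_Mapping.lookup f m = 0"
        using f by (auto simp: semigroup_algebra_def in_keys_iff)
      moreover have "?\<phi> (m - s) = 0" if s: "s \<in> Poly_Mapping.keys g - {0}" for s
      proof (rule ccontr)
        assume "?\<phi> (m - s) \<noteq> 0"
        moreover have "nat (pairing (m - s) w + 1) < nat (pairing m w + 1)"
          using keys_denominator(2)[OF g s] \<open>pairing m w \<ge> 0\<close> by (simp add: pairing_diff)
        ultimately have "m - s \<in> S" using less.hyps by blast
        from add_in[OF this keys_denominator(1)[OF g s]] m show False by simp
      qed
      ultimately have "?\<phi> m = 0" by (subst rec) simp
      with less.prems show False by simp
    qed
  qed
  then show "S_series ?\<phi>" by (simp add: S_series_def)
  show "conv_act g ?\<phi> = Poly_Mapping.lookup f"
  proof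
    fix m
    have "Poly_Mapping.lookup g 0 * ?\<phi> m = Poly_Mapping.lookup f m
        - (\<Sum>s\<in>Poly_Mapping.keys g - {0}. Poly_Mapping.lookup g s * ?\<phi> (m - s))"
      using g by (subst rec) (simp add: denominators_iff)
    then show "conv_act g ?\<phi> m = Poly_Mapping.lookup f m"
      unfolding conv_act_denominator[OF g] by simp
  qed
qed

lemma series_quotient_unique:
  assumes "f \<in> semigroup_algebra S" "g \<in> denominators S"
    and "S_series \<phi>" "\<And>m. conv_act g \<phi> m = Poly_Mapping.lookup f m"
  shows "series_quotient w f g = \<phi>"
proof
  fix m
  have "S_series (\<lambda>m. series_quotient w f g m - \<phi> m)"
    using assms(3) series_quotient(1)[OF assms(1,2)] by (auto simp: S_series_def) metis
  then have "series_quotient w f g m - \<phi> m = 0"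
    by (rule conv_act_injective[OF assms(2)])
      (simp add: conv_act_diff_right series_quotient(2)[OF assms(1,2)] assms(4))
  then show "series_quotient w f g m = \<phi> m" by simp
qed

lemma semigroup_algebra_closed:
  assumes "f \<in> semigroup_algebra S" "g \<in> semigroup_algebra S"
  shows "f + g \<in> semigroup_algebra S" "f * g \<in> semigroup_algebra S"
proof -
  show "f + g \<in> semigroup_algebra S"
    using assms keys_add[of f g] by (auto simp: semigroup_algebra_def)
  show "f * g \<in> semigroup_algebra S"
    using assms keys_mult[of f g] add_in by (fastforce simp: semigroup_algebra_def)
qed

lemma semigroup_algebra_constants:
  "Poly_Mapping.single 0 c \<in> semigroup_algebra S" "0 \<in> semigroup_algebra S"
  using zero_in by (auto simp: semigroup_algebra_def)

lemma denominators_closed: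
  assumes "f \<in> denominators S" "g \<in> denominators S"
  shows "f * g \<in> denominators S"
proof -
  have fg: "f \<in> semigroup_algebra S" "g \<in> semigroup_algebra S" using assms by (auto simp: denominators_iff)
  have "Poly_Mapping.lookup g (0 - s) = 0" if s: "s \<in> Poly_Mapping.keys f - {0}" for s
  proof (rule ccontr)
    assume "\<not> ?thesis"
    then have "- s \<in> S" using fg(2) by (auto simp: semigroup_algebra_def in_keys_iff)
    then show False using add_eq_0[of s "- s"] keys_denominator(1)[OF assms(1) s] s by auto
  qed
  then have "Poly_Mapping.lookup (f * g) 0 = Poly_Mapping.lookup f 0 * Poly_Mapping.lookup g 0"
    unfolding conv_act_lookup[symmetric] conv_act_denominator[OF assms(1)] by simp
  then show ?thesis
    using assms semigroup_algebra_closed(2)[OF fg] by (simp add: denominators_iff)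
qed

lemma one_denominator: "1 \<in> denominators S"
  using zero_in by (simp add: denominators_iff semigroup_algebra_def lookup_one)

abbreviation numerators_denominators where
  "numerators_denominators \<equiv> semigroup_algebra S \<times> denominators S"

text \<open>Two fractions are equal in the localization iff they have the same expansion. So the local ring
  is a space of power series, and the choice of representatives in its operations is harmless.\<close>

lemma frac_rel_iff:
  "((f, g), (f', g')) \<in> frac_rel S \<longleftrightarrow> (f, g) \<in> numerators_denominators \<and> (f', g') \<in> numerators_denominators
    \<and> series_quotient w f g = series_quotient w f' g'"
proof (cases "(f, g) \<in> numerators_denominators \<and> (f', g') \<in> numerators_denominators")
  case True
  then have f: "f \<in> semigroup_algebra S" "g \<in> denominators S"
    and f': "f' \<in> semigroup_algebra S" "g' \<in> denominators S" by auto
  let ?\<phi> = "series_quotient w f g" and ?\<psi> = "series_quotient w f' g'"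
  \<comment> \<open>The common denominator turns the difference of the expansions into the numerator of the difference of the fractions.\<close>
  have *: "Poly_Mapping.lookup (f * g' - f' * g) m = conv_act (g * g') (\<lambda>m. ?\<phi> m - ?\<psi> m) m" for m
  proof -
    have "conv_act (g * g') ?\<phi> = Poly_Mapping.lookup (f * g')"
      using conv_act_mult[of g' g ?\<phi>] by (simp add: series_quotient(2)[OF f] conv_act_lookup mult.commute)
    moreover have "conv_act (g * g') ?\<psi> = Poly_Mapping.lookup (f' * g)"
      using conv_act_mult[of g g' ?\<psi>] by (simp add: series_quotient(2)[OF f'] conv_act_lookup mult.commute)
    ultimately show ?thesis by (simp add: conv_act_diff_right lookup_minus)
  qed
  have ss: "S_series (\<lambda>m. ?\<phi> m - ?\<psi> m)"
    using series_quotient(1)[OF f] series_quotient(1)[OF f'] by (auto simp: S_series_def) metis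
  have "(\<exists>h\<in>denominators S. h * (f * g' - f' * g) = 0) \<longleftrightarrow> ?\<phi> = ?\<psi>"
  proof
    assume "\<exists>h\<in>denominators S. h * (f * g' - f' * g) = 0"
    then obtain h where h: "h \<in> denominators S" "h * (f * g' - f' * g) = 0" by blast
    have "conv_act (h * (g * g')) (\<lambda>m. ?\<phi> m - ?\<psi> m) m = 0" for m
    proof -
      have "conv_act (h * (g * g')) (\<lambda>m. ?\<phi> m - ?\<psi> m) = conv_act h (Poly_Mapping.lookup (f * g' - f' * g))"
        unfolding conv_act_mult[of h] *[symmetric] by simp
      then show ?thesis by (simp add: conv_act_lookup h(2))
    qed
    then have "?\<phi> m - ?\<psi> m = 0" for m
      by (rule conv_act_injective[OF denominators_closed[OF h(1) denominators_closed[OF f(2) f'(2)]] ss])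
    then show "?\<phi> = ?\<psi>" by auto
  next
    assume "?\<phi> = ?\<psi>"
    then have "f * g' - f' * g = 0"
      by (intro poly_mapping_eqI) (simp only: *, simp add: conv_act_def)
    then show "\<exists>h\<in>denominators S. h * (f * g' - f' * g) = 0"
      using one_denominator by (intro bexI[of _ 1]) simp_all
  qed
  with True show ?thesis by (auto simp: frac_rel_def)
qed (auto simp: frac_rel_def)

definition expansion :: "'d germ \<Rightarrow> int ^ 'd \<Rightarrow> complex"
  where "expansion x = series_quotient w (numer x) (denom x)"

lemma carrier_local_ring: "carrier (local_ring S) =
    {fraction S f g | f g. f \<in> semigroup_algebra S \<and> g \<in> denominators S}"
  by (auto simp: local_ring_def quotient_def fraction_def)

lemma numer_denom:
  assumes "f \<in> semigroup_algebra S" "g \<in> denominators S"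
  shows "numer (fraction S f g) \<in> semigroup_algebra S" "denom (fraction S f g) \<in> denominators S"
    "expansion (fraction S f g) = series_quotient w f g"
proof -
  have "(f, g) \<in> fraction S f g"
    using assms by (simp add: fraction_def frac_rel_iff)
  then have "(SOME p. p \<in> fraction S f g) \<in> fraction S f g" by (rule someI)
  then have "(numer (fraction S f g), denom (fraction S f g)) \<in> fraction S f g"
    by (simp add: numer_def denom_def)
  then show "numer (fraction S f g) \<in> semigroup_algebra S" "denom (fraction S f g) \<in> denominators S"
    "expansion (fraction S f g) = series_quotient w f g"
    by (auto simp: fraction_def frac_rel_iff expansion_def)
qed

lemma germ_cases:
  assumes "x \<in> carrier (local_ring S)"
  shows "numer x \<in> semigroup_algebra S" "denom x \<in> denominators S"
    "S_series (expansion x)" "conv_act (denom x) (expansion x) = Poly_Mapping.lookup (numer x)"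
  using assms series_quotient[of "numer x" "denom x"] unfolding carrier_local_ring expansion_def
  by (auto simp: numer_denom)

lemma expansion_eqI:
  assumes "f \<in> semigroup_algebra S" "g \<in> denominators S"
    and "S_series \<phi>" "\<And>m. conv_act g \<phi> m = Poly_Mapping.lookup f m"
  shows "fraction S f g \<in> carrier (local_ring S)" "expansion (fraction S f g) = \<phi>"
  using assms series_quotient_unique[OF assms] by (auto simp: carrier_local_ring numer_denom)

lemma fraction_eqI:
  assumes "f \<in> semigroup_algebra S" "g \<in> denominators S" "f' \<in> semigroup_algebra S" "g' \<in> denominators S"
    and "series_quotient w f g = series_quotient w f' g'"
  shows "fraction S f g = fraction S f' g'"
  using assms unfolding fraction_def by (auto simp: frac_rel_iff)

lemma series_space_local_ring: "series_space (local_ring S) expansion S"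
proof
  show "inj_on expansion (carrier (local_ring S))"
  proof (rule inj_onI)
    fix x y assume xy: "x \<in> carrier (local_ring S)" "y \<in> carrier (local_ring S)" "expansion x = expansion y"
    then obtain f g f' g' where x: "x = fraction S f g" "f \<in> semigroup_algebra S" "g \<in> denominators S"
      and y: "y = fraction S f' g'" "f' \<in> semigroup_algebra S" "g' \<in> denominators S"
      unfolding carrier_local_ring by blast
    have "series_quotient w f g = series_quotient w f' g'"
      using xy(3) unfolding x(1) y(1) numer_denom(3)[OF x(2,3)] numer_denom(3)[OF y(2,3)] .
    then show "x = y"
      unfolding x(1) y(1) by (rule fraction_eqI[OF x(2,3) y(2,3)])
  qed
  show "expansion x m = 0" if "x \<in> carrier (local_ring S)" "m \<notin> S" for x m
    using germ_cases(3)[OF that(1)] that(2) by (auto simp: S_series_def)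
  have "S_series (\<lambda>_. 0)" by (simp add: S_series_def)
  from expansion_eqI[OF semigroup_algebra_constants(2) one_denominator this]
  have "fraction S 0 1 \<in> carrier (local_ring S)" "expansion (fraction S 0 1) = (\<lambda>_. 0)"
    by (simp_all add: conv_act_def)
  then show "\<zero>\<^bsub>local_ring S\<^esub> \<in> carrier (local_ring S)" "expansion \<zero>\<^bsub>local_ring S\<^esub> m = 0" for m
    by (auto simp: local_ring_def)
  have plus: "x \<oplus>\<^bsub>local_ring S\<^esub> y \<in> carrier (local_ring S) \<and>
      expansion (x \<oplus>\<^bsub>local_ring S\<^esub> y) = (\<lambda>m. expansion x m + expansion y m)"
    if x: "x \<in> carrier (local_ring S)" and y: "y \<in> carrier (local_ring S)" for x y
  proof -
    note X = germ_cases[OF x] and Y = germ_cases[OF y]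
    have XY: "denom x \<in> semigroup_algebra S" "denom y \<in> semigroup_algebra S"
      using X Y by (auto simp: denominators_iff)
    let ?f = "numer x * denom y + numer y * denom x" and ?g = "denom x * denom y"
    have "S_series (\<lambda>m. expansion x m + expansion y m)"
      unfolding S_series_def
    proof (intro allI impI)
      fix m assume "expansion x m + expansion y m \<noteq> 0"
      then have "expansion x m \<noteq> 0 \<or> expansion y m \<noteq> 0" by auto
      then show "m \<in> S" using X(3) Y(3) unfolding S_series_def by blast
    qed
    moreover have "conv_act ?g (\<lambda>m. expansion x m + expansion y m) m = Poly_Mapping.lookup ?f m" for m
    proof -
      have "conv_act (denom y * denom x) (expansion x) = Poly_Mapping.lookup (denom y * numer x)"
        unfolding conv_act_mult X(4) conv_act_lookup ..
      moreover have "conv_act (denom x * denom y) (expansion y) = Poly_Mapping.lookup (denom x * numer y)"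
        unfolding conv_act_mult Y(4) conv_act_lookup ..
      ultimately show ?thesis
        by (simp add: conv_act_add_right lookup_add mult.commute)
    qed
    moreover have "?f \<in> semigroup_algebra S" "?g \<in> denominators S"
      using X Y XY by (auto intro!: semigroup_algebra_closed denominators_closed)
    ultimately show ?thesis
      using expansion_eqI[of ?f ?g] by (simp add: local_ring_def)
  qed
  show "x \<oplus>\<^bsub>local_ring S\<^esub> y \<in> carrier (local_ring S)"
    "expansion (x \<oplus>\<^bsub>local_ring S\<^esub> y) m = expansion x m + expansion y m"
    if "x \<in> carrier (local_ring S)" "y \<in> carrier (local_ring S)" for x y m
    using plus[OF that] by auto
  have times: "c \<odot>\<^bsub>local_ring S\<^esub> x \<in> carrier (local_ring S) \<and>
      expansion (c \<odot>\<^bsub>local_ring S\<^esub> x) = (\<lambda>m. c * expansion x m)"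
    if x: "x \<in> carrier (local_ring S)" for c x
  proof -
    note X = germ_cases[OF x]
    let ?f = "Poly_Mapping.single 0 c * numer x"
    have "S_series (\<lambda>m. c * expansion x m)" using X(3) by (auto simp: S_series_def)
    moreover have "conv_act (denom x) (\<lambda>m. c * expansion x m) m = Poly_Mapping.lookup ?f m" for m
      unfolding conv_act_scale_right X(4) conv_act_lookup[symmetric] conv_act_single by simp
    moreover have "?f \<in> semigroup_algebra S"
      using X semigroup_algebra_closed(2) semigroup_algebra_constants(1) by blast
    ultimately show ?thesis
      using expansion_eqI[of ?f "denom x"] X(2) by (simp add: local_ring_def)
  qed
  show "c \<odot>\<^bsub>local_ring S\<^esub> x \<in> carrier (local_ring S)"
    "expansion (c \<odot>\<^bsub>local_ring S\<^esub> x) m = c * expansion x m"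
    if "x \<in> carrier (local_ring S)" for c x m
    using times[OF that] by auto
  show "\<exists>x\<in>carrier (local_ring S). expansion x = h"
    if A: "finite A" "A \<subseteq> S" "\<And>m. m \<notin> A \<Longrightarrow> h m = 0" for A h
  proof -
    define f where "f = Abs_poly_mapping h"
    have "finite {m. h m \<noteq> 0}" by (rule finite_subset[OF _ A(1)]) (use A(3) in blast)
    then have f: "Poly_Mapping.lookup f = h" by (simp add: f_def)
    have h: "S_series h" using A by (auto simp: S_series_def)
    have "f \<in> semigroup_algebra S"
      using h by (auto simp: semigroup_algebra_def in_keys_iff f S_series_def)
    then show ?thesis
      using expansion_eqI[of f 1 h] one_denominator h conv_act_lookup[of 1 f] by (auto simp: f)
  qed
qed

end

section \<open>The filtration by monomial valuations\<close>

context positive_grading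
begin

lemma monomial_valuation_denominator:
  assumes "g \<in> denominators S"
  shows "monomial_valuation w g = 0"
proof (rule antisym)
  have "0 \<in> Poly_Mapping.keys g" using assms by (simp add: denominators_iff in_keys_iff)
  then show "monomial_valuation w g \<le> 0"
    unfolding monomial_valuation_def by (rule INF_lower2) (simp add: pairing_zero)
  show "0 \<le> monomial_valuation w g"
    unfolding monomial_valuation_def using assms pairing_nonneg
    by (intro INF_greatest) (auto simp: denominators_iff semigroup_algebra_def)
qed

text \<open>The valuation of \<open>f\<close> can be read off from the expansion \<open>\<phi>\<close> of \<open>f / g\<close>: passing between \<open>f\<close> and \<open>\<phi>\<close>,
  in either direction, only adds exponents of \<open>g\<close>, which have nonnegative weight.\<close>

lemma quotient_support_bound:
  assumes g: "g \<in> denominators S" and \<phi>: "S_series \<phi>"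
    and eq: "conv_act g \<phi> = Poly_Mapping.lookup f"
  shows "(\<forall>m\<in>Poly_Mapping.keys f. c \<le> pairing m w) \<longleftrightarrow> (\<forall>m. \<phi> m \<noteq> 0 \<longrightarrow> c \<le> pairing m w)"
proof
  assume f: "\<forall>m\<in>Poly_Mapping.keys f. c \<le> pairing m w"
  have "\<phi> m \<noteq> 0 \<Longrightarrow> c \<le> pairing m w" for m
  proof (induction "nat (pairing m w)" arbitrary: m rule: less_induct)
    case less
    show ?case
    proof (cases "m \<in> Poly_Mapping.keys f")
      case False
      then have "Poly_Mapping.lookup g 0 * \<phi> m
          + (\<Sum>s\<in>Poly_Mapping.keys g - {0}. Poly_Mapping.lookup g s * \<phi> (m - s)) = 0"
        using fun_cong[OF eq, of m] unfolding conv_act_denominator[OF g] by (simp add: in_keys_iff)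
      moreover have "Poly_Mapping.lookup g 0 * \<phi> m \<noteq> 0"
        using less.prems g by (simp add: denominators_iff)
      ultimately have "(\<Sum>s\<in>Poly_Mapping.keys g - {0}. Poly_Mapping.lookup g s * \<phi> (m - s)) \<noteq> 0"
        by auto
      then obtain s where "s \<in> Poly_Mapping.keys g - {0}" "Poly_Mapping.lookup g s * \<phi> (m - s) \<noteq> 0"
        by (rule sum.not_neutral_contains_not_neutral)
      then have s: "s \<in> Poly_Mapping.keys g - {0}" "\<phi> (m - s) \<noteq> 0" by auto
      have "m - s \<in> S" using \<phi> s(2) by (auto simp: S_series_def)
      then have "0 \<le> pairing (m - s) w" by (rule pairing_nonneg)
      moreover have "pairing (m - s) w < pairing m w"
        using keys_denominator(2)[OF g s(1)] by (simp add: pairing_diff)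
      ultimately have "c \<le> pairing (m - s) w"
        using less.hyps[of "m - s"] s(2) by simp
      then show ?thesis using \<open>pairing (m - s) w < pairing m w\<close> by simp
    qed (use f in auto)
  qed
  then show "\<forall>m. \<phi> m \<noteq> 0 \<longrightarrow> c \<le> pairing m w" by blast
next
  assume \<phi>c: "\<forall>m. \<phi> m \<noteq> 0 \<longrightarrow> c \<le> pairing m w"
  show "\<forall>m\<in>Poly_Mapping.keys f. c \<le> pairing m w"
  proof (rule ccontr)
    assume "\<not> ?thesis"
    then obtain m where m: "m \<in> Poly_Mapping.keys f" "pairing m w < c" by force
    have "\<phi> m = 0" using \<phi>c m(2) by force
    moreover have "\<phi> (m - s) = 0" if s: "s \<in> Poly_Mapping.keys g - {0}" for s
      using \<phi>c keys_denominator(2)[OF g s] m(2) pairing_diff[of m s w] by force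
    ultimately have "conv_act g \<phi> m = 0"
      unfolding conv_act_denominator[OF g] by simp
    then show False using m(1) eq by (simp add: in_keys_iff)
  qed
qed

end

text \<open>The facts about the valuations on which the result depends: every \<open>\<nu> i\<close> is positive on the nonzero
  exponents, and only finitely many exponents have bounded value.\<close>

locale toric_filtration =
  fixes S :: "(int ^ 'd) set" and \<nu> :: "'r::finite \<Rightarrow> int ^ 'd"
  assumes grading: "\<And>i. positive_grading S (\<nu> i)"
    and finite_levels: "\<And>i c. finite {m \<in> S. pairing m (\<nu> i) \<le> c}"
begin

text \<open>Any of the weights serves to compute the expansions.\<close>

sublocale positive_grading S "\<nu> undefined" by (rule grading)

sublocale series: series_space "local_ring S" expansion S by (rule series_space_local_ring)

definition below :: "int ^ 'r \<Rightarrow> (int ^ 'd) set"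
  where "below v = {m. \<exists>i. pairing m (\<nu> i) < v $ i}"

definition level :: "int ^ 'r \<Rightarrow> 'r \<Rightarrow> (int ^ 'd) set"
  where "level v j = {m. pairing m (\<nu> j) = v $ j}"

lemma below_succ: "below (v + 1) = below v \<union> (\<Union>j. level v j)"
proof -
  have "m \<in> below (v + 1) \<longleftrightarrow> (\<exists>i. pairing m (\<nu> i) < v $ i \<or> pairing m (\<nu> i) = v $ i)" for m
    by (simp add: below_def le_less[symmetric])
  then show ?thesis by (auto simp: below_def level_def)
qed

lemma below_axis: "below (v + axis j 1) = below v \<union> level v j"
proof (intro equalityI subsetI)
  fix m assume "m \<in> below (v + axis j 1)"
  then obtain i where "pairing m (\<nu> i) < v $ i + axis j 1 $ i" by (auto simp: below_def)
  then have "pairing m (\<nu> i) < v $ i \<or> pairing m (\<nu> j) = v $ j"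
    by (cases "i = j") (auto simp: axis_def)
  then show "m \<in> below v \<union> level v j"
    by (auto simp: below_def level_def)
next
  fix m assume "m \<in> below v \<union> level v j"
  then show "m \<in> below (v + axis j 1)"
  proof
    assume "m \<in> below v"
    then obtain i where "pairing m (\<nu> i) < v $ i" by (auto simp: below_def)
    then have "pairing m (\<nu> i) < (v + axis j 1) $ i" by (auto simp: axis_def)
    then show ?thesis unfolding below_def by blast
  next
    assume "m \<in> level v j"
    then have "pairing m (\<nu> j) < (v + axis j 1) $ j" by (auto simp: axis_def level_def)
    then show ?thesis unfolding below_def by blast
  qed
qed

lemma filtration_eq_vanishing: "filtration S \<nu> v = series.vanishing (below v)"
proof -
  have "(ereal (real_of_int (v $ i)) \<le> germ_valuation (\<nu> i) x) \<longleftrightarrow>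
      (\<forall>m. expansion x m \<noteq> 0 \<longrightarrow> v $ i \<le> pairing m (\<nu> i))" if x: "x \<in> carrier (local_ring S)" for x i
  proof -
    note X = germ_cases[OF x]
    interpret i: positive_grading S "\<nu> i" by (rule grading)
    have "ereal (real_of_int (v $ i)) \<le> germ_valuation (\<nu> i) x \<longleftrightarrow>
        (\<forall>m\<in>Poly_Mapping.keys (numer x). v $ i \<le> pairing m (\<nu> i))"
      unfolding germ_valuation_def i.monomial_valuation_denominator[OF X(2)]
      by (simp add: monomial_valuation_def le_INF_iff)
    then show ?thesis
      using i.quotient_support_bound[OF X(2-4)] by simp
  qed
  then show ?thesis
    unfolding filtration_def series.vanishing_def below_def by (auto simp: not_le[symmetric])
qed

lemma finite_levels_inter: "finite (((\<Union>j. level v j) - below v) \<inter> S)"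
proof (rule finite_subset)
  show "((\<Union>j. level v j) - below v) \<inter> S \<subseteq> (\<Union>j. {m \<in> S. pairing m (\<nu> j) \<le> v $ j})"
    by (auto simp: level_def)
qed (simp add: finite_levels)

lemma dim_series_eq: "dim_series S \<nu> v = int (card (((\<Union>j. level v j) - below v) \<inter> S))"
  unfolding dim_series_def filtration_eq_vanishing below_succ
  using series.dim_quotient[OF finite_levels_inter refl] by simp

text \<open>The coordinate points of the arrangement complement are the monomials all of whose valuations are
  exactly \<open>v\<close>.\<close>

lemma euler_characteristic_PF_fiber:
  "euler_characteristic (PF_fiber S \<nu> v) = int (card {m \<in> S. \<forall>j. pairing m (\<nu> j) = v $ j})"
proof -
  have "((\<Inter>j. level v j) - below v) \<inter> S = {m \<in> S. \<forall>j. pairing m (\<nu> j) = v $ j}"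
    by (auto simp: level_def below_def)
  then show ?thesis
    using series.euler_characteristic_fiber[where N = "below v" and B = "level v", OF finite_levels_inter]
    unfolding PF_fiber_def F_fiber_def D_space_def D_comp_def filtration_eq_vanishing below_axis
    by simp
qed

end

section \<open>The Poincare series\<close>

lemma laurent_mult_eq_conv_act: "laurent_mult = conv_act"
  by (intro ext) (simp add: laurent_mult_def conv_act_def)

lemma conv_act_one: "conv_act 1 \<phi> = \<phi>"
  using conv_act_single[of 0 1 \<phi>] by (simp add: fun_eq_iff)

lemma conv_act_tvar_minus_1: "conv_act (tvar i - 1) \<psi> u = \<psi> (u - axis i 1) - \<psi> u"
proof -
  have "conv_act (tvar i - 1) \<psi> u + conv_act 1 \<psi> u = conv_act (tvar i) \<psi> u"
    unfolding conv_act_plus[symmetric] by simp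
  then show ?thesis
    using conv_act_single[of "axis i 1" 1 \<psi> u] by (simp add: tvar_def conv_act_one)
qed

lemma conv_act_prod_tvar_minus_1:
  fixes \<psi> :: "int ^ 'r::finite \<Rightarrow> int"
  shows "conv_act ((\<Prod>i\<in>UNIV. tvar i) - 1) \<psi> u = \<psi> (u - 1) - \<psi> u"
proof -
  have "(\<Prod>i\<in>J. tvar i) = Poly_Mapping.single (\<Sum>i\<in>J. axis i 1) 1" if "finite J" for J :: "'r set"
    using that by (induction J rule: finite_induct) (simp_all add: tvar_def mult_single)
  moreover have "(\<Sum>i\<in>UNIV. axis i 1) = (1 :: int ^ 'r)"
    by (simp add: vec_eq_iff axis_def)
  ultimately have t: "(\<Prod>i\<in>UNIV. tvar i) = Poly_Mapping.single (1 :: int ^ 'r) 1" by simp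
  have "conv_act ((\<Prod>i\<in>UNIV. tvar i) - 1) \<psi> u + conv_act 1 \<psi> u = conv_act (\<Prod>i\<in>UNIV. tvar i) \<psi> u"
    unfolding conv_act_plus[symmetric] by simp
  then show ?thesis
    using conv_act_single[of 1 1 \<psi> u] by (simp add: t conv_act_one)
qed

text \<open>The factor \<open>t\<^sub>i - 1\<close> is a difference operator: it turns the condition \<open>u\<^sub>i \<le> w\<^sub>i\<close> into
  \<open>u\<^sub>i = w\<^sub>i + 1\<close>. All factors together turn the indicator of an orthant into that of one point.\<close>

lemma conv_act_orthant:
  fixes w :: "int ^ 'r::finite"
  shows "conv_act (\<Prod>i\<in>J. (tvar i - 1)) (\<lambda>u. of_bool (\<forall>i. u $ i \<le> w $ i)) =
    (\<lambda>u. of_bool (\<forall>i. if i \<in> J then u $ i = w $ i + 1 else u $ i \<le> w $ i))"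
  using finite[of J]
proof (induction J rule: finite_induct)
  case empty
  show ?case
    by (simp add: conv_act_one)
next
  case (insert j J)
  let ?\<psi> = "\<lambda>u :: int ^ 'r. of_bool (\<forall>i. if i \<in> J then u $ i = w $ i + 1 else u $ i \<le> w $ i) :: int"
  show ?case
  proof
    fix u :: "int ^ 'r"
    let ?R = "\<forall>i. i \<noteq> j \<longrightarrow> (if i \<in> J then u $ i = w $ i + 1 else u $ i \<le> w $ i)"
    have A: "(\<forall>i. if i \<in> J then (u - axis j 1) $ i = w $ i + 1 else (u - axis j 1) $ i \<le> w $ i) \<longleftrightarrow>
        ?R \<and> u $ j \<le> w $ j + 1"
      using insert.hyps(2) by (auto simp: axis_def)
    have B: "(\<forall>i. if i \<in> J then u $ i = w $ i + 1 else u $ i \<le> w $ i) \<longleftrightarrow> ?R \<and> u $ j \<le> w $ j"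
      using insert.hyps(2) by auto
    have C: "(\<forall>i. if i \<in> insert j J then u $ i = w $ i + 1 else u $ i \<le> w $ i) \<longleftrightarrow> ?R \<and> u $ j = w $ j + 1"
      by auto
    have "conv_act (\<Prod>i\<in>insert j J. (tvar i - 1)) (\<lambda>u. of_bool (\<forall>i. u $ i \<le> w $ i)) u = ?\<psi> (u - axis j 1) - ?\<psi> u"
      unfolding prod.insert[OF insert.hyps] conv_act_mult insert.IH conv_act_tvar_minus_1 ..
    also have "\<dots> = of_bool (\<forall>i. if i \<in> insert j J then u $ i = w $ i + 1 else u $ i \<le> w $ i)"
      unfolding A B C by auto
    finally show "conv_act (\<Prod>i\<in>insert j J. (tvar i - 1)) (\<lambda>u. of_bool (\<forall>i. u $ i \<le> w $ i)) u =
        of_bool (\<forall>i. if i \<in> insert j J then u $ i = w $ i + 1 else u $ i \<le> w $ i)" .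
  qed
qed

lemma keys_prod_tvar_minus_1_nonneg:
  assumes "a \<in> Poly_Mapping.keys (\<Prod>i\<in>J. (tvar i - 1))"
  shows "0 \<le> a $ k"
  using finite[of J] assms
proof (induction J arbitrary: a rule: finite_induct)
  case empty
  then show ?case by simp
next
  case (insert j J)
  obtain b c where bc: "a = b + c" "b \<in> Poly_Mapping.keys (tvar j - 1)" "c \<in> Poly_Mapping.keys (\<Prod>i\<in>J. (tvar i - 1))"
    using insert keys_mult[of "tvar j - 1" "\<Prod>i\<in>J. (tvar i - 1)"] by auto
  have "b = axis j 1 \<or> b = 0"
    using bc(2) keys_diff[of "tvar j" 1] by (auto simp: tvar_def)
  then show ?case using insert.IH[OF bc(3)] bc(1) by (auto simp: axis_def)
qed

context toric_filtration
begin

definition monomial_count :: "int ^ 'r \<Rightarrow> int"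
  where "monomial_count v = int (card {m \<in> S. \<forall>j. pairing m (\<nu> j) = v $ j})"

text \<open>The monomial \<open>m\<close> contributes to \<open>d(u)\<close> iff \<open>u \<le> \<nu>(m)\<close> but not \<open>u + 1 \<le> \<nu>(m)\<close>. So it contributes
  the difference of the indicators of two orthants to \<open>L\<close>, and \<open>t\<close> to the power \<open>\<nu>(m) + 1\<close> minus \<open>t\<close> to the
  power \<open>\<nu>(m)\<close> to the product. Infinitely many monomials may contribute to \<open>L\<close>, but the coefficient at \<open>v\<close>
  of the product only involves \<open>d(u)\<close> with \<open>u \<le> v\<close>, to which only the finitely many monomials
  in \<open>T\<close> contribute.\<close>

lemma laurent_mult_dim_series:
  "laurent_mult (\<Prod>i\<in>UNIV. (tvar i - 1)) (dim_series S \<nu>) v = monomial_count (v - 1) - monomial_count v"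
proof -
  let ?p = "\<Prod>i\<in>UNIV. (tvar i - 1) :: int ^ 'r \<Rightarrow>\<^sub>0 int"
  define val where "val = (\<lambda>m. \<chi> j. pairing m (\<nu> j))"
  \<comment> \<open>These monomials include all that contribute to \<open>d(u)\<close> for some \<open>u \<le> v\<close>.\<close>
  define T where "T = {m \<in> S. \<exists>i. pairing m (\<nu> i) \<le> v $ i}"
  have "T = (\<Union>i. {m \<in> S. pairing m (\<nu> i) \<le> v $ i})" by (auto simp: T_def)
  then have finT: "finite T" using finite_levels by simp
  define orthant where "orthant = (\<lambda>w u :: int ^ 'r. of_bool (\<forall>i. u $ i \<le> w $ i) :: int)"
  have conv: "conv_act ?p (orthant w) u = of_bool (u = w + 1)" for w u
    unfolding orthant_def conv_act_orthant by (simp add: vec_eq_iff)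
  have card_T: "int (card {m \<in> T. Q m}) = (\<Sum>m\<in>T. of_bool (Q m))" for Q
  proof -
    have "(\<Sum>m\<in>T. of_bool (Q m) :: int) = (\<Sum>m\<in>{m \<in> T. Q m}. 1)"
      using finT by (intro sum.mono_neutral_cong_right) auto
    then show ?thesis by simp
  qed
  have d: "dim_series S \<nu> u = (\<Sum>m\<in>T. orthant (val m) u - orthant (val m - 1) u)" if u: "\<And>i. u $ i \<le> v $ i" for u
  proof -
    have "((\<Union>j. level u j) - below u) \<inter> S = {m \<in> T. (\<forall>i. u $ i \<le> val m $ i) \<and> \<not> (\<forall>i. u $ i \<le> (val m - 1) $ i)}"
    proof (intro equalityI subsetI)
      fix m assume "m \<in> ((\<Union>j. level u j) - below u) \<inter> S"
      then obtain j where j: "pairing m (\<nu> j) = u $ j" and le: "\<And>i. u $ i \<le> pairing m (\<nu> i)" and m: "m \<in> S"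
        by (auto simp: level_def below_def not_less)
      have "pairing m (\<nu> j) \<le> v $ j" using j u[of j] by simp
      then have "m \<in> T" using m by (auto simp: T_def)
      moreover have "\<not> u $ j \<le> (val m - 1) $ j" using j by (simp add: val_def)
      ultimately show "m \<in> {m \<in> T. (\<forall>i. u $ i \<le> val m $ i) \<and> \<not> (\<forall>i. u $ i \<le> (val m - 1) $ i)}"
        using le by (auto simp: val_def)
    next
      fix m assume "m \<in> {m \<in> T. (\<forall>i. u $ i \<le> val m $ i) \<and> \<not> (\<forall>i. u $ i \<le> (val m - 1) $ i)}"
      then obtain j where j: "\<not> u $ j \<le> (val m - 1) $ j" and le: "\<And>i. u $ i \<le> pairing m (\<nu> i)" and m: "m \<in> S"
        by (auto simp: T_def val_def)
      have "pairing m (\<nu> j) = u $ j" using j le[of j] by (simp add: val_def)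
      then show "m \<in> ((\<Union>j. level u j) - below u) \<inter> S"
        using le m by (auto simp: level_def below_def not_less)
    qed
    then have "dim_series S \<nu> u = (\<Sum>m\<in>T. of_bool ((\<forall>i. u $ i \<le> val m $ i) \<and> \<not> (\<forall>i. u $ i \<le> (val m - 1) $ i)))"
      unfolding dim_series_eq by (simp only: card_T)
    also have "\<dots> = (\<Sum>m\<in>T. orthant (val m) u - orthant (val m - 1) u)"
    proof (rule sum.cong[OF refl])
      fix m
      have "(\<forall>i. u $ i \<le> val m $ i)" if "\<forall>i. u $ i \<le> (val m - 1) $ i"
      proof
        fix i
        have "u $ i \<le> val m $ i - 1" using spec[OF that, of i] by simp
        then show "u $ i \<le> val m $ i" by linarith
      qed
      then show "of_bool ((\<forall>i. u $ i \<le> val m $ i) \<and> \<not> (\<forall>i. u $ i \<le> (val m - 1) $ i)) =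
          orthant (val m) u - orthant (val m - 1) u"
        unfolding orthant_def by auto
    qed
    finally show ?thesis .
  qed
  have "laurent_mult ?p (dim_series S \<nu>) v = conv_act ?p (\<lambda>u. \<Sum>m\<in>T. orthant (val m) u - orthant (val m - 1) u) v"
    unfolding laurent_mult_eq_conv_act conv_act_def
    by (intro sum.cong refl arg_cong2[where f = "(*)"] d) (auto dest: keys_prod_tvar_minus_1_nonneg)
  also have "\<dots> = (\<Sum>m\<in>T. of_bool (v = val m + 1)) - (\<Sum>m\<in>T. of_bool (v = val m))"
    by (simp add: conv_act_sum_right conv_act_diff_right conv sum_subtractf)
  also have "(\<Sum>m\<in>T. of_bool (v = val m + 1)) = monomial_count (v - 1)"
  proof -
    have "{m \<in> S. \<forall>j. pairing m (\<nu> j) = (v - 1) $ j} = {m \<in> T. v = val m + 1}"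
      by (auto simp: T_def val_def vec_eq_iff)
    then show ?thesis by (simp add: monomial_count_def card_T)
  qed
  also have "(\<Sum>m\<in>T. of_bool (v = val m)) = monomial_count v"
  proof -
    have "{m \<in> S. \<forall>j. pairing m (\<nu> j) = v $ j} = {m \<in> T. v = val m}"
      by (auto simp: T_def val_def vec_eq_iff)
    then show ?thesis by (simp add: monomial_count_def card_T)
  qed
  finally show ?thesis .
qed

text \<open>Uniqueness of the quotient by \<open>t\<^sub>1 \<cdots> t\<^sub>r - 1\<close>: the difference of two solutions is constant along the
  diagonal, and vanishes where an index is negative.\<close>

lemma poincare_series_eq: "poincare_series S \<nu> = monomial_count"
  unfolding poincare_series_def
proof (rule the_equality)
  have "0 \<le> v $ i" if "monomial_count v \<noteq> 0" for v i
  proof -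
    have "{m \<in> S. \<forall>j. pairing m (\<nu> j) = v $ j} \<noteq> {}"
      using that unfolding monomial_count_def by (metis card.empty of_nat_0)
    then obtain m where "m \<in> S" "pairing m (\<nu> i) = v $ i" by blast
    then show ?thesis using positive_grading.pairing_nonneg[OF grading] by metis
  qed
  then show main: "is_power_series monomial_count \<and> laurent_mult ((\<Prod>i\<in>UNIV. tvar i) - 1) monomial_count =
      laurent_mult (\<Prod>i\<in>UNIV. (tvar i - 1)) (dim_series S \<nu>)"
    by (simp add: is_power_series_def fun_eq_iff laurent_mult_dim_series)
      (simp add: laurent_mult_eq_conv_act conv_act_prod_tvar_minus_1)
  fix P assume P: "is_power_series P \<and> laurent_mult ((\<Prod>i\<in>UNIV. tvar i) - 1) P =
      laurent_mult (\<Prod>i\<in>UNIV. (tvar i - 1)) (dim_series S \<nu>)"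
  define \<delta> where "\<delta> = (\<lambda>v :: int ^ 'r. P v - monomial_count v)"
  have step: "\<delta> v = \<delta> (v - 1)" for v
  proof -
    have "laurent_mult ((\<Prod>i\<in>UNIV. tvar i) - 1) P v = laurent_mult ((\<Prod>i\<in>UNIV. tvar i) - 1) monomial_count v"
      using P main by simp
    then show ?thesis
      by (simp add: laurent_mult_eq_conv_act conv_act_prod_tvar_minus_1 \<delta>_def)
  qed
  have shift: "\<delta> v = \<delta> (v - (\<chi> i::'r. int k))" for v :: "int ^ 'r" and k
  proof (induction k)
    case 0
    have "v - (\<chi> i::'r. int 0) = v" by (simp add: vec_eq_iff)
    then show ?case by simp
  next
    case (Suc k)
    have eq: "v - (\<chi> i::'r. int k) - 1 = v - (\<chi> i::'r. int (Suc k))" by (simp add: vec_eq_iff)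
    show ?case using trans[OF Suc step[of "v - (\<chi> i::'r. int k)"]] unfolding eq .
  qed
  show "P = monomial_count"
  proof
    fix v :: "int ^ 'r"
    \<comment> \<open>So large that \<open>v\<close> minus \<open>k\<close> times the diagonal has a negative component.\<close>
    define k where "k = nat (v $ undefined + 1)"
    have "(v - (\<chi> i::'r. int k)) $ undefined < 0" by (simp add: k_def)
    then have "\<delta> (v - (\<chi> i::'r. int k)) = 0"
      using P main unfolding is_power_series_def \<delta>_def by (metis diff_0_right leD)
    then show "P v = monomial_count v" using shift[of v k] by (simp add: \<delta>_def)
  qed
qed

theorem poincare_series_eq_euler: "poincare_series S \<nu> = (\<lambda>v. euler_characteristic (PF_fiber S \<nu> v))"
  unfolding poincare_series_eq monomial_count_def euler_characteristic_PF_fiber ..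

end

section \<open>Positivity on the interior of the cone\<close>

lemma real_pairing: "real_of_int (pairing m n) = real_vec m \<bullet> real_vec n"
  by (simp add: pairing_def real_vec_def inner_vec_def)

text \<open>A functional \<open>x\<close> in the dual cone is still nonnegative at the point obtained from \<open>y\<close> by moving against
  the direction of \<open>x\<close> within the cone.\<close>

lemma dual_cone_interior_bound:
  fixes \<sigma> :: "(real ^ 'd) set"
  assumes "y \<in> interior \<sigma>"
  obtains e where "e > 0" "\<And>x. x \<in> dual_cone \<sigma> \<Longrightarrow> e * norm x \<le> x \<bullet> y"
proof -
  obtain e where e: "e > 0" "ball y e \<subseteq> \<sigma>" using assms unfolding mem_interior by blast
  show thesis
  proof (rule that[of "e / 2"])
    fix x assume x: "x \<in> dual_cone \<sigma>"
    define z where "z = y - (e / 2 / norm x) *\<^sub>R x"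
    have "dist y z \<le> e / 2" using e(1) by (simp add: z_def dist_norm)
    then have "z \<in> \<sigma>" using e by (intro subsetD[OF e(2)]) simp
    then have "0 \<le> x \<bullet> z" using x by (simp add: dual_cone_def)
    also have "x \<bullet> z = x \<bullet> y - e / 2 * norm x"
      by (cases "x = 0") (simp_all add: z_def inner_diff_right dot_square_norm power2_eq_square)
    finally show "e / 2 * norm x \<le> x \<bullet> y" by simp
  qed (use e in simp)
qed

lemma finite_lattice_box: "finite {m :: int ^ 'd. \<forall>i. m $ i \<in> {- K..K}}"
proof (rule finite_subset)
  show "{m :: int ^ 'd. \<forall>i. m $ i \<in> {- K..K}} \<subseteq> vec_lambda ` (UNIV \<rightarrow>\<^sub>E {- K..K})"
  proof
    fix m :: "int ^ 'd" assume "m \<in> {m. \<forall>i. m $ i \<in> {- K..K}}"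
    then show "m \<in> vec_lambda ` (UNIV \<rightarrow>\<^sub>E {- K..K})"
      by (intro image_eqI[of _ _ "vec_nth m"]) auto
  qed
  show "finite (vec_lambda ` ((UNIV :: 'd set) \<rightarrow>\<^sub>E {- K..K}))"
    by (intro finite_imageI finite_PiE) auto
qed

lemma toric_filtrationI:
  fixes \<sigma> :: "(real ^ 'd) set" and \<nu> :: "'r::finite \<Rightarrow> int ^ 'd"
  assumes "is_submonoid S" "real_vec ` S \<subseteq> dual_cone \<sigma>" "\<And>i. real_vec (\<nu> i) \<in> interior \<sigma>"
  shows "toric_filtration S \<nu>"
proof
  fix i
  obtain e where e: "e > 0" "\<And>x. x \<in> dual_cone \<sigma> \<Longrightarrow> e * norm x \<le> x \<bullet> real_vec (\<nu> i)"
    using dual_cone_interior_bound[OF assms(3)] by blast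
  have bound: "e * norm (real_vec m) \<le> real_of_int (pairing m (\<nu> i))" if "m \<in> S" for m
    unfolding real_pairing using e(2) assms(2) that by blast
  show "is_submonoid S" by (rule assms(1))
  show "pairing m (\<nu> i) > 0" if m: "m \<in> S" "m \<noteq> 0" for m
  proof -
    have "real_vec m \<noteq> 0" using m(2) by (simp add: real_vec_def vec_eq_iff)
    then have "0 < e * norm (real_vec m)" using e(1) by simp
    then show ?thesis using bound[OF m(1)] by linarith
  qed
  show "finite {m \<in> S. pairing m (\<nu> i) \<le> c}" for c
  proof (rule finite_subset[OF _ finite_lattice_box[of "\<lceil>real_of_int c / e\<rceil>"]])
    show "{m \<in> S. pairing m (\<nu> i) \<le> c} \<subseteq> {m. \<forall>i. m $ i \<in> {- \<lceil>real_of_int c / e\<rceil>..\<lceil>real_of_int c / e\<rceil>}}"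
    proof (intro subsetI CollectI allI)
      fix m k assume m: "m \<in> {m \<in> S. pairing m (\<nu> i) \<le> c}"
      have "e * norm (real_vec m) \<le> real_of_int c"
      proof (rule order_trans[OF bound])
        show "m \<in> S" "real_of_int (pairing m (\<nu> i)) \<le> real_of_int c" using m by simp_all
      qed
      then have "norm (real_vec m) \<le> real_of_int c / e"
        using e(1) by (simp add: field_simps)
      moreover have "\<bar>real_of_int (m $ k)\<bar> \<le> norm (real_vec m)"
        using component_le_norm_cart[of "real_vec m" k] by (simp add: real_vec_def)
      ultimately have "\<bar>real_of_int (m $ k)\<bar> \<le> real_of_int \<lceil>real_of_int c / e\<rceil>"
        by (meson le_of_int_ceiling order_trans)
      then show "m $ k \<in> {- \<lceil>real_of_int c / e\<rceil>..\<lceil>real_of_int c / e\<rceil>}"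
        by auto
    qed
  qed
qed

theorem proposition1:
  fixes \<sigma> :: "(real ^ 'd) set"
    and S :: "(int ^ 'd) set"
    and \<nu> :: "'r::finite \<Rightarrow> int ^ 'd"
  assumes "rational_polyhedral_cone \<sigma>"
    and "strongly_convex \<sigma>"
    and "dim \<sigma> = CARD('d)"
    and "is_submonoid S"
    and "\<exists>G. finite G \<and> S = is_submonoid hull G"
    and "real_vec ` S \<subseteq> dual_cone \<sigma>"
    and "convex_cone hull (real_vec ` S) = dual_cone \<sigma>"
    and "is_subgroup hull S = UNIV"
    and "inj \<nu>"
    and "\<forall>i. real_vec (\<nu> i) \<in> interior \<sigma>"
  shows "poincare_series S \<nu> = (\<lambda>v. euler_characteristic (PF_fiber S \<nu> v))"
proof -
  interpret toric_filtration S \<nu>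
    by (rule toric_filtrationI[OF assms(4,6)]) (use assms(10) in blast)
  show ?thesis by (rule poincare_series_eq_euler)
qed

end
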